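(* Let $L$ be a set of $n$ pairwise skew lines in $\mathbb{R}^3$. Then there are $\Omega(n^{2/3})$ lines of $L$ contained in a single regulus, or there are $\Omega(n^{1/3})$ lines of $L$ no $4$-subset of which is contained in a regulus.
   Context: Lines are pairwise skew if no two of them intersect and no two are parallel. A regulus is the surface in $\mathbb{R}^3$ which is the union of all lines intersecting three given pairwise skew lines; it is a quadric (a hyperbolic paraboloid or a hyperboloid of one sheet) and is doubly ruled. A line lies on (is contained in) a regulus if it is fully contained in the surface. $\Omega(f(n))$ denotes a quantity at least $c f(n)$ for an absolute constant $c>0$ independent of $n$ and $L$. *)

theory Defs
  imports "HOL-Analysis.Analysis"
begin

type_synonym space = "real ^ 3"

definition is_line :: "space set \<Rightarrow> bool" where
  "is_line l \<longleftrightarrow> affine l \<and> aff_dim l = 1"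

definition skew :: "space set \<Rightarrow> space set \<Rightarrow> bool" where
  "skew l m \<longleftrightarrow> l \<inter> m = {} \<and> \<not> affine_parallel l m"

(* Lines "intersect" here in the projective sense: at a point of R^3 or at infinity.
   This is needed for the regulus below to be the whole quadric.  If three pairwise skew
   lines span a hyperboloid of one sheet, then each of them is parallel to exactly one line
   of the opposite ruling; admitting only the lines that meet all three at points of R^3
   would remove these three lines from the surface, which would then contain no line of the
   ruling of the three given lines, not even those lines themselves. *)
definition meets :: "space set \<Rightarrow> space set \<Rightarrow> bool" where
  "meets l m \<longleftrightarrow> l \<inter> m \<noteq> {} \<or> affine_parallel l m"

definition regulus_of :: "space set \<Rightarrow> space set \<Rightarrow> space set \<Rightarrow> space set" where
  "regulus_of a b c = \<Union> {l. is_line l \<and> meets l a \<and> meets l b \<and> meets l c}"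

definition is_regulus :: "space set \<Rightarrow> bool" where
  "is_regulus R \<longleftrightarrow> (\<exists>a b c. is_line a \<and> is_line b \<and> is_line c \<and>
      skew a b \<and> skew a c \<and> skew b c \<and> R = regulus_of a b c)"

definition on_common_regulus :: "space set set \<Rightarrow> bool" where
  "on_common_regulus S \<longleftrightarrow> (\<exists>R. is_regulus R \<and> (\<forall>l\<in>S. l \<subseteq> R))"

end

theory Submission
  imports Defs "HOL-Computational_Algebra.Polynomial"
begin

text \<open>
  A regulus is a quadric, and three pairwise skew lines lie on exactly one. Hence the lines of $L$ on a common
  regulus form blocks such that any three lines of $L$ determine a block. A generic plane meets the lines in
  $n$ points and the blocks in irreducible conics that carry exactly the points of their blocks.
  A Szemeredi-Trotter type bound of Pach and Sharir shows that $O(n^3/k^5 + n/k)$ of these conics contain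
  at least $k$ of the points. If no block has $n^{2/3}$ lines, this bounds the number of $4$-subsets contained
  in a regulus by $O(n^3)$, and a random subset of density $n^{-2/3}$ with one line of each remaining bad
  $4$-subset deleted has $\Omega(n^{1/3})$ lines.

  The bound on rich conics is proved with a vertical decomposition of a random sample of $r \approx k$ conics: the
  bound $I = O(n N^{2/3} + N)$, which only uses that three points determine a conic, is applied in each cell.
  Only the vertical order of the curves at the abscissas of the given points matters, so cells are
  described by a lower curve, an upper curve and an interval of point indices, and the only geometric
  input is that the order of two curves changes a bounded number of times.\<close>


text \<open>Counting triples alone gives O(n^3/k^3) blocks with at least k lines. Weighted by k^3
  and summed up to block size m, this is of order n^3 m, which is too large. The exponent 5 makes
  the weighted main term n^3/k^2 summable. The remaining term n/k contributes n m^3, which is O(n^3)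
  as long as m is O(n^(2/3)); this is the source of the exponent 2/3.

  In the sampling argument no cell is required to have few conflicting curves. Only two averages
  over the samples matter: the conflicts of the cells of all points, and the conflicts of all cells.
  The bound inside a cell carries a free real parameter that makes it linear in these quantities, so
  it can be summed over cells and averaged over samples directly.

  A further obstacle is that the regulus through a bad 4-subset may be generated by lines outside L.
  The chart must therefore be generic for those lines too, and uniqueness of the quadric brings the
  regulus back to three lines of L.\<close>

section \<open>Cell decompositions of curve arrangements\<close>

text \<open>The points are numbered by increasing abscissa. The value \<^term>\<open>key t h\<close> is the height of the curve
  \<^term>\<open>h\<close> at the abscissa of point \<^term>\<open>t\<close>, with ties broken, and \<^term>\<open>side t h\<close> is negative, zero or
  positive if \<^term>\<open>h\<close> passes below, through or above that point. The curves \<^term>\<open>bot\<close> and \<^term>\<open>top\<close> are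
  artificial.\<close>

locale cell_decomposition =
  fixes n :: nat and F :: "'c set" and bot top :: 'c
    and key :: "nat \<Rightarrow> 'c \<Rightarrow> real" and side :: "nat \<Rightarrow> 'c \<Rightarrow> int" and b :: nat
  assumes fin: "finite F" and bot_notin: "bot \<notin> F" and top_notin: "top \<notin> F" and bot_top: "bot \<noteq> top"
    and key_inj: "t < n \<Longrightarrow> inj_on (key t) F"
    and key_bot: "t < n \<Longrightarrow> h \<in> insert top F \<Longrightarrow> key t bot < key t h"
    and key_top: "t < n \<Longrightarrow> h \<in> insert bot F \<Longrightarrow> key t h < key t top"
    and side_mono: "t < n \<Longrightarrow> h \<in> insert bot (insert top F) \<Longrightarrow> h' \<in> insert bot (insert top F) \<Longrightarrow>
          side t h < side t h' \<Longrightarrow> key t h < key t h'"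
    and side_bot: "side t bot < 0" and side_top: "0 < side t top"
    and flips: "h \<in> F \<Longrightarrow> h' \<in> F \<Longrightarrow>
          card {t. 0 < t \<and> t < n \<and> (key (t-1) h < key (t-1) h') \<noteq> (key t h < key t h')} \<le> b"
begin

text \<open>A cell of the arrangement \<^term>\<open>R\<close> is a triple of a lower curve, an upper curve and a maximal interval
  of point indices on which no curve of \<^term>\<open>R\<close> runs between them. Only the cells that contain a point off
  the curves of \<^term>\<open>R\<close> are considered.\<close>

definition good :: "'c set \<Rightarrow> 'c \<Rightarrow> 'c \<Rightarrow> nat \<Rightarrow> bool" where
  "good R g f s \<longleftrightarrow> key s g < key s f \<and> (\<forall>h\<in>R. \<not> (key s g < key s h \<and> key s h < key s f))"

definition span_of :: "'c set \<Rightarrow> 'c \<Rightarrow> 'c \<Rightarrow> nat \<Rightarrow> nat set" where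
  "span_of R g f t = {t'. t' < n \<and> (\<forall>s. (t \<le> s \<and> s \<le> t' \<or> t' \<le> s \<and> s \<le> t) \<longrightarrow> good R g f s)}"

definition off :: "'c set \<Rightarrow> nat \<Rightarrow> bool" where
  "off R t \<longleftrightarrow> t < n \<and> (\<forall>h\<in>R. side t h \<noteq> 0)"

definition is_cell :: "'c set \<Rightarrow> nat \<Rightarrow> 'c \<times> 'c \<times> nat set \<Rightarrow> bool" where
  "is_cell R t \<tau> \<longleftrightarrow> (\<exists>g f. \<tau> = (g, f, span_of R g f t) \<and> g \<in> insert bot R \<and> f \<in> insert top R \<and>
      side t g < 0 \<and> 0 < side t f \<and> good R g f t)"

text \<open>The choice is harmless: a point off \<open>R\<close> has exactly one candidate.\<close>

definition cell :: "'c set \<Rightarrow> nat \<Rightarrow> 'c \<times> 'c \<times> nat set" where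
  "cell R t = (SOME \<tau>. is_cell R t \<tau>)"

definition cells :: "'c set \<Rightarrow> ('c \<times> 'c \<times> nat set) set" where
  "cells R = cell R ` {t. off R t}"

text \<open>Entering the cell at a single index already counts; a sample that has this cell contains
  no such curve.\<close>

definition conflicts :: "'c \<times> 'c \<times> nat set \<Rightarrow> 'c set" where
  "conflicts \<tau> = {h \<in> F. \<exists>s \<in> snd (snd \<tau>). key s (fst \<tau>) < key s h \<and> key s h < key s (fst (snd \<tau>))}"

lemma key_inj':
  assumes "t < n" "h \<in> insert bot (insert top F)" "h' \<in> insert bot (insert top F)" "key t h = key t h'"
  shows "h = h'"
proof -
  have "h \<in> F \<Longrightarrow> h' \<in> F \<Longrightarrow> h = h'" using key_inj[OF assms(1)] assms(4) by (auto dest: inj_onD)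
  moreover have "key t bot < key t top" using key_bot[OF assms(1)] by auto
  moreover have "\<And>x. x \<in> F \<Longrightarrow> key t bot < key t x \<and> key t x < key t top"
    using key_bot[OF assms(1)] key_top[OF assms(1)] by auto
  ultimately show ?thesis using assms(2-4) by (metis insertE less_irrefl)
qed

text \<open>The bounds are the highest curve below the point and the lowest one above it;
  \<open>bot\<close> and \<open>top\<close> guarantee that both exist. Since the point is off
  \<open>R\<close>, every curve of \<open>R\<close> is on one of the two sides, so none runs between
  the bounds.\<close>

lemma is_cell_exists:
  assumes "R \<subseteq> F" "off R t"
  shows "\<exists>\<tau>. is_cell R t \<tau>"
proof -
  have tn: "t < n" using assms(2) by (simp add: off_def)
  have fR: "finite R" using assms(1) fin finite_subset by blast
  define A where "A = {h \<in> insert bot R. side t h < 0}"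
  define B where "B = {h \<in> insert top R. 0 < side t h}"
  have A: "finite A" "A \<noteq> {}" using fR side_bot by (auto simp: A_def)
  have B: "finite B" "B \<noteq> {}" using fR side_top by (auto simp: B_def)
  have "Max (key t ` A) \<in> key t ` A" "Min (key t ` B) \<in> key t ` B" using A B by (auto intro!: Max_in Min_in)
  then obtain g f where gf: "g \<in> A" "Max (key t ` A) = key t g" "f \<in> B" "Min (key t ` B) = key t f" by (auto elim!: imageE)
  have g: "g \<in> A" "\<And>h. h \<in> A \<Longrightarrow> key t h \<le> key t g"
    using gf A Max_ge[of "key t ` A"] by auto
  have f: "f \<in> B" "\<And>h. h \<in> B \<Longrightarrow> key t f \<le> key t h"
    using gf B Min_le[of "key t ` B"] by auto
  have gf: "key t g < key t f"
    by (rule side_mono[OF tn]) (use g f assms(1) in \<open>auto simp: A_def B_def\<close>)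
  have "\<not> (key t g < key t h \<and> key t h < key t f)" if "h \<in> R" for h
  proof -
    have "side t h < 0 \<or> 0 < side t h" using assms(2) that by (force simp: off_def)
    then have "h \<in> A \<or> h \<in> B" using that by (auto simp: A_def B_def)
    then show ?thesis using g(2) f(2) by force
  qed
  then have "good R g f t" using gf by (auto simp: good_def)
  then have "is_cell R t (g, f, span_of R g f t)"
    using g(1) f(1) unfolding is_cell_def A_def B_def by blast
  then show ?thesis by blast
qed

text \<open>By \<open>side_mono\<close> a curve below the point has a smaller key than the upper
  bound of any candidate, and \<open>good\<close> keeps it out of the gap, so it does not exceed the
  lower bound of that candidate. Applied both ways this identifies the lower bounds, and
  symmetrically the upper ones.\<close>

lemma is_cell_unique:
  assumes "R \<subseteq> F" "off R t" "is_cell R t \<tau>" "is_cell R t \<tau>'"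
  shows "\<tau> = \<tau>'"
proof -
  have tn: "t < n" using assms(2) by (simp add: off_def)
  obtain g f where 1: "\<tau> = (g, f, span_of R g f t)" "g \<in> insert bot R" "f \<in> insert top R"
      "side t g < 0" "0 < side t f" "good R g f t" using assms(3) unfolding is_cell_def by blast
  obtain g' f' where 2: "\<tau>' = (g', f', span_of R g' f' t)" "g' \<in> insert bot R" "f' \<in> insert top R"
      "side t g' < 0" "0 < side t f'" "good R g' f' t" using assms(4) unfolding is_cell_def by blast
  have le: "key t g1 \<le> key t g2" if "g1 \<in> insert bot R" "side t g1 < 0" "good R g2 f2 t"
     "g2 \<in> insert bot R" "f2 \<in> insert top R" "0 < side t f2" for g1 g2 f2
  proof (cases "g1 = bot")
    case True then show ?thesis using key_bot[OF tn, of g2] that assms(1) by fastforce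
  next
    case False
    then have "g1 \<in> R" using that by auto
    moreover have "key t g1 < key t f2" by (rule side_mono[OF tn]) (use that assms(1) in auto)
    ultimately show ?thesis using that(3) unfolding good_def by force
  qed
  have ge: "key t f2 \<le> key t f1" if "f1 \<in> insert top R" "0 < side t f1" "good R g2 f2 t"
     "g2 \<in> insert bot R" "f2 \<in> insert top R" "side t g2 < 0" for f1 g2 f2
  proof (cases "f1 = top")
    case True then show ?thesis using key_top[OF tn, of f2] that assms(1) by fastforce
  next
    case False
    then have "f1 \<in> R" using that by auto
    moreover have "key t g2 < key t f1" by (rule side_mono[OF tn]) (use that assms(1) in auto)
    ultimately show ?thesis using that(3) unfolding good_def by force
  qed
  have "key t g = key t g'" using le 1 2 by (meson antisym)
  then have "g = g'" using key_inj'[OF tn] 1(2) 2(2) assms(1) by blast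
  moreover have "key t f = key t f'" using ge 1 2 by (meson antisym)
  then have "f = f'" using key_inj'[OF tn] 1(3) 2(3) assms(1) by blast
  ultimately show ?thesis using 1 2 by simp
qed

lemma cell_eqI: "R \<subseteq> F \<Longrightarrow> off R t \<Longrightarrow> is_cell R t \<tau> \<Longrightarrow> cell R t = \<tau>"
  using is_cell_unique[of R t] unfolding cell_def by (metis someI)

lemma is_cell_cell: "R \<subseteq> F \<Longrightarrow> off R t \<Longrightarrow> is_cell R t (cell R t)"
  using is_cell_exists unfolding cell_def by (metis someI)

lemma cellE:
  assumes "R \<subseteq> F" "off R t"
  obtains g f where "cell R t = (g, f, span_of R g f t)" "g \<in> insert bot R" "f \<in> insert top R"
      "side t g < 0" "0 < side t f" "good R g f t" "t \<in> span_of R g f t"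
proof -
  obtain g f where *: "cell R t = (g, f, span_of R g f t)" "g \<in> insert bot R" "f \<in> insert top R"
      "side t g < 0" "0 < side t f" "good R g f t"
    using is_cell_cell[OF assms] unfolding is_cell_def by blast
  then have "t \<in> span_of R g f t" using assms(2) by (auto simp: span_of_def off_def dest: antisym)
  with * that show ?thesis by blast
qed

lemma conflicts_disjoint:
  assumes "R \<subseteq> F" "off R t"
  shows "conflicts (cell R t) \<inter> R = {}"
proof -
  obtain g f where *: "cell R t = (g, f, span_of R g f t)" by (rule cellE[OF assms])
  have "good R g f s" if "s \<in> span_of R g f t" for s using that by (auto simp: span_of_def)
  then show ?thesis unfolding conflicts_def * by (auto simp: good_def)
qed

lemma span_interval:
  assumes "x \<in> span_of R g f t" "y \<in> span_of R g f t" "x \<le> s" "s \<le> y"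
  shows "s \<in> span_of R g f t"
proof -
  have "good R g f u" if "t \<le> u \<and> u \<le> s \<or> s \<le> u \<and> u \<le> t" for u
  proof -
    have "((t \<le> u \<and> u \<le> x \<or> x \<le> u \<and> u \<le> t)) \<or> ((t \<le> u \<and> u \<le> y \<or> y \<le> u \<and> u \<le> t))" using that assms(3,4) by linarith
    then show ?thesis using assms(1,2) by (auto simp: span_of_def)
  qed
  then show ?thesis using assms by (auto simp: span_of_def)
qed

lemma span_of_rebase:
  assumes "a \<in> span_of R g f t" "t < n"
  shows "span_of R g f a = span_of R g f t"
proof -
  have g: "good R g f s" if "t \<le> s \<and> s \<le> a \<or> a \<le> s \<and> s \<le> t" for s
    using assms(1) that by (auto simp: span_of_def)
  have "good R g f s" if "\<forall>s. (a \<le> s \<and> s \<le> x \<or> x \<le> s \<and> s \<le> a) \<longrightarrow> good R g f s" "t \<le> s \<and> s \<le> x \<or> x \<le> s \<and> s \<le> t" for x s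
  proof -
    have "((t \<le> s \<and> s \<le> a \<or> a \<le> s \<and> s \<le> t)) \<or> ((a \<le> s \<and> s \<le> x \<or> x \<le> s \<and> s \<le> a))" using that(2) by linarith
    then show ?thesis using that(1) g by blast
  qed
  moreover have "good R g f s" if "\<forall>s. (t \<le> s \<and> s \<le> x \<or> x \<le> s \<and> s \<le> t) \<longrightarrow> good R g f s" "a \<le> s \<and> s \<le> x \<or> x \<le> s \<and> s \<le> a" for x s
  proof -
    have "((t \<le> s \<and> s \<le> a \<or> a \<le> s \<and> s \<le> t)) \<or> ((t \<le> s \<and> s \<le> x \<or> x \<le> s \<and> s \<le> t))" using that(2) by linarith
    then show ?thesis using that(1) g by blast
  qed
  ultimately show ?thesis unfolding span_of_def by blast
qed

text \<open>Four curves pin down a cell: its two bounds, and on each side of the span one curve that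
  enters the gap just beyond the end. No such curve is needed where the index range ends or where
  the bounds themselves change order. Passing to a subset of \<open>R\<close> preserves
  \<open>good\<close>, so the span could only grow, and the stopping curves prevent this.\<close>

lemma cell_witness:
  assumes "R \<subseteq> F" "off R t"
  shows "\<exists>D\<subseteq>R. card D \<le> 4 \<and> (\<forall>R'. D \<subseteq> R' \<and> R' \<subseteq> R \<longrightarrow> cell R' t = cell R t)"
proof -
  obtain g f where c: "cell R t = (g, f, span_of R g f t)" "g \<in> insert bot R" "f \<in> insert top R"
      "side t g < 0" "0 < side t f" "good R g f t" "t \<in> span_of R g f t" by (rule cellE[OF assms])
  let ?J = "span_of R g f t"
  have tn: "t < n" using assms(2) by (simp add: off_def)
  have fJ: "finite ?J" by (simp add: span_of_def)
  have bad: "\<exists>D\<subseteq>R. card D \<le> 1 \<and> (\<forall>R'. D \<subseteq> R' \<longrightarrow> \<not> good R' g f s)" if "\<not> good R g f s" for s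
  proof (cases "key s g < key s f")
    case True
    then have "\<exists>h\<in>R. key s g < key s h \<and> key s h < key s f" using that by (simp add: good_def)
    then obtain h where "h \<in> R" "key s g < key s h" "key s h < key s f" by blast
    then show ?thesis by (intro exI[of _ "{h}"]) (auto simp: good_def)
  next
    case False then show ?thesis by (intro exI[of _ "{}"]) (auto simp: good_def)
  qed
  define l where "l = Min ?J"
  define u where "u = Max ?J"
  have lJ: "l \<in> ?J" "u \<in> ?J" "l \<le> t" "t \<le> u" "u < n"
  proof -
    have ne: "?J \<noteq> {}" using c(7) by blast
    show "l \<in> ?J" unfolding l_def by (rule Min_in[OF fJ ne])
    show u: "u \<in> ?J" unfolding u_def by (rule Max_in[OF fJ ne])
    show "l \<le> t" unfolding l_def by (rule Min_le[OF fJ c(7)])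
    show "t \<le> u" unfolding u_def by (rule Max_ge[OF fJ c(7)])
    show "u < n" using u by (simp add: span_of_def)
  qed
  have gd: "good R g f s" if "l \<le> s" "s \<le> u" for s
    using span_interval[OF lJ(1,2) that] by (auto simp: span_of_def)
  have "\<exists>D\<subseteq>R. card D \<le> 1 \<and> (0 < l \<longrightarrow> (\<forall>R'. D \<subseteq> R' \<longrightarrow> \<not> good R' g f (l - 1)))"
  proof (cases "0 < l")
    case True
    have "\<not> good R g f (l - 1)"
    proof
      assume "good R g f (l - 1)"
      then have "good R g f s" if "l - 1 \<le> s" "s \<le> t" for s
        using gd[of s] that lJ by (cases "s = l - 1") auto
      then have "l - 1 \<in> ?J" using lJ tn by (auto simp: span_of_def)
      then have "l \<le> l - 1" using Min_le[OF fJ] l_def by blast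
      then show False using True by simp
    qed
    from bad[OF this] show ?thesis by blast
  qed auto
  then obtain D1 where D1: "D1 \<subseteq> R" "card D1 \<le> 1" "0 < l \<Longrightarrow> D1 \<subseteq> R' \<Longrightarrow> \<not> good R' g f (l - 1)" for R' by blast
  have "\<exists>D\<subseteq>R. card D \<le> 1 \<and> (u + 1 < n \<longrightarrow> (\<forall>R'. D \<subseteq> R' \<longrightarrow> \<not> good R' g f (u + 1)))"
  proof (cases "u + 1 < n")
    case True
    have "\<not> good R g f (u + 1)"
    proof
      assume "good R g f (u + 1)"
      then have "good R g f s" if "t \<le> s" "s \<le> u + 1" for s
        using gd[of s] that lJ by (cases "s = u + 1") auto
      then have "u + 1 \<in> ?J" using lJ True by (auto simp: span_of_def)
      then have "u + 1 \<le> u" using Max_ge[OF fJ] u_def by blast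
      then show False by simp
    qed
    from bad[OF this] show ?thesis by blast
  qed auto
  then obtain D2 where D2: "D2 \<subseteq> R" "card D2 \<le> 1" "u + 1 < n \<Longrightarrow> D2 \<subseteq> R' \<Longrightarrow> \<not> good R' g f (u + 1)" for R' by blast
  define D where "D = ({g} \<inter> R) \<union> ({f} \<inter> R) \<union> D1 \<union> D2"
  have "card ({g} \<inter> R) \<le> 1" "card ({f} \<inter> R) \<le> 1" by (auto simp: card_le_Suc0_iff_eq)
  then have "card D \<le> 4" unfolding D_def
    using D1(2) D2(2) card_Un_le[of "{g} \<inter> R" "{f} \<inter> R"] card_Un_le[of "({g} \<inter> R) \<union> ({f} \<inter> R)" D1]
      card_Un_le[of "({g} \<inter> R) \<union> ({f} \<inter> R) \<union> D1" D2] by linarith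
  moreover have "D \<subseteq> R" using D1 D2 by (auto simp: D_def)
  moreover have "cell R' t = cell R t" if R': "D \<subseteq> R'" "R' \<subseteq> R" for R'
  proof -
    have mono: "good R g f s \<Longrightarrow> good R' g f s" for s using R' by (auto simp: good_def)
    have off': "off R' t" using assms(2) R' by (auto simp: off_def)
    have gf: "g \<in> insert bot R'" "f \<in> insert top R'" using c(2,3) R'(1) by (auto simp: D_def)
    have "span_of R' g f t = ?J"
    proof
      show "?J \<subseteq> span_of R' g f t" using mono by (auto simp: span_of_def)
      show "span_of R' g f t \<subseteq> ?J"
      proof
        fix x assume x: "x \<in> span_of R' g f t"
        have "l \<le> x"
        proof (rule ccontr)
          assume "\<not> l \<le> x"
          then have "(t \<le> l - 1 \<and> l - 1 \<le> x \<or> x \<le> l - 1 \<and> l - 1 \<le> t)" "0 < l" using lJ by auto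
          then have "good R' g f (l - 1)" using x by (auto simp: span_of_def)
          then show False using D1(3)[of R'] \<open>0 < l\<close> R'(1) by (auto simp: D_def)
        qed
        moreover have "x \<le> u"
        proof (rule ccontr)
          assume "\<not> x \<le> u"
          then have "(t \<le> u + 1 \<and> u + 1 \<le> x \<or> x \<le> u + 1 \<and> u + 1 \<le> t)" "u + 1 < n" using lJ x by (auto simp: span_of_def)
          then have "good R' g f (u + 1)" using x by (auto simp: span_of_def)
          then show False using D2(3)[of R'] \<open>u + 1 < n\<close> R'(1) by (auto simp: D_def)
        qed
        ultimately show "x \<in> ?J" using span_interval[OF lJ(1,2)] by blast
      qed
    qed
    then have "is_cell R' t (g, f, ?J)" unfolding is_cell_def using gf c mono by auto
    then show ?thesis using cell_eqI[OF _ off'] R' assms(1) c(1) by simp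
  qed
  ultimately show ?thesis by blast
qed

text \<open>A cell is determined by one of its two bounding curves together with the left end of its time span,
  and if this left end is not $0$, the chosen curve takes part in an order flip there.\<close>

lemma card_cells_le:
  assumes "R \<subseteq> F"
  shows "card (cells R) \<le> 2 * (b + 1) * (card R + 1)^2"
proof -
  have fR: "finite R" using assms fin finite_subset by blast
  define fl where "fl h h' = {t. 0 < t \<and> t < n \<and> (key (t-1) h < key (t-1) h') \<noteq> (key t h < key t h')}" for h h'
  \<comment> \<open>Candidates for the left end of a span bounded by \<open>h\<close>: index 0 and
    the order flips of \<open>h\<close> with curves of \<open>R\<close>. The artificial curves never
    flip and get only 0.\<close>
  define E where "E h = insert 0 (\<Union>h'\<in>R. if h \<in> R then fl h h' else {})" for h
  have ffl: "finite (fl h h')" for h h' unfolding fl_def by (rule finite_subset[of _ "{..<n}"]) auto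
  have fl_sym: "t \<in> fl h h' \<Longrightarrow> h \<in> R \<Longrightarrow> h' \<in> R \<Longrightarrow> t \<in> fl h' h" for t h h'
  proof -
    assume a: "t \<in> fl h h'" "h \<in> R" "h' \<in> R"
    then have "h \<noteq> h'" by (auto simp: fl_def)
    moreover have "t < n" "t - 1 < n" "h \<in> F" "h' \<in> F" using a assms by (auto simp: fl_def)
    ultimately have "key t h \<noteq> key t h'" "key (t-1) h \<noteq> key (t-1) h'"
      using key_inj'[of t h h'] key_inj'[of "t-1" h h'] by blast+
    then show ?thesis using a by (auto simp: fl_def)
  qed
  have cardE: "card (E h) \<le> 1 + card R * b" "finite (E h)" for h
  proof -
    have "card (\<Union>h'\<in>R. if h \<in> R then fl h h' else {}) \<le> (\<Sum>h'\<in>R. card (if h \<in> R then fl h h' else {}))"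
      by (rule card_UN_le[OF fR])
    also have "\<dots> \<le> (\<Sum>h'\<in>R. b)" by (rule sum_mono) (use flips assms in \<open>auto simp: fl_def\<close>)
    finally show "card (E h) \<le> 1 + card R * b" unfolding E_def
      using card_insert_le_m1[of 1] by (subst card_insert_if) (use fR ffl in auto)
    show "finite (E h)" unfolding E_def using fR ffl by auto
  qed
  define PF where "PF = (SIGMA f:insert top R. E f)"
  define PG where "PG = (SIGMA g:insert bot R. E g)"
  have cP: "card PF \<le> (card R + 1) * (1 + card R * b)" "finite PF"
   "card PG \<le> (card R + 1) * (1 + card R * b)" "finite PG"
  proof -
    have *: "card (SIGMA f:insert z R. E f) \<le> (card R + 1) * (1 + card R * b)" for z
    proof -
      have "card (SIGMA f:insert z R. E f) = (\<Sum>f\<in>insert z R. card (E f))"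
        by (rule card_SigmaI) (use fR cardE in auto)
      also have "\<dots> \<le> (\<Sum>f\<in>insert z R. 1 + card R * b)" by (rule sum_mono) (use cardE in auto)
      also have "\<dots> = card (insert z R) * (1 + card R * b)" by simp
      also have "\<dots> \<le> (card R + 1) * (1 + card R * b)"
        by (rule mult_le_mono1) (use fR in \<open>simp add: card_insert_if\<close>)
      finally show ?thesis .
    qed
    show "card PF \<le> (card R + 1) * (1 + card R * b)" "card PG \<le> (card R + 1) * (1 + card R * b)"
      unfolding PF_def PG_def using * by auto
    show "finite PF" "finite PG" unfolding PF_def PG_def using fR cardE by auto
  qed
  define CF where "CF = {\<tau> \<in> cells R. (fst (snd \<tau>), Min (snd (snd \<tau>))) \<in> PF}"
  define CG where "CG = {\<tau> \<in> cells R. (fst \<tau>, Min (snd (snd \<tau>))) \<in> PG}"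
  have rep: "\<exists>g f l. \<tau> = (g, f, span_of R g f l) \<and> l = Min (span_of R g f l) \<and> g \<in> insert bot R \<and> f \<in> insert top R \<and>
     l < n \<and> good R g f l \<and> (0 < l \<longrightarrow> \<not> good R g f (l-1))" if "\<tau> \<in> cells R" for \<tau>
  proof -
    obtain t where t: "off R t" "\<tau> = cell R t" using \<open>\<tau> \<in> cells R\<close> by (auto simp: cells_def)
    obtain g f where c: "cell R t = (g, f, span_of R g f t)" "g \<in> insert bot R" "f \<in> insert top R"
      "t \<in> span_of R g f t" by (rule cellE[OF assms t(1)])
    have fJ: "finite (span_of R g f t)" by (simp add: span_of_def)
    define l where "l = Min (span_of R g f t)"
    have l: "l \<in> span_of R g f t" unfolding l_def using Min_in[OF fJ] c(4) by blast
    have eq: "span_of R g f l = span_of R g f t" by (rule span_of_rebase[OF l]) (use t in \<open>simp add: off_def\<close>)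
    have ln: "l < n" "good R g f l" using l by (auto simp: span_of_def)
    have "\<not> good R g f (l-1)" if "0 < l"
    proof
      assume "good R g f (l-1)"
      then have "good R g f s" if "l - 1 \<le> s" "s \<le> l" for s
        using that ln by (cases "s = l") (auto simp: le_less_Suc_eq dest!: le_neq_implies_less dest: antisym)
      then have "l - 1 \<in> span_of R g f l" using ln by (auto simp: span_of_def)
      then have "l \<le> l - 1" using eq fJ unfolding l_def by simp
      then show False using that by simp
    qed
    moreover have "\<tau> = (g, f, span_of R g f l)" "l = Min (span_of R g f l)"
      unfolding eq using c(1) t(2) l_def by simp_all
    ultimately show ?thesis using c(2,3) ln by blast
  qed
  have "cells R \<subseteq> CF \<union> CG"
  proof
    fix \<tau> assume tau: "\<tau> \<in> cells R"
    then obtain g f l where r: "\<tau> = (g, f, span_of R g f l)" "l = Min (span_of R g f l)" "g \<in> insert bot R" "f \<in> insert top R"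
     "l < n" "good R g f l" "0 < l \<longrightarrow> \<not> good R g f (l-1)" using rep by blast
    have "l \<in> E f \<or> l \<in> E g"
    proof (cases "l = 0")
      case False
      \<comment> \<open>Either the bounds swap their order at \<open>l\<close>, or a curve
        \<open>h\<close> that was between them at \<open>l - 1\<close> has left the gap through
        \<open>f\<close> or through \<open>g\<close>.\<close>
      then have ng: "\<not> good R g f (l-1)" and l0: "0 < l" and ln: "l - 1 < n" using r by auto
      show ?thesis
      proof (cases "key (l-1) g < key (l-1) f")
        case False
        have "g \<noteq> bot" using False key_bot[OF ln, of f] r(4) assms by blast
        moreover have "f \<noteq> top" using False key_top[OF ln, of g] r(3) assms by blast
        moreover have "key l g < key l f" using r(6) by (auto simp: good_def)
        ultimately have "g \<in> R" "f \<in> R" "l \<in> fl g f" using r False l0 by (auto simp: fl_def)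
        then show ?thesis by (auto simp: E_def)
      next
        case True
        then obtain h where h: "h \<in> R" "key (l-1) g < key (l-1) h" "key (l-1) h < key (l-1) f"
          using ng by (auto simp: good_def)
        have nh: "\<not> (key l g < key l h \<and> key l h < key l f)" using r(6) h by (auto simp: good_def)
        show ?thesis
        proof (cases "key l g < key l h")
          case True
          then have "\<not> key l h < key l f" using nh by blast
          then have "f \<noteq> top" using key_top[OF r(5), of h] h assms by blast
          then have fR: "f \<in> R" using r by auto
          have "l \<in> fl h f" using \<open>\<not> key l h < key l f\<close> h l0 r(5) by (auto simp: fl_def)
          then show ?thesis using fl_sym h fR by (auto simp: E_def)
        next
          case False
          then have "g \<noteq> bot" using key_bot[OF r(5), of h] h assms by blast
          then have gR: "g \<in> R" using r by auto
          have "l \<in> fl g h" using False h l0 r(5) by (auto simp: fl_def)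
          then show ?thesis using h gR by (auto simp: E_def)
        qed
      qed
    qed (auto simp: E_def)
    then show "\<tau> \<in> CF \<union> CG" using tau r by (auto simp: CF_def CG_def PF_def PG_def)
  qed
  moreover have "inj_on (\<lambda>\<tau>. (fst (snd \<tau>), Min (snd (snd \<tau>)))) CF"
  proof (rule inj_onI)
    fix x y assume xy: "x \<in> CF" "y \<in> CF" "(fst (snd x), Min (snd (snd x))) = (fst (snd y), Min (snd (snd y)))"
    obtain g f l where r: "x = (g, f, span_of R g f l)" "l = Min (span_of R g f l)" "g \<in> insert bot R" "f \<in> insert top R"
     "l < n" "good R g f l" using rep xy(1) unfolding CF_def by blast
    obtain g' f' l' where r': "y = (g', f', span_of R g' f' l')" "l' = Min (span_of R g' f' l')" "g' \<in> insert bot R" "f' \<in> insert top R"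
     "l' < n" "good R g' f' l'" using rep xy(2) unfolding CF_def by blast
    have e: "f' = f" "l' = l" using xy(3) r(1,2) r'(1,2) by auto
    \<comment> \<open>With a common upper bound, the lower bound with the larger key would lie
      inside the other gap, unless it is \<open>bot\<close>, whose key is smallest anyway.\<close>
    have "key l g' \<le> key l g"
      using r(6) r'(6) e r'(3) key_bot[OF r(5), of g] r(3) assms by (cases "g' = bot") (force simp: good_def)+
    moreover have "key l g \<le> key l g'"
      using r(6) r'(6) e r(3) key_bot[OF r(5), of g'] r'(3) assms by (cases "g = bot") (force simp: good_def)+
    ultimately have "g = g'" using key_inj'[OF r(5), of g g'] r(3) r'(3) assms by auto
    then show "x = y" using r(1) r'(1) e by simp
  qed
  then have "card CF \<le> card PF" by (rule card_inj_on_le) (use cP in \<open>auto simp: CF_def\<close>)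
  moreover have "inj_on (\<lambda>\<tau>. (fst \<tau>, Min (snd (snd \<tau>)))) CG"
  proof (rule inj_onI)
    fix x y assume xy: "x \<in> CG" "y \<in> CG" "(fst x, Min (snd (snd x))) = (fst y, Min (snd (snd y)))"
    obtain g f l where r: "x = (g, f, span_of R g f l)" "l = Min (span_of R g f l)" "g \<in> insert bot R" "f \<in> insert top R"
     "l < n" "good R g f l" using rep xy(1) unfolding CG_def by blast
    obtain g' f' l' where r': "y = (g', f', span_of R g' f' l')" "l' = Min (span_of R g' f' l')" "g' \<in> insert bot R" "f' \<in> insert top R"
     "l' < n" "good R g' f' l'" using rep xy(2) unfolding CG_def by blast
    have e: "g' = g" "l' = l" using xy(3) r(1,2) r'(1,2) by auto
    have "key l f' \<le> key l f"
      using r(6) r'(6) e r(4) key_top[OF r(5), of f'] r'(4) assms by (cases "f = top") (force simp: good_def)+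
    moreover have "key l f \<le> key l f'"
      using r(6) r'(6) e r'(4) key_top[OF r(5), of f] r(4) assms by (cases "f' = top") (force simp: good_def)+
    ultimately have "f = f'" using key_inj'[OF r(5), of f f'] r(4) r'(4) assms by auto
    then show "x = y" using r(1) r'(1) e by simp
  qed
  then have "card CG \<le> card PG" by (rule card_inj_on_le) (use cP in \<open>auto simp: CG_def\<close>)
  moreover have "finite (cells R)" unfolding cells_def off_def by simp
  then have "finite (CF \<union> CG)" unfolding CF_def CG_def by simp
  ultimately have "card (cells R) \<le> card PF + card PG"
    using card_mono[of "CF \<union> CG" "cells R"] card_Un_le[of CF CG] by linarith
  also have "\<dots> \<le> 2 * ((card R + 1) * (1 + card R * b))" using cP by simp
  also have "\<dots> \<le> 2 * ((card R + 1) * ((b + 1) * (card R + 1)))" by (intro mult_le_mono) (auto simp: algebra_simps)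
  finally show ?thesis by (simp only: power2_eq_square mult_ac)
qed

end

section \<open>Average numbers of conflicts over random samples\<close>

lemma sum_indicator_nat: "finite A \<Longrightarrow> (\<Sum>x\<in>A. if P x then 1 else 0) = card {x \<in> A. P x}"
  unfolding card_eq_sum by (rule sum.inter_filter[symmetric])

context cell_decomposition begin

text \<open>The sample space: a sum over it is \<open>card F choose r\<close> times an
  expectation.\<close>

definition subsets :: "nat \<Rightarrow> 'c set set" where
  "subsets r = {R. R \<subseteq> F \<and> card R = r}"

lemma finite_subsets: "finite (subsets r)"
  unfolding subsets_def by (rule finite_subset[of _ "Pow F"]) (use fin in auto)

lemma card_subsets: "card (subsets r) = card F choose r"
  unfolding subsets_def by (rule n_subsets[OF fin])

lemma subsetsD: "R \<in> subsets r \<Longrightarrow> R \<subseteq> F \<and> card R = r \<and> finite R"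
  unfolding subsets_def using finite_subset[OF _ fin] by auto

lemma subsets_insert: "R \<in> subsets r \<Longrightarrow> h \<in> F \<Longrightarrow> h \<notin> R \<Longrightarrow> insert h R \<in> subsets (r+1)"
  by (frule subsetsD) (simp add: subsets_def)

lemma subsets_remove: "R \<in> subsets (r+1) \<Longrightarrow> h \<in> R \<Longrightarrow> R - {h} \<in> subsets r \<and> h \<in> F"
  by (frule subsetsD) (auto simp: subsets_def)

lemma bij_insert_remove:
  "bij_betw (\<lambda>(R, h). (insert h R, h)) (SIGMA R:subsets r. F - R) (SIGMA R:subsets (r+1). R)"
proof (rule bij_betw_byWitness[where f' = "\<lambda>(R, h). (R - {h}, h)"])
  show "(\<lambda>(R, h). (insert h R, h)) ` (SIGMA R:subsets r. F - R) \<subseteq> (SIGMA R:subsets (r+1). R)"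
  proof (rule image_subsetI)
    fix x assume "x \<in> (SIGMA R:subsets r. F - R)"
    then obtain R h where "x = (R, h)" "R \<in> subsets r" "h \<in> F" "h \<notin> R" by (rule SigmaE) simp
    then show "(\<lambda>(R, h). (insert h R, h)) x \<in> (SIGMA R:subsets (r+1). R)" using subsets_insert by simp
  qed
  show "(\<lambda>(R, h). (R - {h}, h)) ` (SIGMA R:subsets (r+1). R) \<subseteq> (SIGMA R:subsets r. F - R)"
  proof (rule image_subsetI)
    fix x assume "x \<in> (SIGMA R:subsets (r+1). R)"
    then obtain R h where "x = (R, h)" "R \<in> subsets (r+1)" "h \<in> R" by (rule SigmaE) simp
    then show "(\<lambda>(R, h). (R - {h}, h)) x \<in> (SIGMA R:subsets r. F - R)" using subsets_remove by simp
  qed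
  show "\<forall>a\<in>SIGMA R:subsets r. F - R. (\<lambda>(R, h). (R - {h}, h)) ((\<lambda>(R, h). (insert h R, h)) a) = a"
  proof
    fix x assume "x \<in> (SIGMA R:subsets r. F - R)"
    then obtain R h where "x = (R, h)" "h \<notin> R" by (rule SigmaE) simp
    then show "(\<lambda>(R, h). (R - {h}, h)) ((\<lambda>(R, h). (insert h R, h)) x) = x" by simp
  qed
  show "\<forall>a\<in>SIGMA R:subsets (r+1). R. (\<lambda>(R, h). (insert h R, h)) ((\<lambda>(R, h). (R - {h}, h)) a) = a"
  proof
    fix x assume "x \<in> (SIGMA R:subsets (r+1). R)"
    then obtain R h where "x = (R, h)" "h \<in> R" by (rule SigmaE) simp
    then show "(\<lambda>(R, h). (insert h R, h)) ((\<lambda>(R, h). (R - {h}, h)) x) = x" by (simp add: insert_absorb)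
  qed
qed

text \<open>Drawing \<open>r\<close> curves and then one more is the same as drawing
  \<open>r + 1\<close> curves and singling out one of them. Conflicts with a sample thus become
  removals from a larger one.\<close>

lemma conflict_sum_swap:
  fixes P :: "'c set \<Rightarrow> 'c \<Rightarrow> nat"
  shows "(\<Sum>R\<in>subsets r. \<Sum>h\<in>F - R. P R h) = (\<Sum>R\<in>subsets (r+1). \<Sum>h\<in>R. P (R - {h}) h)"
proof -
  have fR: "finite R" if "R \<in> subsets k" for R k using subsetsD that by blast
  have "(\<Sum>R\<in>subsets r. \<Sum>h\<in>F - R. P R h) = (\<Sum>(R,h)\<in>(SIGMA R:subsets r. F - R). P R h)"
    by (rule sum.Sigma) (use finite_subsets fin in auto)
  also have "\<dots> = (\<Sum>x\<in>(SIGMA R:subsets r. F - R). (\<lambda>(R, h). P (R - {h}) h) ((\<lambda>(R, h). (insert h R, h)) x))"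
  proof (rule sum.cong)
    fix x assume "x \<in> (SIGMA R:subsets r. F - R)"
    then obtain R h where "x = (R, h)" "h \<notin> R" by auto
    then show "(case x of (R, h) \<Rightarrow> P R h) = (\<lambda>(R, h). P (R - {h}) h) ((\<lambda>(R, h). (insert h R, h)) x)" by simp
  qed simp
  also have "\<dots> = (\<Sum>(R,h)\<in>(SIGMA R:subsets (r+1). R). P (R - {h}) h)"
    by (rule sum.reindex_bij_betw[OF bij_insert_remove])
  also have "\<dots> = (\<Sum>R\<in>subsets (r+1). \<Sum>h\<in>R. P (R - {h}) h)"
    by (rule sum.Sigma[symmetric]) (use finite_subsets fR in auto)
  finally show ?thesis .
qed

lemma conflicts_subset: "conflicts \<tau> \<subseteq> F"
  unfolding conflicts_def by blast

lemma finite_conflicts: "finite (conflicts \<tau>)"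
  unfolding conflicts_def using fin by simp

lemma card_conflicts:
  assumes "R \<subseteq> F" "off R t"
  shows "card (conflicts (cell R t)) = (\<Sum>h\<in>F - R. if h \<in> conflicts (cell R t) then 1 else 0)"
proof -
  have "conflicts (cell R t) = {h \<in> F - R. h \<in> conflicts (cell R t)}"
    using conflicts_disjoint[OF assms] conflicts_subset[of "cell R t"] by auto
  then have "card (conflicts (cell R t)) = card {h \<in> F - R. h \<in> conflicts (cell R t)}" by (rule arg_cong)
  also have "\<dots> = (\<Sum>h\<in>F - R. if h \<in> conflicts (cell R t) then 1 else 0)"
    by (rule sum_indicator_nat[symmetric]) (use fin in simp)
  finally show ?thesis .
qed

text \<open>Backwards analysis: removing a random curve from a sample of size $r + 1$ changes the cell of
  a given point only if the removed curve belongs to the witness set of that cell.\<close>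

lemma sum_conflicts_points:
  "(\<Sum>R\<in>subsets r. \<Sum>t | off R t. card (conflicts (cell R t))) \<le> 4 * n * (card F choose (r+1))"
proof -
  have fo: "finite {t. off R t}" for R by (simp add: off_def)
  have "(\<Sum>R\<in>subsets r. \<Sum>t | off R t. card (conflicts (cell R t)))
      = (\<Sum>R\<in>subsets r. \<Sum>t | off R t. \<Sum>h\<in>F - R. if h \<in> conflicts (cell R t) then 1 else 0)"
    by (intro sum.cong refl card_conflicts) (auto dest: subsetsD)
  also have "\<dots> = (\<Sum>R\<in>subsets r. \<Sum>h\<in>F - R. \<Sum>t | off R t. if h \<in> conflicts (cell R t) then 1 else 0)"
    by (intro sum.cong refl sum.swap)
  also have "\<dots> = (\<Sum>R\<in>subsets (r+1). \<Sum>h\<in>R. \<Sum>t | off (R-{h}) t. if h \<in> conflicts (cell (R-{h}) t) then 1 else 0)"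
    by (rule conflict_sum_swap)
  also have "\<dots> \<le> (\<Sum>R\<in>subsets (r+1). 4 * n)"
  proof (rule sum_mono)
    fix R assume "R \<in> subsets (r+1)"
    then have R: "R \<subseteq> F" "finite R" using subsetsD by auto
    define Q where "Q t h \<longleftrightarrow> off (R-{h}) t \<and> h \<in> conflicts (cell (R-{h}) t)" for t h
    have "(\<Sum>h\<in>R. \<Sum>t | off (R-{h}) t. if h \<in> conflicts (cell (R-{h}) t) then 1 else (0::nat))
        = (\<Sum>h\<in>R. \<Sum>t<n. if Q t h then 1 else 0)"
      by (intro sum.cong refl sum.mono_neutral_cong_left) (auto simp: Q_def off_def)
    also have "\<dots> = (\<Sum>t<n. \<Sum>h\<in>R. if Q t h then 1 else 0)" by (rule sum.swap)
    also have "\<dots> = (\<Sum>t<n. card {h\<in>R. Q t h})"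
      using R(2) by (simp only: sum_indicator_nat)
    also have "\<dots> \<le> (\<Sum>t<n. 4)"
    proof (rule sum_mono)
      fix t assume "t \<in> {..<n}"
      then have tn: "t < n" by simp
      show "card {h\<in>R. Q t h} \<le> 4"
      proof (cases "off R t")
        case True
        obtain D where D: "D \<subseteq> R" "card D \<le> 4" "\<And>R'. D \<subseteq> R' \<Longrightarrow> R' \<subseteq> R \<Longrightarrow> cell R' t = cell R t"
          using cell_witness[OF R(1) True] by blast
        \<comment> \<open>Removing a curve outside the witness leaves the cell of \<open>R\<close>,
          which conflicts with no curve of \<open>R\<close>.\<close>
        have "h \<in> D" if "h \<in> R" "Q t h" for h
        proof (rule ccontr)
          assume "h \<notin> D"
          then have "cell (R - {h}) t = cell R t" using D(1) by (intro D(3)) auto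
          then have "h \<in> conflicts (cell R t)" using that by (simp add: Q_def)
          then show False using conflicts_disjoint[OF R(1) True] that by blast
        qed
        moreover have "finite D" using finite_subset[OF D(1) R(2)] .
        ultimately have "card {h\<in>R. Q t h} \<le> card D" by (intro card_mono) auto
        then show ?thesis using D by simp
      next
        case False
        \<comment> \<open>If the point is on a curve \<open>h0\<close> of \<open>R\<close>, only the
          removal of \<open>h0\<close> can put it off the sample.\<close>
        then obtain h0 where h0: "h0 \<in> R" "side t h0 = 0" using tn by (auto simp: off_def)
        then have "{h\<in>R. Q t h} \<subseteq> {h0}" by (auto simp: Q_def off_def)
        then have "card {h\<in>R. Q t h} \<le> card {h0}" by (intro card_mono) auto
        then show ?thesis by simp
      qed
    qed
    finally show "(\<Sum>h\<in>R. \<Sum>t | off (R-{h}) t. if h \<in> conflicts (cell (R-{h}) t) then 1 else (0::nat)) \<le> 4 * n" by simp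
  qed
  also have "\<dots> = 4 * n * (card F choose (r+1))" by (simp add: card_subsets)
  finally show ?thesis .
qed

text \<open>At most four elements are forced in and \<open>h\<close> is forced out, which costs a
  factor of at most \<open>2 ^ 5 = 32\<close>.\<close>

lemma card_between_subsets:
  assumes "finite R" "D \<subseteq> R" "h \<in> R" "h \<notin> D" "card D \<le> 4" "card R = r + 1"
  shows "2 ^ (r + 1) \<le> 32 * card {R'. D \<subseteq> R' \<and> R' \<subseteq> R - {h}}"
proof -
  have fD: "finite D" using finite_subset[OF assms(2,1)] .
  have "bij_betw (\<lambda>X. X \<union> D) (Pow (R - {h} - D)) {R'. D \<subseteq> R' \<and> R' \<subseteq> R - {h}}"
    by (rule bij_betw_byWitness[where f' = "\<lambda>X. X - D"]) (use assms in auto)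
  then have "card {R'. D \<subseteq> R' \<and> R' \<subseteq> R - {h}} = 2 ^ card (R - {h} - D)"
    using bij_betw_same_card card_Pow[of "R - {h} - D"] assms(1) by fastforce
  moreover have "card (R - {h} - D) = r - card D"
    using assms fD by (subst card_Diff_subset) (auto simp: card_Diff_singleton)
  moreover have "card D \<le> r"
    using card_mono[of "R - {h}" D] assms by (auto simp: card_Diff_singleton)
  ultimately have "32 * card {R'. D \<subseteq> R' \<and> R' \<subseteq> R - {h}} = 2 ^ (5 + (r - card D))" by (simp only: power_add) simp
  moreover have "r + 1 \<le> 5 + (r - card D)" using assms(5) by simp
  ultimately show ?thesis by (metis one_le_numeral power_increasing)
qed

text \<open>A cell of $R \setminus \{h\}$ that is hit by $h$ and by no other curve of $R$ survives in a
  random subset of $R$ with probability at least $2^{-5}$.\<close>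

lemma sum_conflicts_cells:
  "(\<Sum>R\<in>subsets r. \<Sum>\<tau>\<in>cells R. card (conflicts \<tau>)) \<le> (64 * (b + 1) * (r + 2)^2) * (card F choose (r+1))"
proof -
  have fc: "finite (cells R)" for R by (simp add: cells_def off_def)
  have cd: "card (conflicts \<tau>) = (\<Sum>h\<in>F - R. if h \<in> conflicts \<tau> then 1 else 0)" if "R \<in> subsets r" "\<tau> \<in> cells R" for R \<tau>
    using that card_conflicts[of R] subsetsD[of R r] by (auto simp: cells_def)
  have "(\<Sum>R\<in>subsets r. \<Sum>\<tau>\<in>cells R. card (conflicts \<tau>))
      = (\<Sum>R\<in>subsets r. \<Sum>\<tau>\<in>cells R. \<Sum>h\<in>F - R. if h \<in> conflicts \<tau> then 1 else 0)"
    by (intro sum.cong refl cd)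
  also have "\<dots> = (\<Sum>R\<in>subsets r. \<Sum>h\<in>F - R. \<Sum>\<tau>\<in>cells R. if h \<in> conflicts \<tau> then 1 else 0)"
    by (intro sum.cong refl sum.swap)
  also have "\<dots> = (\<Sum>R\<in>subsets (r+1). \<Sum>h\<in>R. \<Sum>\<tau>\<in>cells (R-{h}). if h \<in> conflicts \<tau> then 1 else 0)"
    by (rule conflict_sum_swap)
  also have "\<dots> \<le> (\<Sum>R\<in>subsets (r+1). 64 * (b + 1) * (r + 2)^2)"
  proof (rule sum_mono)
    fix R assume "R \<in> subsets (r+1)"
    then have R: "R \<subseteq> F" "finite R" "card R = r + 1" using subsetsD by auto
    define S where "S = (SIGMA h:R. {\<tau> \<in> cells (R-{h}). h \<in> conflicts \<tau>})"
    have fS: "finite S" unfolding S_def using R fc by auto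
    have "(\<Sum>h\<in>R. \<Sum>\<tau>\<in>cells (R-{h}). if h \<in> conflicts \<tau> then 1 else (0::nat)) = card S"
      unfolding S_def using R(2) fc by (subst card_SigmaI) (auto simp: sum_indicator_nat)
    \<comment> \<open>A cell of \<open>R - {h}\<close> conflicts with no curve of \<open>R\<close>
      other than \<open>h\<close>, so the cell determines \<open>h\<close> and is counted
      once.\<close>
    moreover have inj: "inj_on snd S"
    proof (rule inj_onI)
      fix x y assume "x \<in> S" "y \<in> S" "snd x = snd y"
      then obtain h h' \<tau> where e: "x = (h,\<tau>)" "y = (h',\<tau>)" "h \<in> R" "h' \<in> R" "\<tau> \<in> cells (R-{h})" "h \<in> conflicts \<tau>" "h' \<in> conflicts \<tau>"
        unfolding S_def by auto
      then have "conflicts \<tau> \<inter> (R - {h}) = {}" using conflicts_disjoint[of "R-{h}"] R(1) by (auto simp: cells_def)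
      then show "x = y" using e by auto
    qed
    \<comment> \<open>Double counting of cells and the subsets of \<open>R\<close> that have them:
      each cell survives in at least a 32nd of all subsets.\<close>
    moreover have "2 ^ (r+1) * card (snd ` S) \<le> 32 * (\<Sum>R'\<in>Pow R. card (cells R'))"
    proof -
      have "2 ^ (r+1) \<le> 32 * card {R' \<in> Pow R. \<tau> \<in> cells R'}" if "\<tau> \<in> snd ` S" for \<tau>
      proof -
        obtain h where h: "h \<in> R" "\<tau> \<in> cells (R-{h})" using \<open>\<tau> \<in> snd ` S\<close> by (auto simp: S_def)
        then obtain t where t: "off (R-{h}) t" "\<tau> = cell (R-{h}) t" by (auto simp: cells_def)
        obtain D where D: "D \<subseteq> R-{h}" "card D \<le> 4" "\<And>R'. D \<subseteq> R' \<Longrightarrow> R' \<subseteq> R-{h} \<Longrightarrow> cell R' t = \<tau>"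
          using cell_witness[OF _ t(1)] R(1) t(2) by blast
        have "2 ^ (r+1) \<le> 32 * card {R'. D \<subseteq> R' \<and> R' \<subseteq> R - {h}}"
          by (rule card_between_subsets) (use R h D in auto)
        also have "\<dots> \<le> 32 * card {R' \<in> Pow R. \<tau> \<in> cells R'}"
        proof (intro mult_le_mono2 card_mono)
          have "\<tau> \<in> cells R'" if "D \<subseteq> R'" "R' \<subseteq> R-{h}" for R'
          proof -
            have "off R' t" using t(1) that(2) by (auto simp: off_def)
            then show ?thesis unfolding cells_def using D(3)[OF that] by blast
          qed
          then show "{R'. D \<subseteq> R' \<and> R' \<subseteq> R - {h}} \<subseteq> {R' \<in> Pow R. \<tau> \<in> cells R'}" by blast
        qed (use R in simp)
        finally show ?thesis .
      qed
      then have "(\<Sum>\<tau>\<in>snd ` S. 2 ^ (r+1)) \<le> (\<Sum>\<tau>\<in>snd ` S. 32 * card {R' \<in> Pow R. \<tau> \<in> cells R'})"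
        by (rule sum_mono)
      also have "\<dots> = 32 * (\<Sum>\<tau>\<in>snd ` S. \<Sum>R'\<in>Pow R. if \<tau> \<in> cells R' then 1 else 0)"
        unfolding sum_distrib_left[symmetric] using R(2) by (simp only: sum_indicator_nat finite_Pow_iff)
      also have "\<dots> = 32 * (\<Sum>R'\<in>Pow R. \<Sum>\<tau>\<in>snd ` S. if \<tau> \<in> cells R' then 1 else 0)"
        by (subst sum.swap) simp
      also have "\<dots> \<le> 32 * (\<Sum>R'\<in>Pow R. card (cells R'))"
      proof (intro mult_le_mono2 sum_mono)
        fix R'
        have "(\<Sum>\<tau>\<in>snd ` S. if \<tau> \<in> cells R' then 1 else 0) = card {\<tau> \<in> snd ` S. \<tau> \<in> cells R'}"
          by (rule sum_indicator_nat) (use fS in simp)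
        also have "\<dots> \<le> card (cells R')" by (rule card_mono) (use fc in auto)
        finally show "(\<Sum>\<tau>\<in>snd ` S. if \<tau> \<in> cells R' then 1 else 0) \<le> card (cells R')" .
      qed
      finally show ?thesis by (simp add: mult.commute)
    qed
    \<comment> \<open>The worst-case bound of \<open>card_cells_le\<close> is enough for every
      subset; \<open>32 * 2 = 64\<close> is the final constant.\<close>
    moreover have "(\<Sum>R'\<in>Pow R. card (cells R')) \<le> 2 ^ (r+1) * (2 * (b+1) * (r+2)^2)"
    proof -
      have "(\<Sum>R'\<in>Pow R. card (cells R')) \<le> (\<Sum>R'\<in>Pow R. 2 * (b+1) * (r+2)^2)"
      proof (rule sum_mono)
        fix R' assume "R' \<in> Pow R"
        then have "card R' \<le> r + 1" "R' \<subseteq> F" using card_mono[of R R'] R by auto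
        then show "card (cells R') \<le> 2 * (b+1) * (r+2)^2"
          by (intro order_trans[OF card_cells_le] mult_le_mono2 power_mono) auto
      qed
      then show ?thesis using R by (simp add: card_Pow)
    qed
    ultimately have "2 ^ (r+1) * (\<Sum>h\<in>R. \<Sum>\<tau>\<in>cells (R-{h}). if h \<in> conflicts \<tau> then 1 else (0::nat))
        \<le> 32 * (2 ^ (r+1) * (2 * (b+1) * (r+2)^2))"
      by (simp only: card_image)
    also have "\<dots> = 2 ^ (r+1) * (64 * (b+1) * (r+2)^2)" by (simp add: algebra_simps)
    finally have "2 ^ (r+1) * (\<Sum>h\<in>R. \<Sum>\<tau>\<in>cells (R-{h}). if h \<in> conflicts \<tau> then 1 else (0::nat))
        \<le> 2 ^ (r+1) * (64 * (b+1) * (r+2)^2)" .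
    then show "(\<Sum>h\<in>R. \<Sum>\<tau>\<in>cells (R-{h}). if h \<in> conflicts \<tau> then 1 else (0::nat)) \<le> 64 * (b + 1) * (r + 2)^2"
      by (meson mult_le_cancel1 zero_less_numeral zero_less_power)
  qed
  also have "\<dots> = (64 * (b + 1) * (r + 2)^2) * (card F choose (r+1))" by (simp add: card_subsets)
  finally show ?thesis .
qed

end

section \<open>Incidences without sampling\<close>

lemma six_choose_three: "6 * (m choose 3) = m * (m - 1) * (m - 2)"
proof (induction m)
  case (Suc m)
  have "Suc m choose 3 = (m choose 2) + (m choose 3)" by (simp add: numeral_3_eq_3 numeral_2_eq_2)
  moreover have "2 * (m choose 2) = m * (m - 1)"
  proof -
    have "even (m * (m - 1))" by (cases m) auto
    then show ?thesis unfolding choose_two by (rule dvd_mult_div_cancel)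
  qed
  ultimately have "6 * (Suc m choose 3) = 3 * (m * (m - 1)) + m * (m - 1) * (m - 2)" using Suc by simp
  also have "\<dots> = Suc m * (Suc m - 1) * (Suc m - 2)"
    by (cases m; cases "m - 1") (auto simp: algebra_simps)
  finally show ?case .
qed simp

text \<open>Sets with fewer than \<open>k\<close> common points have no common
  \<open>k\<close>-subset, so no \<open>k\<close>-subset of \<open>P\<close> is counted
  twice.\<close>

lemma sum_choose_le:
  assumes "finite K" "finite P" "\<And>h. h \<in> K \<Longrightarrow> S h \<subseteq> P"
    and "\<And>h h'. h \<in> K \<Longrightarrow> h' \<in> K \<Longrightarrow> h \<noteq> h' \<Longrightarrow> card (S h \<inter> S h') < k"
  shows "(\<Sum>h\<in>K. card (S h) choose k) \<le> card P choose k"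
proof -
  have fS: "finite (S h)" if "h \<in> K" for h using finite_subset[OF assms(3)[OF that] assms(2)] .
  define T where "T h = {X. X \<subseteq> S h \<and> card X = k}" for h
  have cT: "card (T h) = card (S h) choose k" "finite (T h)" if "h \<in> K" for h
    using n_subsets[OF fS[OF that], of k] fS[OF that] by (auto simp: T_def)
  have "T h \<inter> T h' = {}" if "h \<in> K" "h' \<in> K" "h \<noteq> h'" for h h'
  proof (rule ccontr)
    assume "T h \<inter> T h' \<noteq> {}"
    then obtain X where "X \<subseteq> S h \<inter> S h'" "card X = k" by (auto simp: T_def)
    then have "k \<le> card (S h \<inter> S h')" using card_mono[of "S h \<inter> S h'" X] fS that by auto
    then show False using assms(4)[OF that] by simp
  qed
  then have "card (\<Union>h\<in>K. T h) = (\<Sum>h\<in>K. card (T h))" by (intro card_UN_disjoint) (use assms cT in auto)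
  moreover have "card (\<Union>h\<in>K. T h) \<le> card {X. X \<subseteq> P \<and> card X = k}"
  proof (rule card_mono)
    show "(\<Union>h\<in>K. T h) \<subseteq> {X. X \<subseteq> P \<and> card X = k}" using assms(3) unfolding T_def by blast
  qed (use assms(2) in simp)
  ultimately show ?thesis using cT n_subsets[OF assms(2), of k] by simp
qed

text \<open>The inequality of arithmetic and geometric means for \<open>j ^ 3\<close>,
  \<open>w ^ 3\<close>, \<open>w ^ 3\<close>, divided by \<open>w ^ 2\<close>. It is the
  tangent-type bound that replaces a cube root.\<close>

lemma amgm_cubic:
  fixes j w :: real
  assumes "0 \<le> j" "0 < w"
  shows "j \<le> (j^3 / w^2 + 2 * w) / 3"
proof -
  have "0 \<le> (j - w)^2 * (j + 2 * w)" using assms by simp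
  also have "\<dots> = j^3 + 2 * w^3 - 3 * j * w^2" by algebra
  finally have "3 * j * w^2 \<le> j^3 + 2 * w^3" by simp
  also have "\<dots> = (j^3 / w^2 + 2 * w) * w^2" using assms by (simp add: field_simps power3_eq_cube power2_eq_square)
  finally have "3 * j \<le> j^3 / w^2 + 2 * w" using assms by (simp add: mult_le_cancel_right)
  then show ?thesis by simp
qed

text \<open>A linearised form of the Kovari-Sos-Turan bound $O(|P| |K|^{2/3} + |K|)$.\<close>

lemma kst_bound:
  fixes \<mu> :: real
  assumes "finite K" "finite P" "\<And>h. h \<in> K \<Longrightarrow> S h \<subseteq> P"
    and "\<And>h h'. h \<in> K \<Longrightarrow> h' \<in> K \<Longrightarrow> h \<noteq> h' \<Longrightarrow> card (S h \<inter> S h') \<le> 2"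
    and "0 < \<mu>"
  shows "(\<Sum>h\<in>K. real (card (S h))) \<le> 3/2 * card P * \<mu>^2 + 2/3 * (card P * card K) / \<mu> + 3 * card K"
proof (cases "card P = 0")
  case True
  then have "S h = {}" if "h \<in> K" for h using assms(2,3) that by auto
  then show ?thesis using True by simp
next
  case False
  \<comment> \<open>For \<open>\<mu>\<close> near the cube root of \<open>card K\<close> both terms
    with \<open>card P\<close> become \<open>card P * card K powr (2/3)\<close> up to constants.
    Leaving \<open>\<mu>\<close> free allows one value for all cells.\<close>
  define w where "w = card P / \<mu>"
  have w: "0 < w" using False assms(5) by (simp add: w_def)
  have each: "real j \<le> 3 + 9 * (j choose 3) / w^2 + 2/3 * w" for j
  proof (cases "j < 3")
    case True
    then have "real j \<le> 3" by simp
    moreover have "0 \<le> 9 * (j choose 3) / w^2" by simp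
    ultimately show ?thesis using w by linarith
  next
    case False
    have "real (6 * (j choose 3)) = real j * (real j - 1) * (real j - 2)"
      using False by (subst six_choose_three) (simp add: of_nat_diff)
    \<comment> \<open>This yields \<open>j ^ 3 \<le> 27 * (j choose 3)\<close>, with equality at
      \<open>j = 3\<close>, which explains the factor \<open>j - 3\<close> in the
      difference.\<close>
    moreover have "real j ^ 2 * 2 \<le> 9 * ((real j - 1) * (real j - 2))"
    proof -
      have "0 \<le> (real j - 3) * (7 * real j - 6)" using False by simp
      then show ?thesis by (simp add: algebra_simps power2_eq_square)
    qed
    then have "real j * (real j ^ 2 * 2) \<le> real j * (9 * ((real j - 1) * (real j - 2)))"
      by (rule mult_left_mono) simp
    then have "2 * real j ^ 3 \<le> 9 * (real j * (real j - 1) * (real j - 2))"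
      by (simp only: power3_eq_cube power2_eq_square mult_ac)
    ultimately have "real j ^ 3 \<le> 27 * (j choose 3)" by simp
    then have "real j ^ 3 / w^2 \<le> 27 * (j choose 3) / w^2" using w by (simp add: divide_right_mono)
    then show ?thesis using amgm_cubic[of j w] w by simp
  qed
  have "(\<Sum>h\<in>K. real (card (S h))) \<le> (\<Sum>h\<in>K. 3 + 9 * (card (S h) choose 3) / w^2 + 2/3 * w)"
    by (intro sum_mono each)
  also have "\<dots> = 3 * card K + 9 / w^2 * real (\<Sum>h\<in>K. card (S h) choose 3) + 2/3 * w * card K"
    by (simp add: sum.distrib sum_distrib_left sum_divide_distrib algebra_simps)
  also have "9 / w^2 * real (\<Sum>h\<in>K. card (S h) choose 3) \<le> 9 / w^2 * (real (card P) ^ 3 / 6)"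
  proof (rule mult_left_mono)
    have "(\<Sum>h\<in>K. card (S h) choose 3) \<le> card P choose 3"
      by (rule sum_choose_le[OF assms(1,2,3)]) (auto dest: assms(4))
    moreover have "6 * (card P choose 3) \<le> card P ^ 3"
      unfolding six_choose_three power3_eq_cube by (intro mult_mono) auto
    ultimately have "6 * (\<Sum>h\<in>K. card (S h) choose 3) \<le> card P ^ 3" by linarith
    then have "real (6 * (\<Sum>h\<in>K. card (S h) choose 3)) \<le> real (card P ^ 3)" by (rule of_nat_mono)
    then show "real (\<Sum>h\<in>K. card (S h) choose 3) \<le> real (card P) ^ 3 / 6" by simp
  qed (use w in simp)
  also have "9 / w^2 * (real (card P) ^ 3 / 6) = 3/2 * card P * \<mu>^2"
    using False assms(5) by (simp add: w_def field_simps power3_eq_cube power2_eq_square)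
  finally show ?thesis unfolding w_def using assms(5) by (simp add: field_simps)
qed

section \<open>Incidences of points and curves\<close>

context cell_decomposition begin

definition thru :: "nat \<Rightarrow> 'c set" where
  "thru t = {h \<in> F. side t h = 0}"

definition inc :: "'c \<Rightarrow> nat set" where
  "inc h = {t. t < n \<and> side t h = 0}"

lemma finite_thru: "finite (thru t)" unfolding thru_def using fin by simp
lemma finite_inc: "finite (inc h)" unfolding inc_def by simp

lemma sum_inc_thru: "(\<Sum>h\<in>F. card (inc h)) = (\<Sum>t<n. card (thru t))"
proof -
  have "(\<Sum>h\<in>F. card (inc h)) = (\<Sum>h\<in>F. \<Sum>t<n. if side t h = 0 then 1 else 0)"
    by (intro sum.cong refl, subst sum_indicator_nat) (auto simp: inc_def)
  also have "\<dots> = (\<Sum>t<n. \<Sum>h\<in>F. if side t h = 0 then 1 else 0)" by (rule sum.swap)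
  also have "\<dots> = (\<Sum>t<n. card (thru t))"
    by (intro sum.cong refl, subst sum_indicator_nat) (use fin in \<open>auto simp: thru_def\<close>)
  finally show ?thesis .
qed

text \<open>This confines the incidences in a cell to its conflicting curves: the side 0 lies
  strictly between the signs of the two bounds at \<open>t\<close>.\<close>

lemma thru_subset_conflicts:
  assumes "R \<subseteq> F" "off R t"
  shows "thru t \<subseteq> conflicts (cell R t)"
proof
  fix h assume h: "h \<in> thru t"
  have tn: "t < n" using assms(2) by (simp add: off_def)
  obtain g f where c: "cell R t = (g, f, span_of R g f t)" "g \<in> insert bot R" "f \<in> insert top R"
      "side t g < 0" "0 < side t f" "t \<in> span_of R g f t" by (rule cellE[OF assms])
  have "key t g < key t h" "key t h < key t f"
    by (rule side_mono[OF tn]; use c h assms(1) in \<open>auto simp: thru_def\<close>)+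
  then show "h \<in> conflicts (cell R t)" using c h by (auto simp: conflicts_def thru_def)
qed

context
  assumes two: "\<And>h h'. h \<in> F \<Longrightarrow> h' \<in> F \<Longrightarrow> h \<noteq> h' \<Longrightarrow> card (inc h \<inter> inc h') \<le> 2"
begin

text \<open>\<open>kst_bound\<close> is applied in each cell to its points and its conflicting
  curves. Since one \<open>\<mu>\<close> serves all cells, the sums collapse: every point
  contributes the conflicts of its own cell, and every cell its conflicts once.\<close>

lemma off_incidences:
  fixes \<mu> :: real
  assumes R: "R \<subseteq> F" and mu: "0 < \<mu>"
  shows "(\<Sum>t | off R t. real (card (thru t)))
     \<le> 3/2 * n * \<mu>^2 + 2/3 * (\<Sum>t | off R t. card (conflicts (cell R t))) / \<mu> + 3 * (\<Sum>\<tau>\<in>cells R. card (conflicts \<tau>))"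
proof -
  have fo: "finite {t. off R t}" by (simp add: off_def)
  have fc: "finite (cells R)" using fo by (simp add: cells_def)
  define P where "P \<tau> = {t \<in> {t. off R t}. cell R t = \<tau>}" for \<tau>
  have fP: "finite (P \<tau>)" for \<tau> using fo by (simp add: P_def)
  have each: "(\<Sum>t\<in>P \<tau>. real (card (thru t)))
     \<le> 3/2 * card (P \<tau>) * \<mu>^2 + 2/3 * (card (P \<tau>) * card (conflicts \<tau>)) / \<mu> + 3 * card (conflicts \<tau>)" for \<tau>
  proof -
    have "(\<Sum>t\<in>P \<tau>. card (thru t)) = (\<Sum>t\<in>P \<tau>. \<Sum>h\<in>conflicts \<tau>. if side t h = 0 then 1 else 0)"
    proof (rule sum.cong[OF refl])
      fix t assume "t \<in> P \<tau>"
      then have "thru t \<subseteq> conflicts \<tau>" using thru_subset_conflicts[OF R] by (auto simp: P_def)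
      then have "thru t = {h \<in> conflicts \<tau>. side t h = 0}" using conflicts_subset[of \<tau>] by (auto simp: thru_def)
      then show "card (thru t) = (\<Sum>h\<in>conflicts \<tau>. if side t h = 0 then 1 else 0)"
        using sum_indicator_nat[OF finite_conflicts, of "\<lambda>h. side t h = 0" \<tau>] by simp
    qed
    also have "\<dots> = (\<Sum>h\<in>conflicts \<tau>. \<Sum>t\<in>P \<tau>. if side t h = 0 then 1 else 0)" by (rule sum.swap)
    also have "\<dots> = (\<Sum>h\<in>conflicts \<tau>. card {t \<in> P \<tau>. side t h = 0})"
      using fP by (simp only: sum_indicator_nat)
    finally have "(\<Sum>t\<in>P \<tau>. real (card (thru t))) = (\<Sum>h\<in>conflicts \<tau>. real (card {t \<in> P \<tau>. side t h = 0}))"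
      by (metis (no_types, lifting) of_nat_sum sum.cong)
    also have "\<dots> \<le> 3/2 * card (P \<tau>) * \<mu>^2 + 2/3 * (card (P \<tau>) * card (conflicts \<tau>)) / \<mu> + 3 * card (conflicts \<tau>)"
    proof (rule kst_bound[OF finite_conflicts fP _ _ mu])
      fix h h' assume h: "h \<in> conflicts \<tau>" "h' \<in> conflicts \<tau>" "h \<noteq> h'"
      have "card ({t \<in> P \<tau>. side t h = 0} \<inter> {t \<in> P \<tau>. side t h' = 0}) \<le> card (inc h \<inter> inc h')"
        by (rule card_mono) (auto simp: finite_inc inc_def P_def off_def)
      also have "\<dots> \<le> 2" by (rule two[OF subsetD[OF conflicts_subset h(1)] subsetD[OF conflicts_subset h(2)] h(3)])
      finally show "card ({t \<in> P \<tau>. side t h = 0} \<inter> {t \<in> P \<tau>. side t h' = 0}) \<le> 2" .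
    qed auto
    finally show ?thesis .
  qed
  have "(\<Sum>t | off R t. real (card (thru t))) = (\<Sum>\<tau>\<in>cells R. \<Sum>t\<in>P \<tau>. real (card (thru t)))"
    unfolding cells_def P_def by (rule sum.image_gen[OF fo])
  also have "\<dots> \<le> (\<Sum>\<tau>\<in>cells R. 3/2 * card (P \<tau>) * \<mu>^2 + 2/3 * (card (P \<tau>) * card (conflicts \<tau>)) / \<mu> + 3 * card (conflicts \<tau>))"
    by (intro sum_mono each)
  also have "\<dots> = 3/2 * (\<Sum>\<tau>\<in>cells R. card (P \<tau>)) * \<mu>^2 + 2/3 * (\<Sum>\<tau>\<in>cells R. card (P \<tau>) * card (conflicts \<tau>)) / \<mu>
       + 3 * (\<Sum>\<tau>\<in>cells R. card (conflicts \<tau>))"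
    by (simp add: sum.distrib sum_distrib_left sum_distrib_right sum_divide_distrib)
  also have "(\<Sum>\<tau>\<in>cells R. card (P \<tau>) * card (conflicts \<tau>)) = (\<Sum>t | off R t. card (conflicts (cell R t)))"
  proof -
    have "(\<Sum>t | off R t. card (conflicts (cell R t))) = (\<Sum>\<tau>\<in>cells R. \<Sum>t\<in>P \<tau>. card (conflicts (cell R t)))"
      unfolding cells_def P_def by (rule sum.image_gen[OF fo])
    also have "\<dots> = (\<Sum>\<tau>\<in>cells R. \<Sum>t\<in>P \<tau>. card (conflicts \<tau>))"
      by (intro sum.cong refl) (auto simp: P_def)
    finally show ?thesis by simp
  qed
  also have "(\<Sum>\<tau>\<in>cells R. card (P \<tau>)) = card {t. off R t}"
    using sum.image_gen[OF fo, of "\<lambda>_. 1::nat" "cell R"] unfolding cells_def P_def by simp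
  also have "3/2 * real (card {t. off R t}) * \<mu>^2 \<le> 3/2 * n * \<mu>^2"
  proof -
    have "card {t. off R t} \<le> card {..<n}" by (rule card_mono) (auto simp: off_def)
    then show ?thesis by (intro mult_right_mono) auto
  qed
  finally show ?thesis by simp
qed

end

text \<open>Union bound: a fixed curve is sampled with probability at most
  \<open>r / card F\<close>, so some curve through the point is sampled with probability at most
  1/2.\<close>

lemma card_off_subsets:
  assumes N: "0 < card F" and poor: "2 * r * card (thru t) \<le> card F" and tn: "t < n"
  shows "card F choose r \<le> 2 * card {R \<in> subsets r. off R t}"
proof -
  let ?N = "card F"
  define A where "A h = {R \<in> subsets r. h \<in> R}" for h
  have fA: "finite (A h)" for h unfolding A_def using finite_subsets by simp
  have cA: "?N * card (A h) \<le> r * (?N choose r)" if "h \<in> F" for h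
  proof (cases r)
    case 0
    then have "A h = {}" by (auto simp: A_def dest!: subsetsD)
    then show ?thesis by simp
  next
    case (Suc k)
    have "card (A h) \<le> card {X. X \<subseteq> F - {h} \<and> card X = k}"
    proof (rule card_inj_on_le[where f = "\<lambda>R. R - {h}"])
      show "inj_on (\<lambda>R. R - {h}) (A h)" by (rule inj_onI) (auto simp: A_def)
      show "(\<lambda>R. R - {h}) ` A h \<subseteq> {X. X \<subseteq> F - {h} \<and> card X = k}"
      proof (rule image_subsetI)
        fix R assume "R \<in> A h"
        then have "R \<subseteq> F" "card R = Suc k" "h \<in> R" using subsetsD[of R r] Suc by (auto simp: A_def)
        then show "R - {h} \<in> {X. X \<subseteq> F - {h} \<and> card X = k}" by (auto simp: card_Diff_singleton)
      qed
      show "finite {X. X \<subseteq> F - {h} \<and> card X = k}" using fin by simp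
    qed
    also have "\<dots> = (?N - 1) choose k" using fin that by (subst n_subsets) (auto simp: card_Diff_singleton)
    finally have "?N * card (A h) \<le> ?N * ((?N - 1) choose k)" by simp
    also have "\<dots> = r * (?N choose r)" unfolding Suc by (rule binomial_absorption[symmetric])
    finally show ?thesis .
  qed
  have "{R \<in> subsets r. \<not> off R t} \<subseteq> (\<Union>h\<in>thru t. A h)"
    using tn by (auto simp: off_def thru_def A_def dest: subsetsD)
  then have "card {R \<in> subsets r. \<not> off R t} \<le> card (\<Union>h\<in>thru t. A h)"
    by (intro card_mono) (use finite_thru fA in auto)
  also have "\<dots> \<le> (\<Sum>h\<in>thru t. card (A h))" by (rule card_UN_le[OF finite_thru])
  finally have "?N * card {R \<in> subsets r. \<not> off R t} \<le> (\<Sum>h\<in>thru t. ?N * card (A h))"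
    by (simp add: sum_distrib_left[symmetric])
  also have "\<dots> \<le> (\<Sum>h\<in>thru t. r * (?N choose r))" by (intro sum_mono cA) (simp add: thru_def)
  also have "\<dots> = (r * card (thru t)) * (?N choose r)" by simp
  finally have "2 * (?N * card {R \<in> subsets r. \<not> off R t}) \<le> (2 * r * card (thru t)) * (?N choose r)" by simp
  also have "\<dots> \<le> ?N * (?N choose r)" by (rule mult_le_mono1[OF poor])
  finally have "?N * (2 * card {R \<in> subsets r. \<not> off R t}) \<le> ?N * (?N choose r)" by simp
  then have "2 * card {R \<in> subsets r. \<not> off R t} \<le> (?N choose r)" using N by (simp only: mult_le_cancel1)
  moreover have "card {R \<in> subsets r. off R t} + card {R \<in> subsets r. \<not> off R t} = card (subsets r)"
  proof -
    have "{R \<in> subsets r. off R t} \<union> {R \<in> subsets r. \<not> off R t} = subsets r" by blast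
    moreover have "{R \<in> subsets r. off R t} \<inter> {R \<in> subsets r. \<not> off R t} = {}" by blast
    ultimately show ?thesis using finite_subsets
      card_Un_disjoint[of "{R \<in> subsets r. off R t}" "{R \<in> subsets r. \<not> off R t}"] by simp
  qed
  ultimately show ?thesis using card_subsets[of r] by linarith
qed

context
  assumes two: "\<And>h h'. h \<in> F \<Longrightarrow> h' \<in> F \<Longrightarrow> h \<noteq> h' \<Longrightarrow> card (inc h \<inter> inc h') \<le> 2"
begin

text \<open>Points on very many curves may be hit by almost every sample, so pairs of curves are
  counted instead. Two curves share at most two points, while such a point on \<open>d\<close>
  curves accounts for at least \<open>card F * d / (8 * r)\<close> pairs.\<close>

lemma rich_incidences:
  assumes r: "2 * r \<le> card F"
  shows "(\<Sum>t | t < n \<and> card F < 2 * r * card (thru t). card (thru t)) \<le> 8 * card F * r"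
proof (cases "r = 0")
  case False
  let ?N = "card F"
  let ?T = "{t. t < n \<and> ?N < 2 * r * card (thru t)}"
  have fT: "finite ?T" by simp
  have pairs: "(\<Sum>t\<in>?T. card (thru t) choose 2) \<le> 2 * (?N choose 2)"
  proof -
    define S where "S = {X. X \<subseteq> F \<and> card X = 2}"
    have fS: "finite S" "card S = ?N choose 2" unfolding S_def using fin by (auto simp: n_subsets)
    have "(\<Sum>t\<in>?T. card (thru t) choose 2) = (\<Sum>t\<in>?T. \<Sum>X\<in>S. if X \<subseteq> thru t then 1 else 0)"
    proof (rule sum.cong[OF refl])
      fix t
      have "{X \<in> S. X \<subseteq> thru t} = {X. X \<subseteq> thru t \<and> card X = 2}" by (auto simp: S_def thru_def)
      then have "card (thru t) choose 2 = card {X \<in> S. X \<subseteq> thru t}" using n_subsets[OF finite_thru, of t 2] by simp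
      then show "card (thru t) choose 2 = (\<Sum>X\<in>S. if X \<subseteq> thru t then 1 else 0)"
        using sum_indicator_nat[OF fS(1), of "\<lambda>X. X \<subseteq> thru t"] by simp
    qed
    also have "\<dots> = (\<Sum>X\<in>S. \<Sum>t\<in>?T. if X \<subseteq> thru t then 1 else 0)" by (rule sum.swap)
    also have "\<dots> = (\<Sum>X\<in>S. card {t\<in>?T. X \<subseteq> thru t})" using fT by (simp only: sum_indicator_nat)
    also have "\<dots> \<le> (\<Sum>X\<in>S. 2)"
    proof (rule sum_mono)
      fix X assume "X \<in> S"
      then obtain h h' where h: "X = {h, h'}" "h \<noteq> h'" "h \<in> F" "h' \<in> F"
        unfolding S_def by (auto simp: card_2_iff)
      have "card {t\<in>?T. X \<subseteq> thru t} \<le> card (inc h \<inter> inc h')"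
        by (rule card_mono) (auto simp: finite_inc inc_def thru_def h(1))
      also have "\<dots> \<le> 2" by (rule two) (use h in auto)
      finally show "card {t\<in>?T. X \<subseteq> thru t} \<le> 2" .
    qed
    finally show ?thesis using fS by simp
  qed
  have "2 * (?N choose 2) \<le> ?N * ?N"
    unfolding choose_two by (rule order_trans[OF times_div_less_eq_dividend]) simp
  with pairs have p2: "4 * (\<Sum>t\<in>?T. card (thru t) choose 2) \<le> 4 * (?N * ?N)" by linarith
  have each: "?N * card (thru t) \<le> 8 * r * (card (thru t) choose 2)" if "t \<in> ?T" for t
  proof -
    define d where "d = card (thru t)"
    have d: "?N < 2 * r * d" using that by (simp add: d_def)
    have "d \<noteq> 0" using d by (intro notI) simp
    moreover have "d \<noteq> 1" using d r by auto
    ultimately have d2: "2 \<le> d" by simp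
    have c2: "2 * (d choose 2) = d * (d - 1)"
    proof -
      have "even (d * (d - 1))" by (cases d) auto
      then show ?thesis unfolding choose_two by (rule dvd_mult_div_cancel)
    qed
    have "?N * d \<le> (2 * r * d) * d" using d by (intro mult_le_mono1) simp
    also have "\<dots> \<le> (2 * r * d) * (2 * (d - 1))" using d2 by (intro mult_le_mono2) simp
    also have "\<dots> = 4 * r * (d * (d - 1))" by simp
    also have "\<dots> = 8 * r * (d choose 2)" unfolding c2[symmetric] by simp
    finally show ?thesis by (simp add: d_def)
  qed
  have "?N * (\<Sum>t\<in>?T. card (thru t)) \<le> (\<Sum>t\<in>?T. 8 * r * (card (thru t) choose 2))"
    unfolding sum_distrib_left by (rule sum_mono) (rule each)
  also have "\<dots> = 2 * r * (4 * (\<Sum>t\<in>?T. card (thru t) choose 2))" by (simp add: sum_distrib_left mult_ac)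
  also have "\<dots> \<le> 2 * r * (4 * (?N * ?N))" by (rule mult_le_mono2[OF p2])
  also have "\<dots> = ?N * (8 * ?N * r)" by simp
  finally have "?N * (\<Sum>t\<in>?T. card (thru t)) \<le> ?N * (8 * ?N * r)" .
  moreover have "0 < ?N" using r False by linarith
  ultimately show ?thesis by simp
qed simp

text \<open>Average of \<open>off_incidences\<close> over the samples; a poor point is off at least
  half of them, hence a factor 2. The value of \<open>\<mu>\<close> balances the terms in
  \<open>n\<close>, whose coefficients \<open>3 + 16/3\<close> are rounded up to 9.\<close>

lemma poor_incidences:
  fixes \<mu> :: real
  assumes N: "0 < card F" and r: "2 * r \<le> card F" and mu: "0 < \<mu>" "\<mu>^3 = card F / (r + 1)"
  shows "(\<Sum>t | t < n \<and> 2 * r * card (thru t) \<le> card F. card (thru t))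
    \<le> 9 * n * \<mu>^2 + 1536 * (b + 1) * card F * (r + 1)"
proof -
  let ?N = "card F"
  let ?T = "{t. t < n \<and> 2 * r * card (thru t) \<le> ?N}"
  define P where "P = real (?N choose r)"
  have P0: "0 < P" unfolding P_def using r by simp
  \<comment> \<open>Returning from samples of size \<open>r + 1\<close> to size \<open>r\<close>
    costs at most \<open>card F / (r + 1)\<close>, which is \<open>\<mu> ^ 3\<close>.\<close>
  have step: "real (?N choose (r+1)) \<le> P * (?N / (r + 1))"
  proof -
    have "Suc r * (?N choose Suc r) = (?N - r) * (?N choose r)"
      using binomial_absorption[of r ?N] binomial_absorb_comp[of ?N r] by simp
    then have "(r + 1) * (?N choose (r+1)) \<le> ?N * (?N choose r)" by simp
    then have "real ((r + 1) * (?N choose (r+1))) \<le> real (?N * (?N choose r))" by (rule of_nat_mono)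
    then show ?thesis unfolding P_def by (simp add: field_simps)
  qed
  have "P * (\<Sum>t\<in>?T. real (card (thru t))) = (\<Sum>t\<in>?T. P * real (card (thru t)))" by (simp add: sum_distrib_left)
  also have "\<dots> \<le> (\<Sum>t\<in>?T. 2 * real (card {R \<in> subsets r. off R t}) * real (card (thru t)))"
  proof (rule sum_mono)
    fix t assume "t \<in> ?T"
    then have "?N choose r \<le> 2 * card {R \<in> subsets r. off R t}" using card_off_subsets[OF N] by simp
    then have "P \<le> 2 * real (card {R \<in> subsets r. off R t})" unfolding P_def by linarith
    then show "P * real (card (thru t)) \<le> 2 * real (card {R \<in> subsets r. off R t}) * real (card (thru t))"
      by (rule mult_right_mono) simp
  qed
  also have "\<dots> = 2 * (\<Sum>t\<in>?T. \<Sum>R\<in>subsets r. if off R t then real (card (thru t)) else 0)"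
    using finite_subsets by (simp add: sum_distrib_left sum.inter_filter[symmetric] mult.assoc)
  also have "\<dots> = 2 * (\<Sum>R\<in>subsets r. \<Sum>t\<in>?T. if off R t then real (card (thru t)) else 0)"
    by (subst sum.swap) simp
  also have "\<dots> \<le> 2 * (\<Sum>R\<in>subsets r. \<Sum>t | off R t. real (card (thru t)))"
  proof (intro mult_left_mono sum_mono)
    fix R
    have "(\<Sum>t\<in>?T. if off R t then real (card (thru t)) else 0) = (\<Sum>t\<in>{t\<in>?T. off R t}. real (card (thru t)))"
      by (rule sum.inter_filter[symmetric]) simp
    also have "\<dots> \<le> (\<Sum>t | off R t. real (card (thru t)))"
      by (rule sum_mono2) (auto simp: off_def)
    finally show "(\<Sum>t\<in>?T. if off R t then real (card (thru t)) else 0) \<le> (\<Sum>t | off R t. real (card (thru t)))" .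
  qed simp
  also have "\<dots> \<le> 2 * (\<Sum>R\<in>subsets r. 3/2 * n * \<mu>^2 + 2/3 * (\<Sum>t | off R t. card (conflicts (cell R t))) / \<mu>
       + 3 * (\<Sum>\<tau>\<in>cells R. card (conflicts \<tau>)))"
    by (intro mult_left_mono sum_mono off_incidences two mu) (auto dest: subsetsD)
  also have "\<dots> = 3 * n * \<mu>^2 * P + 4/3 * real (\<Sum>R\<in>subsets r. \<Sum>t | off R t. card (conflicts (cell R t))) / \<mu>
       + 6 * real (\<Sum>R\<in>subsets r. \<Sum>\<tau>\<in>cells R. card (conflicts \<tau>))"
    unfolding P_def card_subsets[symmetric]
    by (simp add: sum.distrib sum_distrib_left sum_divide_distrib algebra_simps)
  also have "\<dots> \<le> 3 * n * \<mu>^2 * P + 4/3 * (4 * n * (P * \<mu>^3)) / \<mu> + 6 * (256 * (b + 1) * (r + 1)^2 * (P * (?N / (r + 1))))"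
  proof (intro add_mono mult_left_mono divide_right_mono)
    have "real (\<Sum>R\<in>subsets r. \<Sum>t | off R t. card (conflicts (cell R t))) \<le> real (4 * n * (?N choose (r+1)))"
      by (rule of_nat_mono[OF sum_conflicts_points])
    also have "\<dots> = 4 * n * real (?N choose (r+1))" by simp
    also have "\<dots> \<le> 4 * n * (P * \<mu>^3)"
    proof (rule mult_left_mono)
      show "real (?N choose (r+1)) \<le> P * \<mu>^3" unfolding mu(2) using step by (simp add: add.commute)
    qed simp
    finally show "real (\<Sum>R\<in>subsets r. \<Sum>t | off R t. card (conflicts (cell R t))) \<le> 4 * n * (P * \<mu>^3)" .
    have "real (\<Sum>R\<in>subsets r. \<Sum>\<tau>\<in>cells R. card (conflicts \<tau>)) \<le> real ((64 * (b + 1) * (r + 2)^2) * (?N choose (r+1)))"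
      by (rule of_nat_mono[OF sum_conflicts_cells])
    also have "\<dots> = 64 * (real b + 1) * (real r + 2)^2 * real (?N choose (r+1))" by (simp add: algebra_simps)
    also have "\<dots> \<le> 256 * (b + 1) * (r + 1)^2 * (P * (?N / (r + 1)))"
    proof (rule mult_mono[OF _ step])
      have "(real r + 2)^2 \<le> (2 * (real r + 1))^2" by (rule power_mono) auto
      also have "\<dots> = 4 * (real r + 1)^2" by (simp only: power_mult_distrib) simp
      finally have "64 * (real b + 1) * (real r + 2)^2 \<le> 64 * (real b + 1) * (4 * (real r + 1)^2)"
        by (rule mult_left_mono) simp
      then show "64 * (real b + 1) * (real r + 2)^2 \<le> real (256 * (b + 1) * (r + 1)^2)" by (simp add: algebra_simps)
    qed auto
    finally show "real (\<Sum>R\<in>subsets r. \<Sum>\<tau>\<in>cells R. card (conflicts \<tau>)) \<le> 256 * (b + 1) * (r + 1)^2 * (P * (?N / (r + 1)))" .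
  qed (use mu in auto)
  also have "\<dots> = P * (25/3 * n * \<mu>^2 + 1536 * (b + 1) * ?N * (r + 1))"
    using mu(1) by (simp add: field_simps power2_eq_square power3_eq_cube)
  also have "\<dots> \<le> P * (9 * n * \<mu>^2 + 1536 * (b + 1) * ?N * (r + 1))"
    using P0 by (intro mult_left_mono add_right_mono mult_right_mono) auto
  finally show ?thesis using P0 by simp
qed

lemma incidence_bound:
  fixes \<mu> :: real
  assumes N: "0 < card F" and r: "2 * r \<le> card F" and mu: "0 < \<mu>" "\<mu>^3 = card F / (r + 1)"
  shows "(\<Sum>h\<in>F. card (inc h)) \<le> 9 * n * \<mu>^2 + (1536 * b + 1544) * card F * (r + 1)"
proof -
  let ?A = "{t. t < n \<and> 2 * r * card (thru t) \<le> card F}" and ?B = "{t. t < n \<and> card F < 2 * r * card (thru t)}"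
  have "{..<n} = ?A \<union> ?B" by auto
  moreover have "?A \<inter> ?B = {}" by auto
  ultimately have "(\<Sum>h\<in>F. card (inc h)) = (\<Sum>t\<in>?A. card (thru t)) + (\<Sum>t\<in>?B. card (thru t))"
    unfolding sum_inc_thru by (metis (no_types, lifting) finite_Un finite_lessThan sum.union_disjoint)
  then have "real (\<Sum>h\<in>F. card (inc h)) = real (\<Sum>t\<in>?A. card (thru t)) + real (\<Sum>t\<in>?B. card (thru t))" by simp
  also have "real (\<Sum>t\<in>?B. card (thru t)) \<le> real (8 * card F * r)"
    by (rule of_nat_mono[OF rich_incidences[OF r]])
  also have "real (\<Sum>t\<in>?A. card (thru t)) \<le> 9 * n * \<mu>^2 + 1536 * (b + 1) * card F * (r + 1)"
    using poor_incidences[OF assms] by simp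
  \<comment> \<open>\<open>1536 * (b + 1) + 8 = 1536 * b + 1544\<close>, where 8 comes from the rich
    points.\<close>
  finally show ?thesis by (simp add: algebra_simps)
qed

theorem card_rich_curves:
  assumes k: "\<And>h. h \<in> F \<Longrightarrow> k \<le> card (inc h)" and k_large: "2 * (1536 * b + 1544) \<le> k"
  shows "card F \<le> 93312 * (1536 * b + 1544)^2 * real n ^ 3 / real k ^ 5 + 2 * real n / k"
proof -
  define \<kappa> where "\<kappa> = 1536 * b + 1544"
  have kap: "1 \<le> \<kappa>" "2 * \<kappa> \<le> k" using k_large by (auto simp: \<kappa>_def)
  have k0: "0 < k" using kap by linarith
  let ?N = "card F"
  \<comment> \<open>Up to rounding, the largest sample size for which the term
    \<open>\<kappa> * card F * (r + 1)\<close> of the incidence bound is at most half of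
    \<open>k * card F\<close> and can be absorbed.\<close>
  define r where "r = k div (2 * \<kappa>) - 1"
  have q: "1 \<le> k div (2 * \<kappa>)" using kap by (simp add: div_greater_zero_iff Suc_le_eq)
  then have r1: "r + 1 = k div (2 * \<kappa>)" by (simp add: r_def)
  have ru: "2 * \<kappa> * (r + 1) \<le> k" unfolding r1 by simp
  have rl: "k \<le> 4 * \<kappa> * (r + 1)"
  proof -
    have "k < 2 * \<kappa> * (k div (2 * \<kappa>)) + 2 * \<kappa>" using dividend_less_times_div[of "2 * \<kappa>" k] kap by (simp add: add.commute)
    also have "\<dots> \<le> 2 * \<kappa> * (r + 1) + 2 * \<kappa> * (r + 1)" unfolding r1 using q by (intro add_mono) auto
    finally show ?thesis by simp
  qed
  have kN: "k * ?N \<le> (\<Sum>h\<in>F. card (inc h))"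
    using sum_bounded_below[of F k "\<lambda>h. card (inc h)"] k by (simp add: mult.commute)
  show ?thesis
  proof (cases "2 * r \<le> ?N \<and> 0 < ?N")
    case True
    then have N: "0 < ?N" "2 * r \<le> ?N" by auto
    define \<mu> where "\<mu> = root 3 (?N / (r + 1))"
    have mu: "0 < \<mu>" "\<mu>^3 = ?N / (real r + 1)" unfolding \<mu>_def using N by auto
    have "k * ?N \<le> real (\<Sum>h\<in>F. card (inc h))" using kN by (metis of_nat_mono of_nat_mult)
    also have "\<dots> \<le> 9 * n * \<mu>^2 + \<kappa> * ?N * (r + 1)"
      using incidence_bound[OF N mu] by (simp add: \<kappa>_def)
    also have "real (\<kappa> * ?N * (r + 1)) \<le> real k * ?N / 2"
    proof -
      have "2 * (\<kappa> * ?N * (r + 1)) \<le> k * ?N" using mult_le_mono1[OF ru, of ?N] by (simp only: mult_ac)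
      then have "real (2 * (\<kappa> * ?N * (r + 1))) \<le> real (k * ?N)" by (rule of_nat_mono)
      then show ?thesis by simp
    qed
    finally have "real k * ?N \<le> 18 * n * \<mu>^2" by simp
    \<comment> \<open>Cubing removes the root in \<open>\<mu>\<close> and lets
      \<open>card F ^ 2\<close> cancel. The constants are \<open>18 ^ 3 = 5832\<close> and then
      \<open>4 ^ 2 * 5832 = 93312\<close>.\<close>
    then have "(real k * ?N)^3 \<le> (18 * n * \<mu>^2)^3" by (rule power_mono) simp
    also have "\<dots> = 5832 * real n ^ 3 * (\<mu>^3)^2" by (simp add: power_mult_distrib flip: power_mult)
    also have "\<dots> = 5832 * real n ^ 3 * ?N^2 / (real (r + 1))^2" unfolding mu(2) by (simp add: power_divide add.commute)
    finally have "real k ^ 3 * ?N * ?N^2 \<le> 5832 * real n ^ 3 / (real (r + 1))^2 * ?N^2"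
      by (simp add: power_mult_distrib power3_eq_cube power2_eq_square mult_ac)
    then have *: "real k ^ 3 * ?N \<le> 5832 * real n ^ 3 / (real (r + 1))^2"
      by (rule mult_right_le_imp_le) (use N in simp)
    have "real k ^ 2 \<le> (4 * \<kappa> * (r + 1))^2" using rl by (metis of_nat_mono of_nat_power power_mono zero_le)
    then have "real k ^ 2 * (real k ^ 3 * ?N) \<le> (4 * \<kappa> * (r + 1))^2 * (5832 * real n ^ 3 / (real (r + 1))^2)"
      using * by (intro mult_mono) auto
    also have "\<dots> = 93312 * \<kappa>^2 * real n ^ 3"
    proof -
      have "(4 * K * x)^2 * (5832 * y / x^2) = 93312 * K^2 * y" if "x \<noteq> 0" for K x y :: real
        using that by (simp add: field_simps power2_eq_square)
      from this[of "real (r + 1)" "real \<kappa>" "real n ^ 3"] show ?thesis by (simp add: algebra_simps)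
    qed
    finally have "real ?N * real k ^ 5 \<le> 93312 * \<kappa>^2 * real n ^ 3"
      by (simp add: power_numeral_reduce mult_ac)
    then have "real ?N \<le> 93312 * \<kappa>^2 * real n ^ 3 / real k ^ 5"
      using k0 by (simp add: pos_le_divide_eq)
    moreover have "0 \<le> 2 * real n / k" by simp
    ultimately show ?thesis unfolding \<kappa>_def by linarith
  next
    case False
    \<comment> \<open>There are too few curves for sampling, but then overlaps are negligible:
      \<open>k * card F\<close> is at most \<open>n + card F ^ 2\<close>, and
      \<open>card F ^ 2\<close> is at most half of \<open>k * card F\<close>.\<close>
    then have N: "?N < 2 * r \<or> ?N = 0" by auto
    have "8 * ?N \<le> k"
    proof -
      have "8 * ?N \<le> 16 * r" using N by auto
      also have "\<dots> \<le> 2 * \<kappa> * r" by (rule mult_le_mono1) (simp add: \<kappa>_def)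
      also have "\<dots> \<le> 2 * \<kappa> * (r + 1)" by simp
      also have "\<dots> \<le> k" by (rule ru)
      finally show ?thesis .
    qed
    have "(\<Sum>h\<in>F. card (inc h)) \<le> n + ?N * ?N"
    proof -
      have "(\<Sum>h\<in>G. card (inc h)) \<le> n + card G * card G" if "finite G" "G \<subseteq> F" for G
      proof -
        have "(\<Sum>h\<in>G. card (inc h)) \<le> card (\<Union>h\<in>G. inc h) + card G * card G" using that
        proof (induction G rule: finite_induct)
          case (insert g G)
          have "card (inc g \<inter> (\<Union>h\<in>G. inc h)) \<le> (\<Sum>h\<in>G. card (inc g \<inter> inc h))"
            unfolding Int_UN_distrib by (rule card_UN_le) (use insert in simp)
          also have "\<dots> \<le> (\<Sum>h\<in>G. 2)" by (intro sum_mono two) (use insert in auto)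
          finally have "card (inc g \<inter> (\<Union>h\<in>G. inc h)) \<le> 2 * card G" by simp
          moreover have "card (inc g \<union> (\<Union>h\<in>G. inc h)) + card (inc g \<inter> (\<Union>h\<in>G. inc h)) = card (inc g) + card (\<Union>h\<in>G. inc h)"
            by (rule card_Un_Int[symmetric]) (use insert finite_inc in auto)
          ultimately show ?case using insert by (simp add: algebra_simps)
        qed simp
        moreover have "card (\<Union>h\<in>G. inc h) \<le> card {..<n}" by (rule card_mono) (auto simp: inc_def)
        ultimately show ?thesis by simp
      qed
      from this[OF fin subset_refl] show ?thesis .
    qed
    then have "k * ?N \<le> n + ?N * ?N" using kN by linarith
    moreover have "2 * (?N * ?N) \<le> k * ?N"
    proof -
      have "2 * ?N \<le> k" using \<open>8 * ?N \<le> k\<close> by linarith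
      from mult_le_mono1[OF this, of ?N] show ?thesis by (simp only: mult.assoc)
    qed
    ultimately have "k * ?N \<le> 2 * n" by linarith
    then have "real (k * ?N) \<le> real (2 * n)" by (rule of_nat_mono)
    then have "real ?N \<le> 2 * real n / k" using k0 by (simp add: field_simps)
    moreover have "0 \<le> 93312 * (1536 * b + 1544)^2 * real n ^ 3 / real k ^ 5" by simp
    ultimately show ?thesis by linarith
  qed
qed

end
end

section \<open>Curves with few order changes\<close>

text \<open>Intervals between consecutive values overlap only in a common end.\<close>

lemma card_intervals_containing:
  fixes \<xi> :: "nat \<Rightarrow> real"
  assumes "\<And>s t. s < t \<Longrightarrow> t < n \<Longrightarrow> \<xi> s < \<xi> t"
  shows "card {t. 0 < t \<and> t < n \<and> \<xi> (t-1) \<le> z \<and> z \<le> \<xi> t} \<le> 2"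
proof (cases "{t. 0 < t \<and> t < n \<and> \<xi> (t-1) \<le> z \<and> z \<le> \<xi> t} = {}")
  case False
  let ?S = "{t. 0 < t \<and> t < n \<and> \<xi> (t-1) \<le> z \<and> z \<le> \<xi> t}"
  have fS: "finite ?S" by simp
  define m where "m = Min ?S"
  have m: "m \<in> ?S" unfolding m_def by (rule Min_in[OF fS False])
  have "?S \<subseteq> {m, m + 1}"
  proof
    fix t assume t: "t \<in> ?S"
    have "m \<le> t" unfolding m_def by (rule Min_le[OF fS t])
    moreover have "\<not> m < t - 1"
    proof
      assume "m < t - 1"
      then have "\<xi> m < \<xi> (t - 1)" by (rule assms) (use t \<open>m < t - 1\<close> in auto)
      then show False using m t by simp
    qed
    ultimately show "t \<in> {m, m + 1}" by auto
  qed
  then have "card ?S \<le> card {m, m + 1}" by (rule card_mono[rotated]) simp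
  then show ?thesis by simp
next
  case True
  then show ?thesis by (simp only: card.empty zero_le_numeral)
qed

text \<open>The cell decomposition sees only the order of the graphs above the given abscissas. Two
  graphs can swap between consecutive abscissas only if an exceptional value lies in that closed
  interval, and each value lies in at most two of them; hence \<open>2 * c\<close> flips.\<close>

theorem card_rich_graphs:
  fixes V :: "'p set" and x y :: "'p \<Rightarrow> real" and G :: "'g set" and H :: "'g \<Rightarrow> real \<Rightarrow> real"
  assumes V: "finite V" "inj_on x V" and G: "finite G"
    and two: "\<And>g g'. g \<in> G \<Longrightarrow> g' \<in> G \<Longrightarrow> g \<noteq> g' \<Longrightarrow>
        card {v \<in> V. H g (x v) = y v \<and> H g' (x v) = y v} \<le> 2"
    and rich: "\<And>g. g \<in> G \<Longrightarrow> k \<le> card {v \<in> V. H g (x v) = y v}"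
    and flips: "\<And>g g'. g \<in> G \<Longrightarrow> g' \<in> G \<Longrightarrow> g \<noteq> g' \<Longrightarrow>
        \<exists>Z. finite Z \<and> card Z \<le> c \<and> (\<forall>u\<in>x ` V. \<forall>v\<in>x ` V. u < v \<and> {u..v} \<inter> Z = {} \<longrightarrow>
            sgn (H g u - H g' u) = sgn (H g v - H g' v))"
    and k: "2 * (1536 * (2 * c) + 1544) \<le> k"
  shows "real (card G) \<le> 93312 * real ((1536 * (2 * c) + 1544)^2) * real (card V) ^ 3 / real k ^ 5 + 2 * real (card V) / k"
proof -
  define n where "n = card V"
  define xs where "xs = sorted_list_of_set (x ` V)"
  have len: "length xs = n" unfolding xs_def n_def using V by (simp add: card_image)
  define \<xi> where "\<xi> t = xs ! t" for t
  have mono: "\<xi> s < \<xi> t" if "s < t" "t < n" for s t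
    unfolding \<xi>_def using sorted_wrt_nth_less[of "(<)" xs s t] strict_sorted_list_of_set[of "x ` V"] that len
    by (simp add: xs_def)
  have setxs: "set xs = x ` V" unfolding xs_def using V by simp
  have xi_in: "\<xi> t \<in> x ` V" if "t < n" for t unfolding \<xi>_def setxs[symmetric] using that len by simp
  define e where "e t = the_inv_into V x (\<xi> t)" for t
  have e: "e t \<in> V" "x (e t) = \<xi> t" if "t < n" for t
    unfolding e_def using the_inv_into_into[OF V(2) xi_in[OF that] subset_refl] f_the_inv_into_f[OF V(2) xi_in[OF that]] by auto
  have bij_e: "bij_betw e {..<n} V"
  proof (rule bij_betw_imageI)
    show inj: "inj_on e {..<n}"
    proof (rule inj_onI)
      fix s t assume "s \<in> {..<n}" "t \<in> {..<n}" "e s = e t"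
      then have "\<xi> s = \<xi> t" using e by (metis lessThan_iff)
      then show "s = t" using mono[of s t] mono[of t s] \<open>s \<in> _\<close> \<open>t \<in> _\<close> by (cases s t rule: linorder_cases) auto
    qed
    have "e ` {..<n} \<subseteq> V" using e by auto
    then show "e ` {..<n} = V" using card_image[OF inj] V(1) by (simp add: card_subset_eq n_def)
  qed
  obtain idx :: "'g \<Rightarrow> nat" where idx: "inj_on idx G"
    using finite_imp_inj_to_nat_seg[OF G] by blast
  \<comment> \<open>Ties are broken by a numbering that does not depend on the point, so an
    unchanged sign of the height difference, zero included, means an unchanged order.\<close>
  define lt where "lt t g g' \<longleftrightarrow> H g (\<xi> t) < H g' (\<xi> t) \<or> (H g (\<xi> t) = H g' (\<xi> t) \<and> idx g < idx g')" for t g g'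
  define rank where "rank t g = card {a \<in> G. lt t a g}" for t g
  have rank_less: "rank t g < rank t g'" if "g \<in> G" "lt t g g'" for t g g'
    unfolding rank_def
  proof (rule psubset_card_mono)
    show "finite {a \<in> G. lt t a g'}" using G by simp
    have "{a \<in> G. lt t a g} \<subseteq> {a \<in> G. lt t a g'}" using that by (auto simp: lt_def)
    moreover have "g \<in> {a \<in> G. lt t a g'}" "g \<notin> {a \<in> G. lt t a g}" using that by (auto simp: lt_def)
    ultimately show "{a \<in> G. lt t a g} \<subset> {a \<in> G. lt t a g'}" by blast
  qed
  have lt_total: "lt t g g' \<or> lt t g' g" if "g \<in> G" "g' \<in> G" "g \<noteq> g'" for t g g'
    using that idx by (auto simp: lt_def dest: inj_onD) (metis inj_onD linorder_neqE_nat)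
  have rank_iff: "rank t g < rank t g' \<longleftrightarrow> lt t g g'" if "g \<in> G" "g' \<in> G" for t g g'
    using rank_less[of g t g'] rank_less[of g' t g] lt_total[OF that, of t] that by (cases "g = g'") (auto simp: lt_def)
  have rank_bound: "rank t g < card G" if "g \<in> G" for t g
    unfolding rank_def by (rule psubset_card_mono[OF G]) (use that in \<open>auto simp: lt_def\<close>)
  \<comment> \<open>Ranks run from 0 to \<open>card G - 1\<close>, so \<open>- 1\<close> and
    \<open>card G\<close> are free for \<open>bot\<close> and \<open>top\<close>, the two values of
    the \<open>bool\<close> summand.\<close>
  define key where "key t h = (case h of Inl g \<Rightarrow> real (rank t g) | Inr s \<Rightarrow> if s then real (card G) else - 1)" for t and h :: "'g + bool"
  define side where "side t h = (case h of Inl g \<Rightarrow> (if H g (\<xi> t) < y (e t) then - 1 else if H g (\<xi> t) = y (e t) then 0 else 1 :: int)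
       | Inr s \<Rightarrow> (if s then 1 else - 1))" for t and h :: "'g + bool"
  interpret cell_decomposition n "Inl ` G" "Inr False" "Inr True" key side "2 * c"
  proof
    show "finite (Inl ` G)" using G by simp
    show "inj_on (key t) (Inl ` G)" for t
    proof (rule inj_onI)
      fix h h' :: "'g + bool" assume "h \<in> Inl ` G" "h' \<in> Inl ` G" and eq: "key t h = key t h'"
      then obtain g g' where g: "h = Inl g" "h' = Inl g'" "g \<in> G" "g' \<in> G" by auto
      have "rank t g = rank t g'" using eq unfolding g(1,2) by (simp add: key_def)
      then have "g = g'" using lt_total[OF g(3,4), of t] rank_less[OF g(3), of t g'] rank_less[OF g(4), of t g] by auto
      then show "h = h'" using g by simp
    qed
    show "key t (Inr False) < key t h" if "h \<in> insert (Inr True) (Inl ` G)" for t h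
      using that by (auto simp: key_def)
    show "key t h < key t (Inr True)" if "h \<in> insert (Inr False) (Inl ` G)" for t h
      using that rank_bound by (auto simp: key_def)
    show "key t h < key t h'" if "h \<in> insert (Inr False) (insert (Inr True) (Inl ` G))"
        "h' \<in> insert (Inr False) (insert (Inr True) (Inl ` G))" "side t h < side t h'" for t h h'
      using that rank_bound by (auto simp: key_def side_def lt_def intro!: rank_less split: if_splits)
    show "side t (Inr False) < 0" "0 < side t (Inr True)" for t by (auto simp: side_def)
    show "card {t. 0 < t \<and> t < n \<and> (key (t-1) h < key (t-1) h') \<noteq> (key t h < key t h')} \<le> 2 * c"
      if hh: "h \<in> Inl ` G" "h' \<in> Inl ` G" for h h'
    proof -
      obtain g g' where g: "h = Inl g" "h' = Inl g'" "g \<in> G" "g' \<in> G" using hh by auto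
      show ?thesis
      proof (cases "g = g'")
        case True then show ?thesis using g by simp
      next
        case False
        obtain Z where Z: "finite Z" "card Z \<le> c" "\<And>u v. u \<in> x ` V \<Longrightarrow> v \<in> x ` V \<Longrightarrow> u < v \<Longrightarrow> {u..v} \<inter> Z = {} \<Longrightarrow>
            sgn (H g u - H g' u) = sgn (H g v - H g' v)"
          using flips[OF g(3,4) False] by blast
        define W where "W z = {t. 0 < t \<and> t < n \<and> \<xi> (t-1) \<le> z \<and> z \<le> \<xi> t}" for z
        have cW: "card (W z) \<le> 2" for z unfolding W_def by (rule card_intervals_containing) (rule mono)
        have "t \<in> (\<Union>z\<in>Z. W z)" if t: "0 < t" "t < n" "(key (t-1) h < key (t-1) h') \<noteq> (key t h < key t h')" for t
        proof (rule ccontr)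
          assume "t \<notin> (\<Union>z\<in>Z. W z)"
          then have "{\<xi> (t-1)..\<xi> t} \<inter> Z = {}" using t by (auto simp: W_def)
          then have "sgn (H g (\<xi> (t-1)) - H g' (\<xi> (t-1))) = sgn (H g (\<xi> t) - H g' (\<xi> t))"
            by (intro Z(3) xi_in mono) (use t in auto)
          then have "lt (t-1) g g' = lt t g g'" unfolding lt_def by (auto simp: sgn_if split: if_splits)
          then show False using t(3) rank_iff[OF g(3,4)] unfolding g(1,2) by (simp add: key_def)
        qed
        then have "card {t. 0 < t \<and> t < n \<and> (key (t-1) h < key (t-1) h') \<noteq> (key t h < key t h')} \<le> card (\<Union>z\<in>Z. W z)"
          by (intro card_mono) (use Z in \<open>auto simp: W_def\<close>)
        also have "\<dots> \<le> (\<Sum>z\<in>Z. card (W z))" by (rule card_UN_le[OF Z(1)])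
        also have "\<dots> \<le> (\<Sum>z\<in>Z. 2)" by (rule sum_mono[OF cW])
        also have "\<dots> \<le> 2 * c" using Z(2) by simp
        finally show ?thesis .
      qed
    qed
  qed auto
  have inc: "inc (Inl g) = {t. t < n \<and> H g (x (e t)) = y (e t)}" for g
    using e(2) by (auto simp: inc_def side_def split: if_splits)
  have card_e: "card {t. t < n \<and> Q (e t)} = card {v \<in> V. Q v}" for Q
  proof -
    have "{v \<in> V. Q v} = e ` {t. t < n \<and> Q (e t)}"
      using bij_e by (auto simp: bij_betw_def)
    moreover have "inj_on e {t. t < n \<and> Q (e t)}"
      by (rule inj_on_subset[of e "{..<n}"]) (use bij_e in \<open>auto simp: bij_betw_def\<close>)
    ultimately show ?thesis by (simp add: card_image)
  qed
  have "real (card (Inl ` G :: ('g + bool) set)) \<le> 93312 * (1536 * (2 * c) + 1544)^2 * real n ^ 3 / real k ^ 5 + 2 * real n / k"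
  proof (rule card_rich_curves)
    show "card (inc h \<inter> inc h') \<le> 2" if "h \<in> Inl ` G" "h' \<in> Inl ` G" "h \<noteq> h'" for h h' :: "'g + bool"
    proof -
      obtain g g' where g: "h = Inl g" "h' = Inl g'" "g \<in> G" "g' \<in> G" "g \<noteq> g'" using \<open>h \<in> _\<close> \<open>h' \<in> _\<close> \<open>h \<noteq> h'\<close> by auto
      have "inc h \<inter> inc h' = {t. t < n \<and> (H g (x (e t)) = y (e t) \<and> H g' (x (e t)) = y (e t))}"
        unfolding g(1,2) inc by auto
      then show ?thesis using card_e[of "\<lambda>v. H g (x v) = y v \<and> H g' (x v) = y v"] two[OF g(3-5)] by simp
    qed
    show "k \<le> card (inc h)" if "h \<in> Inl ` G" for h
      using that rich card_e[of "\<lambda>v. H g (x v) = y v" for g] by (auto simp: inc)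
    show "2 * (1536 * (2 * c) + 1544) \<le> k" by (rule k)
  qed
  then show ?thesis by (simp add: card_image n_def)
qed

section \<open>Conics\<close>

lemma sgn_eq_if_no_zero:
  fixes f :: "real \<Rightarrow> real"
  assumes "continuous_on {u..v} f" "u \<le> v" "\<And>z. u \<le> z \<Longrightarrow> z \<le> v \<Longrightarrow> f z \<noteq> 0"
  shows "sgn (f u) = sgn (f v)"
proof (rule ccontr)
  assume ne: "sgn (f u) \<noteq> sgn (f v)"
  have "f u \<noteq> 0" "f v \<noteq> 0" using assms by auto
  then consider "f u < 0" "0 < f v" | "0 < f u" "f v < 0" using ne by (auto simp: sgn_if split: if_splits)
  then show False
  proof cases
    case 1
    then show False using IVT'[of f u 0 v] assms by auto
  next
    case 2
    then show False using IVT2'[of f v 0 u] assms by auto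
  qed
qed

lemma poly_eq_linear: "degree p \<le> 1 \<Longrightarrow> p = [:coeff p 0, coeff p 1:]"
  by (rule poly_eqI) (auto simp: coeff_pCons coeff_eq_0 split: nat.split)

lemma poly_degree_le_1: "degree p \<le> 1 \<Longrightarrow> poly p u = coeff p 0 + coeff p 1 * (u::real)"
  by (subst poly_eq_linear) auto

text \<open>With the factor 2 the branches are \<open>- B\<close> plus or minus the square root of
  the discriminant \<open>B^2 - C\<close>.\<close>

definition monic_conic :: "real poly \<Rightarrow> real poly \<Rightarrow> real \<Rightarrow> real \<Rightarrow> real" where
  "monic_conic B C u v = v^2 + 2 * poly B u * v + poly C u"

text \<open>The discriminant of a conic that contains no line is not the square of a polynomial.\<close>

lemma discriminant_not_square:
  fixes B C w :: "real poly" and p1 p2 p3 :: "real \<times> real"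
  assumes deg: "degree B \<le> 1" "degree w \<le> 1" and sq: "B^2 - C = w^2"
    and zero: "monic_conic B C (fst p1) (snd p1) = 0" "monic_conic B C (fst p2) (snd p2) = 0" "monic_conic B C (fst p3) (snd p3) = 0"
    and mid: "monic_conic B C ((fst p1 + fst p2)/2) ((snd p1 + snd p2)/2) \<noteq> 0"
       "monic_conic B C ((fst p1 + fst p3)/2) ((snd p1 + snd p3)/2) \<noteq> 0"
       "monic_conic B C ((fst p2 + fst p3)/2) ((snd p2 + snd p3)/2) \<noteq> 0"
  shows False
proof -
  have fac: "monic_conic B C u v = (v + poly B u - poly w u) * (v + poly B u + poly w u)" for u v
  proof -
    have "poly B u ^ 2 - poly C u = poly w u ^ 2" using arg_cong[OF sq, of "\<lambda>p. poly p u"] by simp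
    then show ?thesis unfolding monic_conic_def by algebra
  qed
  define L where "L s p \<longleftrightarrow> snd p = - poly B (fst p) + s * poly w (fst p)" for s :: real and p
  have branch: "L 1 p \<or> L (-1) p" if "monic_conic B C (fst p) (snd p) = 0" for p
  proof -
    have "snd p + poly B (fst p) - poly w (fst p) = 0 \<or> snd p + poly B (fst p) + poly w (fst p) = 0"
      using that unfolding fac by (simp only: mult_eq_0_iff)
    then show ?thesis unfolding L_def by auto
  qed
  have midp: "monic_conic B C ((fst p + fst q)/2) ((snd p + snd q)/2) = 0" if "L s p" "L s q" "s = 1 \<or> s = -1" for s p q
  proof -
    have "(snd p + snd q)/2 + poly B ((fst p + fst q)/2) - s * poly w ((fst p + fst q)/2) = 0"
      using that(1,2) unfolding L_def poly_degree_le_1[OF deg(1)] poly_degree_le_1[OF deg(2)] by (simp add: field_simps)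
    then show ?thesis using that(3) unfolding fac by auto
  qed
  \<comment> \<open>Two of the three points lie on the same linear factor, and then so does their
    midpoint.\<close>
  show False using branch[OF zero(1)] branch[OF zero(2)] branch[OF zero(3)] midp mid by blast
qed

text \<open>The resultant of two conics with respect to the ordinate.\<close>

definition res_conic :: "real poly \<Rightarrow> real poly \<Rightarrow> real poly \<Rightarrow> real poly \<Rightarrow> real poly" where
  "res_conic B C B' C' = (C - C')^2 - 4 * B * (B - B') * (C - C') + 4 * C * (B - B')^2"

text \<open>Subtracting the conics leaves \<open>2 * (B - B') * v + (C - C') = 0\<close>, which is
  linear in \<open>v\<close>. Eliminating \<open>v\<close> from the first conic with it and clearing
  the denominator \<open>4 * (B - B')^2\<close> gives \<open>res_conic\<close>.\<close>

lemma res_conic_common_zero: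
  assumes "monic_conic B C u v = 0" "monic_conic B' C' u v = 0"
  shows "poly (res_conic B C B' C') u = 0"
  using assms unfolding monic_conic_def res_conic_def by simp algebra

lemma degree_res_conic:
  assumes "degree B \<le> 1" "degree C \<le> 2" "degree B' \<le> 1" "degree C' \<le> 2"
  shows "degree (res_conic B C B' C') \<le> 4"
proof -
  have b: "degree (B - B') \<le> 1" and c: "degree (C - C') \<le> 2" using assms by (auto intro: degree_diff_le)
  have "degree ((C - C')^2) \<le> 4" using degree_power_le[of "C - C'" 2] c by linarith
  moreover have "degree (4 * B * (B - B') * (C - C')) \<le> 4"
    using degree_mult_le[of "4 * B * (B - B')" "C - C'"] degree_mult_le[of "4 * B" "B - B'"] degree_mult_le[of 4 B] b c assms
    by (simp add: degree_numeral)
  moreover have "degree (4 * C * (B - B')^2) \<le> 4"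
    using degree_mult_le[of "4 * C" "(B - B')^2"] degree_mult_le[of 4 C] degree_power_le[of "B - B'" 2] b assms
    by (simp add: degree_numeral)
  ultimately show ?thesis unfolding res_conic_def by (intro degree_add_le degree_diff_le) auto
qed

text \<open>An identically vanishing resultant of two different conics signals a common component,
  so the first conic splits into lines. Algebraically, completing the square writes the resultant as
  \<open>\<gamma>^2 - \<beta>^2 * (B^2 - C)\<close>.\<close>

lemma res_conic_eq_0:
  assumes "degree B \<le> 1" "degree C \<le> 2" "res_conic B C B' C' = 0" "B \<noteq> B' \<or> C \<noteq> C'" "degree B' \<le> 1"
  shows "\<exists>w. degree w \<le> 1 \<and> B^2 - C = w^2"
proof (cases "B = B'")
  case True
  then show ?thesis using assms by (simp add: res_conic_def)
next
  case False
  define \<beta> where "\<beta> = 2 * (B - B')"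
  define \<gamma> where "\<gamma> = C - C' - B * \<beta>"
  have b0: "\<beta> \<noteq> 0" using False by (simp add: \<beta>_def)
  have eq: "\<gamma>^2 = \<beta>^2 * (B^2 - C)"
  proof -
    have "\<gamma>^2 - \<beta>^2 * (B^2 - C) = res_conic B C B' C'"
      unfolding \<beta>_def \<gamma>_def res_conic_def by algebra
    then show ?thesis using assms(3) by simp
  qed
  \<comment> \<open>As \<open>\<beta>\<close> has degree at most 1, divisibility amounts to
    \<open>\<gamma>\<close> vanishing at the root of \<open>\<beta>\<close>, if there is
    one.\<close>
  have "\<beta> dvd \<gamma>"
  proof -
    have "degree \<beta> \<le> 1" using assms(1,5) by (auto simp: \<beta>_def intro!: order_trans[OF degree_mult_le] degree_diff_le)
    then have "\<beta> = [:coeff \<beta> 0, coeff \<beta> 1:]" by (rule poly_eq_linear)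
    then obtain p q where pq: "\<beta> = [:p, q:]" by blast
    show ?thesis
    proof (cases "q = 0")
      case True
      then have "\<gamma> = \<beta> * smult (1/p) \<gamma>" using pq b0 by auto
      then show ?thesis by (rule dvdI)
    next
      case False
      have "poly \<beta> (- p / q) = 0" using pq False by simp
      then have "poly \<gamma> (- p / q) = 0" using arg_cong[OF eq, of "\<lambda>r. poly r (- p / q)"] by simp
      then obtain s where "\<gamma> = [:- (- p / q), 1:] * s" unfolding poly_eq_0_iff_dvd by (rule dvdE)
      also have "[:- (- p / q), 1:] = \<beta> * [:1/q:]" using pq False by simp
      finally have "\<gamma> = \<beta> * ([:1/q:] * s)" by (simp only: mult.assoc)
      then show ?thesis by (rule dvdI)
    qed
  qed
  then obtain w where w: "\<gamma> = \<beta> * w" by (rule dvdE)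
  have "\<beta>^2 * w^2 = \<beta>^2 * (B^2 - C)" using eq unfolding w by (simp only: power_mult_distrib)
  then have sq: "B^2 - C = w^2" using b0 by simp
  have "degree (B^2 - C) \<le> 2" using assms(1,2) degree_power_le[of B 2] by (intro degree_diff_le) auto
  then have "degree w \<le> 1" unfolding sq by (cases "w = 0") (auto simp: degree_power_eq)
  with sq show ?thesis by blast
qed

text \<open>One of the two branches of a monic_conic carries half of its points. The graphs of two branches change their
  order only at the at most $4$ zeros of the resultant and the at most $2 + 2$ zeros of the discriminants,
  so the bound for graphs applies with $8$ exceptional abscissas, and $26120 = 1536 \cdot 16 + 1544$.\<close>

theorem card_rich_conics:
  fixes V :: "'p set" and x y :: "'p \<Rightarrow> real" and G :: "'g set" and Bp Cp :: "'g \<Rightarrow> real poly"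
  defines "on g v \<equiv> monic_conic (Bp g) (Cp g) (x v) (y v) = 0"
  assumes V: "finite V" "inj_on x V" and G: "finite G"
    and deg: "\<And>g. g \<in> G \<Longrightarrow> degree (Bp g) \<le> 1" "\<And>g. g \<in> G \<Longrightarrow> degree (Cp g) \<le> 2"
    and two: "\<And>g g'. g \<in> G \<Longrightarrow> g' \<in> G \<Longrightarrow> g \<noteq> g' \<Longrightarrow> card {v \<in> V. on g v \<and> on g' v} \<le> 2"
    and rich: "\<And>g. g \<in> G \<Longrightarrow> k \<le> card {v \<in> V. on g v}"
    and nondeg: "\<And>g. g \<in> G \<Longrightarrow> \<exists>v1 v2 v3. on g v1 \<and> on g v2 \<and> on g v3 \<and>
       monic_conic (Bp g) (Cp g) ((x v1 + x v2)/2) ((y v1 + y v2)/2) \<noteq> 0 \<and>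
       monic_conic (Bp g) (Cp g) ((x v1 + x v3)/2) ((y v1 + y v3)/2) \<noteq> 0 \<and>
       monic_conic (Bp g) (Cp g) ((x v2 + x v3)/2) ((y v2 + y v3)/2) \<noteq> 0"
    and k: "104482 \<le> k"
  shows "card G \<le> 22674816 * 26120^2 * real (card V) ^ 3 / real k ^ 5 + 6 * real (card V) / k"
proof -
  define D where "D g = (Bp g)^2 - Cp g" for g
  have degD: "degree (D g) \<le> 2" if "g \<in> G" for g
    unfolding D_def using deg[OF that] degree_power_le[of "Bp g" 2] by (intro degree_diff_le) auto
  have nsq: False if "g \<in> G" "degree w \<le> 1" "D g = w^2" for g w
  proof -
    obtain v1 v2 v3 where *: "on g v1 \<and> on g v2 \<and> on g v3 \<and>
       monic_conic (Bp g) (Cp g) ((x v1 + x v2)/2) ((y v1 + y v2)/2) \<noteq> 0 \<and>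
       monic_conic (Bp g) (Cp g) ((x v1 + x v3)/2) ((y v1 + y v3)/2) \<noteq> 0 \<and>
       monic_conic (Bp g) (Cp g) ((x v2 + x v3)/2) ((y v2 + y v3)/2) \<noteq> 0" using nondeg[OF \<open>g \<in> G\<close>] by blast
    show False
      by (rule discriminant_not_square[of "Bp g" w "Cp g" "(x v1, y v1)" "(x v2, y v2)" "(x v3, y v3)"])
        (use * that deg[OF \<open>g \<in> G\<close>] in \<open>auto simp: on_def D_def\<close>)
  qed
  have D0: "D g \<noteq> 0" if "g \<in> G" for g using nsq[OF that, of 0] by auto
  define br where "br s g u = - poly (Bp g) u + s * sqrt (poly (D g) u)" for s :: real and g u
  have conic_iff: "monic_conic (Bp g) (Cp g) u v = (v + poly (Bp g) u)^2 - poly (D g) u" for g u v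
    unfolding monic_conic_def D_def by (simp add: power2_eq_square algebra_simps)
  have br_conic: "monic_conic (Bp g) (Cp g) u (br s g u) = 0" if "0 \<le> poly (D g) u" "s = 1 \<or> s = -1" for g u s
    using that by (auto simp: conic_iff br_def power2_eq_square)
  have on_br: "0 \<le> poly (D g) (x v) \<and> (y v = br 1 g (x v) \<or> y v = br (-1) g (x v))" if "on g v" for g v
  proof -
    have sq: "(y v + poly (Bp g) (x v))^2 = poly (D g) (x v)" using that by (simp add: on_def conic_iff)
    then have "0 \<le> poly (D g) (x v)" by (metis zero_le_power2)
    moreover have "sqrt (poly (D g) (x v)) = \<bar>y v + poly (Bp g) (x v)\<bar>" unfolding sq[symmetric] by simp
    ultimately show ?thesis unfolding br_def by linarith
  qed
  define side where "side s g = {v \<in> V. 0 \<le> poly (D g) (x v) \<and> y v = br s g (x v)}" for s g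
  define s where "s g = (if k div 2 \<le> card (side 1 g) then 1 else - 1 :: real)" for g
  have s: "s g = 1 \<or> s g = -1" for g by (simp add: s_def)
  have s_rich: "k div 2 \<le> card (side (s g) g)" if "g \<in> G" for g
  proof (cases "k div 2 \<le> card (side 1 g)")
    case False
    have "{v \<in> V. on g v} \<subseteq> side 1 g \<union> side (-1) g" using on_br by (auto simp: side_def)
    then have "card {v \<in> V. on g v} \<le> card (side 1 g \<union> side (-1) g)" by (rule card_mono[rotated]) (use V in \<open>auto simp: side_def\<close>)
    also have "\<dots> \<le> card (side 1 g) + card (side (-1) g)" by (rule card_Un_le)
    finally show ?thesis using False rich[OF that] by (simp add: s_def)
  qed (simp add: s_def)
  \<comment> \<open>Where its branch is not real, a graph is put at a height \<open>M\<close> above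
    all points and all branch values at them. There it meets no point, and its order with any other
    graph stays the same as long as no discriminant changes sign.\<close>
  obtain M where M: "\<And>v. v \<in> V \<Longrightarrow> y v < M" "\<And>g v. g \<in> G \<Longrightarrow> v \<in> V \<Longrightarrow> br (s g) g (x v) < M"
  proof -
    define S where "S = y ` V \<union> (\<lambda>(g, v). br (s g) g (x v)) ` (G \<times> V)"
    have "finite S" unfolding S_def using V G by simp
    then have "\<forall>a\<in>S. a \<le> Max (insert 0 S)" by simp
    then have "\<forall>a\<in>S. a < Max (insert 0 S) + 1" by force
    then show ?thesis by (intro that[of "Max (insert 0 S) + 1"]) (auto simp: S_def)
  qed
  define H where "H g u = (if 0 \<le> poly (D g) u then br (s g) g u else M)" for g u
  have H_on: "{v \<in> V. H g (x v) = y v} = side (s g) g" for g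
    using M(1) by (auto simp: H_def side_def)
  have side_on: "v \<in> side (s g) g \<Longrightarrow> v \<in> V \<and> on g v" for g v
    using br_conic[of g "x v" "s g"] s[of g] by (auto simp: side_def on_def)
  have "real (card G) \<le> 93312 * real ((1536 * (2 * 8) + 1544)^2) * real (card V) ^ 3 / real (k div 2) ^ 5 + 2 * real (card V) / real (k div 2)"
  proof (rule card_rich_graphs[OF V G, where H = H and c = 8])
    show "k div 2 \<le> card {v \<in> V. H g (x v) = y v}" if "g \<in> G" for g
      unfolding H_on by (rule s_rich[OF that])
    show "card {v \<in> V. H g (x v) = y v \<and> H g' (x v) = y v} \<le> 2" if "g \<in> G" "g' \<in> G" "g \<noteq> g'" for g g'
    proof -
      have "{v \<in> V. H g (x v) = y v \<and> H g' (x v) = y v} = side (s g) g \<inter> side (s g') g'"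
        unfolding H_on[symmetric] by auto
      also have "\<dots> \<subseteq> {v \<in> V. on g v \<and> on g' v}" using side_on by blast
      finally have "card {v \<in> V. H g (x v) = y v \<and> H g' (x v) = y v} \<le> card {v \<in> V. on g v \<and> on g' v}"
        by (rule card_mono[rotated]) (use V in simp)
      then show ?thesis using two[OF that] by simp
    qed
    show "\<exists>Z. finite Z \<and> card Z \<le> 8 \<and> (\<forall>u\<in>x ` V. \<forall>v\<in>x ` V. u < v \<and> {u..v} \<inter> Z = {} \<longrightarrow>
            sgn (H g u - H g' u) = sgn (H g v - H g' v))" if g: "g \<in> G" "g' \<in> G" "g \<noteq> g'" for g g'
    proof -
      define R where "R = res_conic (Bp g) (Cp g) (Bp g') (Cp g')"
      have R0: "R \<noteq> 0"
      proof
        assume "R = 0"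
        \<comment> \<open>Equal equations would make the conics share all of their at least
          \<open>k\<close> points, more than two.\<close>
        moreover have "Bp g \<noteq> Bp g' \<or> Cp g \<noteq> Cp g'"
        proof (rule ccontr)
          assume "\<not> (Bp g \<noteq> Bp g' \<or> Cp g \<noteq> Cp g')"
          then have "{v \<in> V. on g v \<and> on g' v} = {v \<in> V. on g v}" by (auto simp: on_def)
          then show False using two[OF g] rich[OF g(1)] k by simp
        qed
        ultimately show False
          using res_conic_eq_0[of "Bp g" "Cp g" "Bp g'" "Cp g'"] deg[OF g(1)] deg[OF g(2)] nsq[OF g(1)]
          unfolding R_def D_def by blast
      qed
      define P where "P = R * D g * D g'"
      have P0: "P \<noteq> 0" using R0 D0 g by (simp add: P_def)
      have "degree R \<le> 4" unfolding R_def by (rule degree_res_conic) (use deg g in auto)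
      then have "degree P \<le> 8" unfolding P_def
        using degree_mult_le[of "R * D g" "D g'"] degree_mult_le[of R "D g"] degD[OF g(1)] degD[OF g(2)] by linarith
      moreover have "card {z. poly P z = 0} \<le> degree P" by (rule card_poly_roots_bound[OF P0])
      moreover have "sgn (H g u - H g' u) = sgn (H g v - H g' v)"
        if uv: "u \<in> x ` V" "v \<in> x ` V" "u < v" "{u..v} \<inter> {z. poly P z = 0} = {}" for u v
      proof -
        have nz: "poly R z \<noteq> 0" "poly (D g) z \<noteq> 0" "poly (D g') z \<noteq> 0" if "u \<le> z" "z \<le> v" for z
          using uv(4) that by (auto simp: P_def)
        have sg: "sgn (poly (D h) u) = sgn (poly (D h) z)" if "u \<le> z" "z \<le> v" "h = g \<or> h = g'" for h z
          by (rule sgn_eq_if_no_zero) (use that nz in \<open>auto intro!: continuous_intros\<close>)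
        have Dpos: "0 \<le> poly (D h) z \<longleftrightarrow> 0 \<le> poly (D h) u" if "u \<le> z" "z \<le> v" "h = g \<or> h = g'" for h z
          using sg[OF that] by (auto simp: sgn_if split: if_splits)
        have Mb: "br (s h) h z < M" if "h = g \<or> h = g'" "z = u \<or> z = v" for h z
          using M(2) that g uv(1,2) by auto
        have Dv: "0 \<le> poly (D g) v \<longleftrightarrow> 0 \<le> poly (D g) u" "0 \<le> poly (D g') v \<longleftrightarrow> 0 \<le> poly (D g') u"
          using Dpos[of v] uv(3) by auto
        show ?thesis
        proof (cases "0 \<le> poly (D g) u \<and> 0 \<le> poly (D g') u")
          case True
          define f where "f z = br (s g) g z - br (s g') g' z" for z
          have cont: "continuous_on {u..v} f" unfolding f_def br_def by (intro continuous_intros)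
          have nzf: "f z \<noteq> 0" if z: "u \<le> z" "z \<le> v" for z
          proof -
            have "0 \<le> poly (D g) z" "0 \<le> poly (D g') z" using Dpos[of z] True z by auto
            then have "f z = 0 \<Longrightarrow> poly R z = 0" unfolding R_def f_def
              using res_conic_common_zero[OF br_conic[of g z "s g"], of "Bp g'" "Cp g'"] br_conic[of g' z "s g'"] s by auto
            then show ?thesis using nz z by blast
          qed
          have "sgn (f u) = sgn (f v)"
            using sgn_eq_if_no_zero[OF cont less_imp_le[OF uv(3)]] nzf by blast
          then show ?thesis using True Dv by (simp add: H_def f_def)
        next
          case False
          then show ?thesis using Dv Mb[of g u] Mb[of g v] Mb[of g' u] Mb[of g' v] by (auto simp: H_def sgn_if)
        qed
      qed
      ultimately show ?thesis using poly_roots_finite[OF P0]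
        by (intro exI[of _ "{z. poly P z = 0}"]) auto
    qed
    \<comment> \<open>Origin of the threshold for \<open>k\<close>: half of it has to reach
      \<open>2 * 26120 = 52240\<close>.\<close>
    show "2 * (1536 * (2 * 8) + 1544) \<le> k div 2" using k by simp
  qed
  also have "\<dots> \<le> 22674816 * 26120^2 * real (card V) ^ 3 / real k ^ 5 + 6 * real (card V) / k"
  proof (rule add_mono)
    \<comment> \<open>The factor 3 allows for rounding in the halving of \<open>k\<close>;
      \<open>93312 * 3 ^ 5 = 22674816\<close> and \<open>2 * 3 = 6\<close>.\<close>
    have "k \<le> 3 * (k div 2)" using k by linarith
    then have k3: "real k \<le> 3 * real (k div 2)" by linarith
    have k0: "0 < real (k div 2)" "0 < real k" using k by auto
    have "real k ^ 5 \<le> (3 * real (k div 2)) ^ 5" by (rule power_mono[OF k3]) simp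
    then have "real k ^ 5 \<le> 243 * real (k div 2) ^ 5" by (simp add: power_mult_distrib)
    then have "1 / real (k div 2) ^ 5 \<le> 243 / real k ^ 5" using k0 by (simp add: field_simps)
    then have "93312 * 26120^2 * real (card V) ^ 3 * (1 / real (k div 2) ^ 5) \<le> 93312 * 26120^2 * real (card V) ^ 3 * (243 / real k ^ 5)"
      by (rule mult_left_mono) simp
    then show "93312 * real ((1536 * (2 * 8) + 1544)^2) * real (card V) ^ 3 / real (k div 2) ^ 5 \<le> 22674816 * 26120^2 * real (card V) ^ 3 / real k ^ 5"
      by simp
    have "1 / real (k div 2) \<le> 3 / real k" using k0 k3 by (simp add: field_simps)
    then have "2 * real (card V) * (1 / real (k div 2)) \<le> 2 * real (card V) * (3 / real k)" by (rule mult_left_mono) simp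
    then show "2 * real (card V) / real (k div 2) \<le> 6 * real (card V) / k" by simp
  qed
  finally show ?thesis .
qed

section \<open>Lines and reguli in a chart\<close>

text \<open>The scalar triple product, that is the determinant with rows \<open>u\<close>,
  \<open>v\<close>, \<open>w\<close>.\<close>

definition tri :: "space \<Rightarrow> space \<Rightarrow> space \<Rightarrow> real" where
  "tri u v w = u$1 * (v$2 * w$3 - v$3 * w$2) - u$2 * (v$1 * w$3 - v$3 * w$1) + u$3 * (v$1 * w$2 - v$2 * w$1)"

text \<open>A whole line, as the parameter ranges over all reals; a single point if \<open>d\<close>
  is 0.\<close>

definition ray :: "space \<Rightarrow> space \<Rightarrow> space set" where
  "ray a d = range (\<lambda>t. a + t *\<^sub>R d)"

lemma affine_hull_pair_ray: "affine hull {p, q} = ray p (q - p)"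
proof -
  have "{u *\<^sub>R p + v *\<^sub>R q | u v. u + v = 1} = ray p (q - p)"
    unfolding ray_def
  proof safe
    fix u v :: real assume "u + v = 1"
    then have "u = 1 - v" by simp
    then have "u *\<^sub>R p + v *\<^sub>R q = p + v *\<^sub>R (q - p)" by (simp only: scaleR_left_diff_distrib scaleR_right_diff_distrib) simp
    then show "u *\<^sub>R p + v *\<^sub>R q \<in> range (\<lambda>t. p + t *\<^sub>R (q - p))" by blast
  next
    fix t :: real
    have "p + t *\<^sub>R (q - p) = (1 - t) *\<^sub>R p + t *\<^sub>R q" by (simp add: algebra_simps)
    then show "\<exists>u v. p + t *\<^sub>R (q - p) = u *\<^sub>R p + v *\<^sub>R q \<and> u + v = 1"
      by (intro exI[of _ "1 - t"] exI[of _ t]) simp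
  qed
  then show ?thesis by (simp add: affine_hull_2)
qed

lemma is_line_iff: "is_line l \<longleftrightarrow> (\<exists>a d. d \<noteq> 0 \<and> l = ray a d)"
proof
  assume l: "is_line l"
  obtain B where B: "affine hull B = affine hull l" "of_nat (card B) = aff_dim l + 1"
    using aff_dim_basis_exists by blast
  then have "card B = 2" using l by (simp add: is_line_def)
  then obtain p q where "B = {p, q}" "p \<noteq> q" by (auto simp: card_2_iff)
  then show "\<exists>a d. d \<noteq> 0 \<and> l = ray a d"
    using B(1) l affine_hull_pair_ray[of p q] by (intro exI[of _ p] exI[of _ "q - p"]) (simp add: is_line_def hull_same)
next
  assume "\<exists>a d. d \<noteq> 0 \<and> l = ray a d"
  then obtain a d where "d \<noteq> 0" "l = ray a d" by blast
  then have "l = affine hull {a, a + d}" using affine_hull_pair_ray[of a "a + d"] by simp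
  then show "is_line l" using \<open>d \<noteq> 0\<close> by (simp add: is_line_def aff_dim_2)
qed

lemma ray_parallel: "affine_parallel (ray a d) (ray a' (c *\<^sub>R d))" if "c \<noteq> 0"
proof -
  have "ray a' (c *\<^sub>R d) = (\<lambda>x. (a' - a) + x) ` ray a d"
  proof -
    have "ray a' (c *\<^sub>R d) = ray a' d"
    proof -
      have "a' + t *\<^sub>R c *\<^sub>R d \<in> ray a' d" for t unfolding ray_def by (intro image_eqI[of _ _ "t * c"]) auto
      moreover have "a' + t *\<^sub>R d \<in> ray a' (c *\<^sub>R d)" for t
        unfolding ray_def using that by (intro image_eqI[of _ _ "t / c"]) auto
      ultimately show ?thesis unfolding ray_def by blast
    qed
    also have "\<dots> = (\<lambda>x. (a' - a) + x) ` ray a d" unfolding ray_def image_image by simp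
    finally show ?thesis .
  qed
  then show ?thesis unfolding affine_parallel_def by blast
qed

lemma parallel_ray_dir:
  assumes "affine_parallel (ray a d) (ray a' d')"
  shows "\<exists>c. d' = c *\<^sub>R d"
proof -
  obtain v where v: "ray a' d' = (\<lambda>x. v + x) ` ray a d" using assms unfolding affine_parallel_def by blast
  have "a' + 0 *\<^sub>R d' \<in> ray a' d'" "a' + 1 *\<^sub>R d' \<in> ray a' d'" unfolding ray_def by blast+
  then have "\<exists>s. a' = v + (a + s *\<^sub>R d)" "\<exists>t. a' + d' = v + (a + t *\<^sub>R d)" unfolding v by (auto simp: ray_def)
  then obtain s t where "a' = v + (a + s *\<^sub>R d)" "a' + d' = v + (a + t *\<^sub>R d)" by blast
  then have "d' = (v + (a + t *\<^sub>R d)) - (v + (a + s *\<^sub>R d))" by (metis add_diff_cancel_left')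
  then have "d' = (t - s) *\<^sub>R d" by (simp add: algebra_simps)
  then show ?thesis by blast
qed

lemma tri_decomp:
  assumes "tri d e d' = 0" "d \<noteq> 0" "\<nexists>c. d' = c *\<^sub>R d"
  shows "\<exists>\<alpha> \<beta>. e = \<alpha> *\<^sub>R d + \<beta> *\<^sub>R d'"
proof -
  \<comment> \<open>The cross product of \<open>d\<close> and \<open>d'\<close>; its squared length
    \<open>N\<close> vanishes only for dependent vectors.\<close>
  define n1 n2 n3 where "n1 = d$2 * d'$3 - d$3 * d'$2" and "n2 = d$3 * d'$1 - d$1 * d'$3" and "n3 = d$1 * d'$2 - d$2 * d'$1"
  define N where "N = n1^2 + n2^2 + n3^2"
  have "N \<noteq> 0"
  proof
    assume "N = 0"
    then have z: "n1 = 0" "n2 = 0" "n3 = 0" unfolding N_def by (simp_all add: add_nonneg_eq_0_iff)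
    consider "d$1 \<noteq> 0" | "d$2 \<noteq> 0" | "d$3 \<noteq> 0" using assms(2) by (auto simp: vec_eq_iff forall_3)
    then have "\<exists>c. d' = c *\<^sub>R d"
    proof cases
      case 1 then show ?thesis using z unfolding n1_def n2_def n3_def
        by (intro exI[of _ "d'$1 / d$1"]) (auto simp: vec_eq_iff forall_3 field_simps)
    next
      case 2 then show ?thesis using z unfolding n1_def n2_def n3_def
        by (intro exI[of _ "d'$2 / d$2"]) (auto simp: vec_eq_iff forall_3 field_simps)
    next
      case 3 then show ?thesis using z unfolding n1_def n2_def n3_def
        by (intro exI[of _ "d'$3 / d$3"]) (auto simp: vec_eq_iff forall_3 field_simps)
    qed
    then show False using assms(3) by blast
  qed
  \<comment> \<open>Cramer's rule in the plane of \<open>d\<close> and \<open>d'\<close>: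
    \<open>A\<close> and \<open>B\<close> are the inner products of the normal with the cross
    products of \<open>e\<close> and \<open>d'\<close>, and of \<open>d\<close> and
    \<open>e\<close>.\<close>
  define A where "A = n1 * (e$2 * d'$3 - e$3 * d'$2) + n2 * (e$3 * d'$1 - e$1 * d'$3) + n3 * (e$1 * d'$2 - e$2 * d'$1)"
  define B where "B = n1 * (d$2 * e$3 - d$3 * e$2) + n2 * (d$3 * e$1 - d$1 * e$3) + n3 * (d$1 * e$2 - d$2 * e$1)"
  have t0: "d$1 * (e$2 * d'$3 - e$3 * d'$2) - d$2 * (e$1 * d'$3 - e$3 * d'$1) + d$3 * (e$1 * d'$2 - e$2 * d'$1) = 0"
    using assms(1) unfolding tri_def .
  have "N * e$1 = A * d$1 + B * d'$1" "N * e$2 = A * d$2 + B * d'$2" "N * e$3 = A * d$3 + B * d'$3"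
    unfolding N_def A_def B_def n1_def n2_def n3_def using t0 by algebra+
  then have "e = (A / N) *\<^sub>R d + (B / N) *\<^sub>R d'" using \<open>N \<noteq> 0\<close>
    by (auto simp: vec_eq_iff forall_3 field_simps)
  then show ?thesis by blast
qed

text \<open>Meeting in the projective sense is coplanarity, so the finite and the parallel case are
  captured by one determinant.\<close>

lemma meets_iff:
  assumes "d \<noteq> 0" "d' \<noteq> 0"
  shows "meets (ray a d) (ray a' d') \<longleftrightarrow> tri d (a - a') d' = 0"
proof
  assume "meets (ray a d) (ray a' d')"
  then consider s t where "a + s *\<^sub>R d = a' + t *\<^sub>R d'" | "affine_parallel (ray a d) (ray a' d')"
    unfolding meets_def ray_def by blast
  then show "tri d (a - a') d' = 0"
  proof cases
    case 1
    then have eq: "a - a' = t *\<^sub>R d' - s *\<^sub>R d" by (simp add: algebra_simps)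
    show ?thesis unfolding eq tri_def by (simp add: algebra_simps)
  next
    case 2
    then obtain c where "d' = c *\<^sub>R d" using parallel_ray_dir by blast
    then show ?thesis by (simp add: tri_def algebra_simps)
  qed
next
  assume t: "tri d (a - a') d' = 0"
  show "meets (ray a d) (ray a' d')"
  proof (cases "\<exists>c. d' = c *\<^sub>R d")
    case True
    then obtain c where "d' = c *\<^sub>R d" "c \<noteq> 0" using assms by auto
    then show ?thesis using ray_parallel unfolding meets_def by blast
  next
    case False
    then obtain \<alpha> \<beta> where "a - a' = \<alpha> *\<^sub>R d + \<beta> *\<^sub>R d'" using tri_decomp[OF t assms(1)] by blast
    then have "a + (- \<alpha>) *\<^sub>R d = a' + \<beta> *\<^sub>R d'" by (simp add: algebra_simps)
    moreover have "a + (- \<alpha>) *\<^sub>R d \<in> ray a d" "a' + \<beta> *\<^sub>R d' \<in> ray a' d'" unfolding ray_def by blast+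
    ultimately have "a + (- \<alpha>) *\<^sub>R d \<in> ray a d \<inter> ray a' d'" by simp
    then show ?thesis unfolding meets_def by blast
  qed
qed

lemma skew_iff_not_meets: "skew l m \<longleftrightarrow> \<not> meets l m"
  unfolding skew_def meets_def by blast

lemma ray_through: "p \<in> ray a d \<Longrightarrow> ray a d = ray p d"
proof -
  assume "p \<in> ray a d"
  then obtain s where s: "p = a + s *\<^sub>R d" unfolding ray_def by blast
  have "a + t *\<^sub>R d \<in> ray p d" for t unfolding ray_def s by (intro image_eqI[of _ _ "t - s"]) (auto simp: algebra_simps)
  moreover have "p + t *\<^sub>R d \<in> ray a d" for t unfolding ray_def s by (intro image_eqI[of _ _ "t + s"]) (auto simp: algebra_simps)
  ultimately show ?thesis unfolding ray_def by blast
qed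

text \<open>A line through \<open>p\<close> is given by its direction \<open>e\<close>, and each of
  the three meeting conditions is linear in \<open>e\<close>.\<close>

lemma mem_regulus_iff:
  assumes "d1 \<noteq> 0" "d2 \<noteq> 0" "d3 \<noteq> 0"
  shows "p \<in> regulus_of (ray a1 d1) (ray a2 d2) (ray a3 d3) \<longleftrightarrow>
    (\<exists>e. e \<noteq> 0 \<and> tri e (p - a1) d1 = 0 \<and> tri e (p - a2) d2 = 0 \<and> tri e (p - a3) d3 = 0)"
proof
  assume "p \<in> regulus_of (ray a1 d1) (ray a2 d2) (ray a3 d3)"
  then obtain l where l: "p \<in> l" "is_line l" "meets l (ray a1 d1)" "meets l (ray a2 d2)" "meets l (ray a3 d3)"
    unfolding regulus_of_def by blast
  then obtain a e where e: "e \<noteq> 0" "l = ray a e" unfolding is_line_iff by blast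
  then have "l = ray p e" using ray_through l(1) by blast
  then show "\<exists>e. e \<noteq> 0 \<and> tri e (p - a1) d1 = 0 \<and> tri e (p - a2) d2 = 0 \<and> tri e (p - a3) d3 = 0"
    using l(3-5) e(1) meets_iff assms by blast
next
  assume "\<exists>e. e \<noteq> 0 \<and> tri e (p - a1) d1 = 0 \<and> tri e (p - a2) d2 = 0 \<and> tri e (p - a3) d3 = 0"
  then obtain e where e: "e \<noteq> 0" "tri e (p - a1) d1 = 0" "tri e (p - a2) d2 = 0" "tri e (p - a3) d3 = 0" by blast
  have "p + 0 *\<^sub>R e \<in> ray p e" unfolding ray_def by blast
  moreover have "is_line (ray p e)" using e(1) is_line_iff by blast
  moreover have "meets (ray p e) (ray a1 d1) \<and> meets (ray p e) (ray a2 d2) \<and> meets (ray p e) (ray a3 d3)"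
    using meets_iff e assms by blast
  ultimately show "p \<in> regulus_of (ray a1 d1) (ray a2 d2) (ray a3 d3)" unfolding regulus_of_def by auto
qed

section \<open>Lines as graphs over a height coordinate\<close>

text \<open>The quadruple $(a, b, c, d)$ stands for the line $x = a + b z$, $y = c + d z$.\<close>

type_synonym chart_line = "real \<times> real \<times> real \<times> real"

definition px :: "chart_line \<Rightarrow> real \<Rightarrow> real" where "px q z = (case q of (a, b, c, d) \<Rightarrow> a + b * z)"
definition py :: "chart_line \<Rightarrow> real \<Rightarrow> real" where "py q z = (case q of (a, b, c, d) \<Rightarrow> c + d * z)"
definition vx :: "chart_line \<Rightarrow> real" where "vx q = fst (snd q)"
definition vy :: "chart_line \<Rightarrow> real" where "vy q = snd (snd (snd q))"

lemma px_eq: "px q z = px q s + vx q * (z - s)" and py_eq: "py q z = py q s + vy q * (z - s)"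
  by (auto simp: px_def py_def vx_def vy_def algebra_simps split: prod.split)

text \<open>Zero iff the two lines meet or are parallel.\<close>

definition cskew :: "chart_line \<Rightarrow> chart_line \<Rightarrow> real" where
  "cskew q r = (px q 0 - px r 0) * (vy q - vy r) - (vx q - vx r) * (py q 0 - py r 0)"

lemma cskew_at: "cskew q r = (px q s - px r s) * (vy q - vy r) - (vx q - vx r) * (py q s - py r s)"
  unfolding px_eq[of q s 0] py_eq[of q s 0] px_eq[of r s 0] py_eq[of r s 0] cskew_def by (simp add: algebra_simps)

text \<open>Zero iff the three lines have collinear points at height \<^term>\<open>s\<close>.\<close>

definition ccol :: "chart_line \<Rightarrow> chart_line \<Rightarrow> chart_line \<Rightarrow> real \<Rightarrow> real" where
  "ccol q1 q2 q3 s = (px q2 s - px q1 s) * (py q3 s - py q1 s) - (px q3 s - px q1 s) * (py q2 s - py q1 s)"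

text \<open>The determinant of the three linear conditions on the direction of a line through $(x, y, z)$ that make it
  meet the three given lines.\<close>

definition creg :: "chart_line \<Rightarrow> chart_line \<Rightarrow> chart_line \<Rightarrow> real \<Rightarrow> real \<Rightarrow> real \<Rightarrow> real" where
  "creg q1 q2 q3 x y z =
     ((x - px q1 z) * vy q1 - (y - py q1 z) * vx q1) * ((x - px q2 z) * (y - py q3 z) - (x - px q3 z) * (y - py q2 z)) +
     ((x - px q2 z) * vy q2 - (y - py q2 z) * vx q2) * ((x - px q3 z) * (y - py q1 z) - (x - px q1 z) * (y - py q3 z)) +
     ((x - px q3 z) * vy q3 - (y - py q3 z) * vx q3) * ((x - px q1 z) * (y - py q2 z) - (x - px q2 z) * (y - py q1 z))"

lemma det3_zero_iff:
  fixes a1 a2 a3 b1 b2 b3 c1 c2 c3 :: real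
  shows "(\<exists>x y z. (x \<noteq> 0 \<or> y \<noteq> 0 \<or> z \<noteq> 0) \<and> a1 * x + a2 * y + a3 * z = 0 \<and> b1 * x + b2 * y + b3 * z = 0 \<and> c1 * x + c2 * y + c3 * z = 0)
    \<longleftrightarrow> a1 * (b2 * c3 - b3 * c2) - a2 * (b1 * c3 - b3 * c1) + a3 * (b1 * c2 - b2 * c1) = 0"
proof -
  define A :: "real^3^3" where "A = vector [vector [a1, a2, a3], vector [b1, b2, b3], vector [c1, c2, c3]]"
  have det: "det A = a1 * (b2 * c3 - b3 * c2) - a2 * (b1 * c3 - b3 * c1) + a3 * (b1 * c2 - b2 * c1)"
    by (simp add: det_3 A_def vector_3 algebra_simps)
  have Av: "A *v v = vector [a1 * v$1 + a2 * v$2 + a3 * v$3, b1 * v$1 + b2 * v$2 + b3 * v$3, c1 * v$1 + c2 * v$2 + c3 * v$3]" for v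
    by (simp add: vec_eq_iff forall_3 matrix_vector_mult_def sum_3 A_def vector_3)
  have "det A = 0 \<longleftrightarrow> (\<exists>v. v \<noteq> 0 \<and> A *v v = 0)"
    using invertible_det_nz[of A] matrix_left_invertible_ker[of A] invertible_left_inverse[of A] by metis
  also have "\<dots> \<longleftrightarrow> (\<exists>x y z. (x \<noteq> 0 \<or> y \<noteq> 0 \<or> z \<noteq> 0) \<and> a1 * x + a2 * y + a3 * z = 0 \<and> b1 * x + b2 * y + b3 * z = 0 \<and> c1 * x + c2 * y + c3 * z = 0)"
  proof
    assume "\<exists>v. v \<noteq> 0 \<and> A *v v = 0"
    then obtain v where "v \<noteq> 0" "A *v v = 0" by blast
    then show "\<exists>x y z. (x \<noteq> 0 \<or> y \<noteq> 0 \<or> z \<noteq> 0) \<and> a1 * x + a2 * y + a3 * z = 0 \<and> b1 * x + b2 * y + b3 * z = 0 \<and> c1 * x + c2 * y + c3 * z = 0"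
      unfolding Av by (intro exI[of _ "v$1"] exI[of _ "v$2"] exI[of _ "v$3"]) (auto simp: vec_eq_iff forall_3 vector_3)
  next
    assume "\<exists>x y z. (x \<noteq> 0 \<or> y \<noteq> 0 \<or> z \<noteq> 0) \<and> a1 * x + a2 * y + a3 * z = 0 \<and> b1 * x + b2 * y + b3 * z = 0 \<and> c1 * x + c2 * y + c3 * z = 0"
    then obtain x y z where "(x \<noteq> 0 \<or> y \<noteq> 0 \<or> z \<noteq> 0) \<and> a1 * x + a2 * y + a3 * z = 0 \<and> b1 * x + b2 * y + b3 * z = 0 \<and> c1 * x + c2 * y + c3 * z = 0" by blast
    then show "\<exists>v. v \<noteq> 0 \<and> A *v v = 0"
      unfolding Av by (intro exI[of _ "vector [x, y, z]"]) (auto simp: vec_eq_iff forall_3 vector_3)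
  qed
  finally show ?thesis unfolding det by simp
qed

text \<open>The coordinates are \<open>p$1\<close>, \<open>p$2\<close> and the height
  \<open>\<nu> \<bullet> p\<close>, which form a linear coordinate system when
  \<open>\<nu>$3 \<noteq> 0\<close>. A line with \<open>\<nu> \<bullet> d \<noteq> 0\<close> is a
  graph over the height.\<close>

definition chart :: "space \<Rightarrow> space \<Rightarrow> space \<Rightarrow> chart_line" where
  "chart \<nu> a d = (a$1 - d$1 / (\<nu> \<bullet> d) * (\<nu> \<bullet> a), d$1 / (\<nu> \<bullet> d), a$2 - d$2 / (\<nu> \<bullet> d) * (\<nu> \<bullet> a), d$2 / (\<nu> \<bullet> d))"

lemma px_chart: "px (chart \<nu> a d) z = a$1 + (z - \<nu> \<bullet> a) / (\<nu> \<bullet> d) * d$1"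
  and py_chart: "py (chart \<nu> a d) z = a$2 + (z - \<nu> \<bullet> a) / (\<nu> \<bullet> d) * d$2"
  and vx_chart: "vx (chart \<nu> a d) = d$1 / (\<nu> \<bullet> d)"
  and vy_chart: "vy (chart \<nu> a d) = d$2 / (\<nu> \<bullet> d)"
  by (simp_all add: px_def py_def vx_def vy_def chart_def field_simps diff_divide_distrib)

lemma inner_space: "(\<nu>::space) \<bullet> v = \<nu>$1 * v$1 + \<nu>$2 * v$2 + \<nu>$3 * v$3"
  by (simp add: inner_vec_def sum_3)

lemma ray_chart:
  assumes "\<nu> \<bullet> d \<noteq> 0"
  shows "\<nu> \<bullet> (a + ((z - \<nu> \<bullet> a) / (\<nu> \<bullet> d)) *\<^sub>R d) = z"
    "(a + ((z - \<nu> \<bullet> a) / (\<nu> \<bullet> d)) *\<^sub>R d)$1 = px (chart \<nu> a d) z"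
    "(a + ((z - \<nu> \<bullet> a) / (\<nu> \<bullet> d)) *\<^sub>R d)$2 = py (chart \<nu> a d) z"
  using assms by (simp_all add: px_chart py_chart inner_add_right)

lemma ray_eq_heights:
  assumes "\<nu> \<bullet> d \<noteq> 0"
  shows "ray a d = range (\<lambda>z. a + ((z - \<nu> \<bullet> a) / (\<nu> \<bullet> d)) *\<^sub>R d)"
proof -
  have "a + t *\<^sub>R d = a + ((\<nu> \<bullet> (a + t *\<^sub>R d) - \<nu> \<bullet> a) / (\<nu> \<bullet> d)) *\<^sub>R d" for t
    using assms by (simp add: inner_add_right)
  then show ?thesis unfolding ray_def by blast
qed

text \<open>The factor \<open>\<nu>$3\<close> is the determinant of the coordinate change, and
  \<open>\<nu> \<bullet> d\<close> normalises the direction to unit height. The right side displays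
  the row of the determinant \<open>creg\<close> that belongs to this line.\<close>

lemma tri_chart:
  fixes \<nu> a d p e :: space
  assumes "\<nu> \<bullet> d \<noteq> 0"
  defines "q \<equiv> chart \<nu> a d"
  defines "X \<equiv> p$1 - px q (\<nu> \<bullet> p)" and "Y \<equiv> p$2 - py q (\<nu> \<bullet> p)"
  shows "\<nu>$3 * tri e (p - a) d = (\<nu> \<bullet> d) * (Y * e$1 + (- X) * e$2 + (X * vy q - Y * vx q) * (\<nu> \<bullet> e))"
proof -
  define D where "D = \<nu> \<bullet> d"
  define t where "t = (\<nu> \<bullet> p - \<nu> \<bullet> a) / D"
  have D: "D \<noteq> 0" using assms by (simp add: D_def)
  have tD: "t * D = \<nu> \<bullet> p - \<nu> \<bullet> a" using D by (simp add: t_def)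
  have X: "X = p$1 - a$1 - t * d$1" and Y: "Y = p$2 - a$2 - t * d$2"
    by (simp_all add: X_def Y_def q_def px_chart py_chart t_def D_def)
  have v: "vx q * D = d$1" "vy q * D = d$2" using D by (simp_all add: q_def vx_chart vy_chart D_def)
  have "D * (Y * e$1 + (- X) * e$2 + (X * vy q - Y * vx q) * (\<nu> \<bullet> e)) = D * Y * e$1 - D * X * e$2 + (X * (vy q * D) - Y * (vx q * D)) * (\<nu> \<bullet> e)"
    by (simp add: algebra_simps)
  also have "\<dots> = D * Y * e$1 - D * X * e$2 + (X * d$2 - Y * d$1) * (\<nu> \<bullet> e)" unfolding v ..
  also have "\<dots> = \<nu>$3 * tri e (p - a) d"
    using tD unfolding X Y D_def inner_space tri_def vector_minus_component by algebra
  finally show ?thesis by (simp add: D_def)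
qed

lemma mem_regulus_chart:
  assumes nz: "\<nu>$3 \<noteq> 0" and d: "\<nu> \<bullet> d1 \<noteq> 0" "\<nu> \<bullet> d2 \<noteq> 0" "\<nu> \<bullet> d3 \<noteq> 0"
  shows "p \<in> regulus_of (ray a1 d1) (ray a2 d2) (ray a3 d3) \<longleftrightarrow>
    creg (chart \<nu> a1 d1) (chart \<nu> a2 d2) (chart \<nu> a3 d3) (p$1) (p$2) (\<nu> \<bullet> p) = 0"
proof -
  let ?z = "\<nu> \<bullet> p"
  define n1 where "n1 a d = p$2 - py (chart \<nu> a d) ?z" for a d
  define n2 where "n2 a d = - (p$1 - px (chart \<nu> a d) ?z)" for a d
  define n3 where "n3 a d = (p$1 - px (chart \<nu> a d) ?z) * vy (chart \<nu> a d) - (p$2 - py (chart \<nu> a d) ?z) * vx (chart \<nu> a d)" for a d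
  have d0: "d1 \<noteq> 0" "d2 \<noteq> 0" "d3 \<noteq> 0" using d by auto
  have tri0: "tri e (p - a) d = 0 \<longleftrightarrow> n1 a d * e$1 + n2 a d * e$2 + n3 a d * (\<nu> \<bullet> e) = 0" if "\<nu> \<bullet> d \<noteq> 0" for a d e
    using tri_chart[OF that, of e p a] nz that unfolding n1_def n2_def n3_def
    by (metis mult_eq_0_iff)
  have "p \<in> regulus_of (ray a1 d1) (ray a2 d2) (ray a3 d3) \<longleftrightarrow>
    (\<exists>e. e \<noteq> 0 \<and> n1 a1 d1 * e$1 + n2 a1 d1 * e$2 + n3 a1 d1 * (\<nu> \<bullet> e) = 0 \<and>
       n1 a2 d2 * e$1 + n2 a2 d2 * e$2 + n3 a2 d2 * (\<nu> \<bullet> e) = 0 \<and> n1 a3 d3 * e$1 + n2 a3 d3 * e$2 + n3 a3 d3 * (\<nu> \<bullet> e) = 0)"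
    unfolding mem_regulus_iff[OF d0] using tri0 d by simp
  also have "\<dots> \<longleftrightarrow> (\<exists>x y z. (x \<noteq> 0 \<or> y \<noteq> 0 \<or> z \<noteq> 0) \<and> n1 a1 d1 * x + n2 a1 d1 * y + n3 a1 d1 * z = 0 \<and>
       n1 a2 d2 * x + n2 a2 d2 * y + n3 a2 d2 * z = 0 \<and> n1 a3 d3 * x + n2 a3 d3 * y + n3 a3 d3 * z = 0)" (is "?l \<longleftrightarrow> ?r")
  proof
    assume ?l
    then obtain e where e: "e \<noteq> 0" "n1 a1 d1 * e$1 + n2 a1 d1 * e$2 + n3 a1 d1 * (\<nu> \<bullet> e) = 0"
       "n1 a2 d2 * e$1 + n2 a2 d2 * e$2 + n3 a2 d2 * (\<nu> \<bullet> e) = 0" "n1 a3 d3 * e$1 + n2 a3 d3 * e$2 + n3 a3 d3 * (\<nu> \<bullet> e) = 0" by blast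
    have "e$1 \<noteq> 0 \<or> e$2 \<noteq> 0 \<or> \<nu> \<bullet> e \<noteq> 0"
      using e(1) nz by (auto simp: vec_eq_iff forall_3 inner_space)
    then show ?r using e by blast
  next
    assume ?r
    then obtain x y z where e: "x \<noteq> 0 \<or> y \<noteq> 0 \<or> z \<noteq> 0" "n1 a1 d1 * x + n2 a1 d1 * y + n3 a1 d1 * z = 0"
       "n1 a2 d2 * x + n2 a2 d2 * y + n3 a2 d2 * z = 0" "n1 a3 d3 * x + n2 a3 d3 * y + n3 a3 d3 * z = 0" by blast
    define e :: space where "e = vector [x, y, (z - \<nu>$1 * x - \<nu>$2 * y) / \<nu>$3]"
    have ec: "e$1 = x" "e$2 = y" "\<nu> \<bullet> e = z" using nz by (simp_all add: e_def vector_3 inner_space)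
    then have "e \<noteq> 0" using e(1) by auto
    then show ?l using e(2-4) ec by (intro exI[of _ e]) simp
  qed
  also have "\<dots> \<longleftrightarrow> creg (chart \<nu> a1 d1) (chart \<nu> a2 d2) (chart \<nu> a3 d3) (p$1) (p$2) ?z = 0"
    unfolding det3_zero_iff unfolding n1_def n2_def n3_def creg_def by (simp add: algebra_simps)
  finally show ?thesis .
qed

lemma regulus_subset_chart:
  assumes nz: "\<nu>$3 \<noteq> 0" and d: "\<nu> \<bullet> d1 \<noteq> 0" "\<nu> \<bullet> d2 \<noteq> 0" "\<nu> \<bullet> d3 \<noteq> 0" "\<nu> \<bullet> d \<noteq> 0"
  shows "ray a d \<subseteq> regulus_of (ray a1 d1) (ray a2 d2) (ray a3 d3) \<longleftrightarrow>
    (\<forall>z. creg (chart \<nu> a1 d1) (chart \<nu> a2 d2) (chart \<nu> a3 d3) (px (chart \<nu> a d) z) (py (chart \<nu> a d) z) z = 0)"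
  unfolding ray_eq_heights[OF d(4)] image_subset_iff
  using mem_regulus_chart[OF assms(1-4)] ray_chart[OF d(4), of a] by simp

lemma skew_chart:
  assumes nz: "\<nu>$3 \<noteq> 0" and d: "\<nu> \<bullet> d \<noteq> 0" "\<nu> \<bullet> d' \<noteq> 0" and sk: "skew (ray a d) (ray a' d')"
  shows "cskew (chart \<nu> a d) (chart \<nu> a' d') \<noteq> 0"
proof -
  have d0: "d \<noteq> 0" "d' \<noteq> 0" using d by auto
  have t: "tri d (a - a') d' \<noteq> 0" using sk meets_iff[OF d0] by (simp add: skew_iff_not_meets)
  define s where "s = \<nu> \<bullet> a"
  let ?q = "chart \<nu> a d" and ?r = "chart \<nu> a' d'"
  have a: "px ?q s = a$1" "py ?q s = a$2" by (simp_all add: px_chart py_chart s_def)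
  have v: "d$1 = vx ?q * (\<nu> \<bullet> d)" "d$2 = vy ?q * (\<nu> \<bullet> d)" using d by (simp_all add: vx_chart vy_chart)
  have "\<nu>$3 * tri d (a - a') d' = (\<nu> \<bullet> d') * ((a$2 - py ?r s) * d$1 + (- (a$1 - px ?r s)) * d$2 + ((a$1 - px ?r s) * vy ?r - (a$2 - py ?r s) * vx ?r) * (\<nu> \<bullet> d))"
    unfolding s_def by (rule tri_chart[OF d(2)])
  also have "\<dots> = - (\<nu> \<bullet> d') * (\<nu> \<bullet> d) * cskew ?q ?r"
    unfolding cskew_at[of _ _ s] a v by (simp add: algebra_simps)
  finally show ?thesis using t nz by auto
qed

text \<open>For \<open>u = a1 - a2\<close> and \<open>v = a1 - a3\<close> the inner cross products
  are normals of the planes through \<open>a1\<close> and each of two lines, so \<open>evec\<close>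
  is the direction of the transversal through \<open>a1\<close> to both lines.\<close>

definition evec :: "space \<Rightarrow> space \<Rightarrow> space \<Rightarrow> space \<Rightarrow> space" where
  "evec u d v f = cross3 (cross3 u d) (cross3 v f)"

lemma tri_cross3: "tri u v w = cross3 u v \<bullet> w"
  by (simp add: tri_def cross3_simps)

text \<open>Otherwise the planes spanned by \<open>u\<close>, \<open>d\<close> and by
  \<open>v\<close>, \<open>f\<close> coincide, and \<open>d\<close>, \<open>v - u\<close>,
  \<open>f\<close> are dependent.\<close>

lemma evec_nonzero:
  assumes "cross3 u d \<noteq> 0" "cross3 v f \<noteq> 0" "tri d (v - u) f \<noteq> 0"
  shows "evec u d v f \<noteq> 0"
proof
  assume e: "evec u d v f = 0"
  have e1: "evec u d v f = (cross3 u d \<bullet> f) *\<^sub>R v - (cross3 u d \<bullet> v) *\<^sub>R f"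
    unfolding evec_def by (simp add: vec_eq_iff forall_3 cross3_def vector_3 inner_vec_def sum_3 algebra_simps)
  have e2: "evec u d v f = (cross3 v f \<bullet> u) *\<^sub>R d - (cross3 v f \<bullet> d) *\<^sub>R u"
    unfolding evec_def by (simp add: vec_eq_iff forall_3 cross3_def vector_3 inner_vec_def sum_3 algebra_simps)
  have "cross3 (evec u d v f) f = (cross3 u d \<bullet> f) *\<^sub>R cross3 v f" unfolding e1 by (simp add: cross3_simps)
  then have z1: "cross3 u d \<bullet> f = 0" using e assms(2) by simp
  have "cross3 u (evec u d v f) = (cross3 v f \<bullet> u) *\<^sub>R cross3 u d" unfolding e2 by (simp add: cross3_simps)
  then have "cross3 v f \<bullet> u = 0" using e assms(1) by simp
  then have "(cross3 v f \<bullet> d) *\<^sub>R u = 0" using e e2 by simp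
  moreover have "u \<noteq> 0" using assms(1) by auto
  ultimately have z2: "cross3 v f \<bullet> d = 0" by simp
  have "tri d (v - u) f = - (cross3 v f \<bullet> d) * (- 1) + cross3 u d \<bullet> f" unfolding tri_cross3 by (simp add: cross3_simps)
  then show False using z1 z2 assms(3) by simp
qed

text \<open>If the points at the height of \<open>a1\<close> were collinear, their line would be a
  transversal through \<open>a1\<close> of constant height, so \<open>evec\<close> would be
  orthogonal to \<open>\<nu>\<close>.\<close>

lemma ccol_chart:
  assumes nz: "\<nu>$3 \<noteq> 0" and d: "\<nu> \<bullet> d2 \<noteq> 0" "\<nu> \<bullet> d3 \<noteq> 0"
    and e: "\<nu> \<bullet> evec (a1 - a2) d2 (a1 - a3) d3 \<noteq> 0"
  shows "ccol (chart \<nu> a1 d1) (chart \<nu> a2 d2) (chart \<nu> a3 d3) (\<nu> \<bullet> a1) \<noteq> 0"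
proof
  assume c: "ccol (chart \<nu> a1 d1) (chart \<nu> a2 d2) (chart \<nu> a3 d3) (\<nu> \<bullet> a1) = 0"
  define s where "s = \<nu> \<bullet> a1"
  define u where "u = a1 - (a2 + ((s - \<nu> \<bullet> a2) / (\<nu> \<bullet> d2)) *\<^sub>R d2)"
  define v where "v = a1 - (a3 + ((s - \<nu> \<bullet> a3) / (\<nu> \<bullet> d3)) *\<^sub>R d3)"
  have uv: "\<nu> \<bullet> u = 0" "\<nu> \<bullet> v = 0" unfolding u_def v_def inner_diff_right ray_chart[OF d(1)] ray_chart[OF d(2)] by (simp_all add: s_def)
  have a1: "px (chart \<nu> a1 d1) s = a1$1" "py (chart \<nu> a1 d1) s = a1$2" by (simp_all add: px_chart py_chart s_def)
  have c2: "px (chart \<nu> a2 d2) s - px (chart \<nu> a1 d1) s = - u$1" "py (chart \<nu> a2 d2) s - py (chart \<nu> a1 d1) s = - u$2"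
    "px (chart \<nu> a3 d3) s - px (chart \<nu> a1 d1) s = - v$1" "py (chart \<nu> a3 d3) s - py (chart \<nu> a1 d1) s = - v$2"
    unfolding a1 u_def v_def ray_chart(2,3)[OF d(1), symmetric] ray_chart(2,3)[OF d(2), symmetric] by simp_all
  have cr: "u$1 * v$2 = v$1 * u$2" using c unfolding ccol_def s_def[symmetric] c2 by simp
  have e': "evec (a1 - a2) d2 (a1 - a3) d3 = evec u d2 v d3"
    unfolding evec_def u_def v_def by (simp add: cross3_simps)
  have "\<nu> \<bullet> evec u d2 v d3 = (cross3 u d2 \<bullet> d3) * (\<nu> \<bullet> v) - (cross3 u d2 \<bullet> v) * (\<nu> \<bullet> d3)"
    unfolding evec_def by (simp add: cross3_simps)
  also have "\<dots> = - (cross3 u d2 \<bullet> v) * (\<nu> \<bullet> d3)" using uv by simp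
  finally have n0: "cross3 u d2 \<bullet> v \<noteq> 0" using e e' by auto
  have "\<nu>$3 * (cross3 u d2 \<bullet> v) = 0"
  proof -
    have "cross3 u d2 \<bullet> v = u$1 * (d2$2 * v$3 - d2$3 * v$2) - u$2 * (d2$1 * v$3 - d2$3 * v$1) + u$3 * (d2$1 * v$2 - d2$2 * v$1)"
      unfolding tri_cross3[symmetric] tri_def ..
    moreover have "\<nu>$1 * u$1 + \<nu>$2 * u$2 + \<nu>$3 * u$3 = 0" "\<nu>$1 * v$1 + \<nu>$2 * v$2 + \<nu>$3 * v$3 = 0"
      using uv by (simp_all add: inner_space)
    ultimately show ?thesis using cr by algebra
  qed
  then show False using nz n0 by simp
qed

lemma polys_avoid_roots:
  fixes P :: "real poly set"
  assumes "finite P" "0 \<notin> P"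
  shows "\<exists>t. \<forall>p\<in>P. poly p t \<noteq> 0"
proof -
  have "finite {t. poly p t = 0}" if "p \<in> P" for p by (rule poly_roots_finite) (use assms(2) that in auto)
  then have "finite (\<Union>p\<in>P. {t. poly p t = 0})" using assms(1) by (intro finite_UN_I)
  then obtain t where "t \<notin> (\<Union>p\<in>P. {t. poly p t = 0})" using ex_new_if_finite infinite_UNIV_char_0 by blast
  then show ?thesis by blast
qed

text \<open>The vector is taken on the moment curve \<open>(1, t, t^2)\<close>, where each
  hyperplane becomes a nonzero polynomial in \<open>t\<close>.\<close>

lemma vectors_avoid_hyperplanes:
  fixes E :: "space set"
  assumes "finite E" "0 \<notin> E"
  shows "\<exists>\<nu>. \<forall>e\<in>E. \<nu> \<bullet> e \<noteq> 0"
proof -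
  define P where "P e = [:e$1, e$2, e$3:]" for e :: space
  have "P e \<noteq> 0" if "e \<in> E" for e
  proof
    assume "P e = 0"
    then have "e = 0" by (simp add: P_def vec_eq_iff forall_3)
    then show False using assms(2) that by simp
  qed
  then obtain t where t: "\<forall>p\<in>P ` E. poly p t \<noteq> 0" using polys_avoid_roots[of "P ` E"] assms(1) by (metis finite_imageI imageE)
  define \<nu> :: space where "\<nu> = vector [1, t, t^2]"
  have "\<nu> \<bullet> e = poly (P e) t" for e by (simp add: \<nu>_def P_def inner_space vector_3 power2_eq_square algebra_simps)
  then show ?thesis using t by (metis imageI)
qed

text \<open>All requirements ask \<open>\<nu>\<close> to avoid finitely many hyperplanes.
  \<open>M\<close> and \<open>Tr\<close> are kept general so that lines generating a regulus from
  outside the given family fit into the same chart.\<close>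

theorem chart_exists:
  assumes M: "finite M" "\<And>l. l \<in> M \<Longrightarrow> is_line l"
    and Tr: "finite Tr" "\<And>a b c. (a, b, c) \<in> Tr \<Longrightarrow> a \<in> M \<and> b \<in> M \<and> c \<in> M \<and> skew a b \<and> skew a c \<and> skew b c"
  shows "\<exists>q. (\<forall>l\<in>M. \<forall>m\<in>M. skew l m \<longrightarrow> cskew (q l) (q m) \<noteq> 0) \<and>
    (\<forall>a\<in>M. \<forall>b\<in>M. \<forall>c\<in>M. \<forall>l\<in>M.
       l \<subseteq> regulus_of a b c \<longleftrightarrow> (\<forall>z. creg (q a) (q b) (q c) (px (q l) z) (py (q l) z) z = 0)) \<and>
    (\<forall>(a, b, c)\<in>Tr. \<exists>s. ccol (q a) (q b) (q c) s \<noteq> 0)"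
proof -
  have "\<exists>a d. \<forall>l\<in>M. d l \<noteq> 0 \<and> l = ray (a l) (d l)"
    using M(2) unfolding is_line_iff by metis
  then obtain pt dir where pd: "\<And>l. l \<in> M \<Longrightarrow> dir l \<noteq> 0" "\<And>l. l \<in> M \<Longrightarrow> l = ray (pt l) (dir l)" by blast
  define ev where "ev = (\<lambda>(a, b, c). evec (pt a - pt b) (dir b) (pt a - pt c) (dir c))"
  have ev0: "ev (a, b, c) \<noteq> 0" if "(a, b, c) \<in> Tr" for a b c
  proof -
    have abc: "a \<in> M" "b \<in> M" "c \<in> M" "skew a b" "skew a c" "skew b c" using Tr(2)[OF that] by auto
    have tri_nz: "tri (dir l) (pt l - pt m) (dir m) \<noteq> 0" if "l \<in> M" "m \<in> M" "skew l m" for l m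
      using that meets_iff[of "dir l" "dir m" "pt l" "pt m"] pd by (metis skew_iff_not_meets)
    have nz: "cross3 (pt a - pt m) (dir m) \<noteq> 0" if "m \<in> M" "skew a m" for m
    proof
      assume "cross3 (pt a - pt m) (dir m) = 0"
      moreover have "tri (dir a) (pt a - pt m) (dir m) = dir a \<bullet> cross3 (pt a - pt m) (dir m)"
        unfolding tri_cross3 by (simp add: cross3_simps)
      ultimately show False using tri_nz[OF abc(1) that] by simp
    qed
    have "(pt a - pt c) - (pt a - pt b) = pt b - pt c" by simp
    then show ?thesis unfolding ev_def prod.case
      using evec_nonzero[OF nz[OF abc(2,4)] nz[OF abc(3,5)]] tri_nz[OF abc(2,3,6)] by simp
  qed
  \<comment> \<open>The vector \<open>axis 3 1\<close> encodes the requirement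
    \<open>\<nu>$3 \<noteq> 0\<close>.\<close>
  have fE: "finite (dir ` M \<union> ev ` Tr \<union> {axis 3 1})" using M(1) Tr(1) by simp
  have zE: "0 \<notin> dir ` M \<union> ev ` Tr \<union> {axis 3 1}" using pd(1) ev0 by (force simp: axis_eq_0_iff)
  from vectors_avoid_hyperplanes[OF fE zE]
  obtain \<nu> where nu: "\<forall>e \<in> dir ` M \<union> ev ` Tr \<union> {axis 3 1}. \<nu> \<bullet> e \<noteq> 0" ..
  have n3: "\<nu>$3 \<noteq> 0" using nu by (simp add: inner_axis)
  have nd: "\<nu> \<bullet> dir l \<noteq> 0" if "l \<in> M" for l using nu that by blast
  define q where "q l = chart \<nu> (pt l) (dir l)" for l
  have "cskew (q l) (q m) \<noteq> 0" if "l \<in> M" "m \<in> M" "skew l m" for l m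
    unfolding q_def using skew_chart[OF n3 nd[OF that(1)] nd[OF that(2)]] pd(2) that by metis
  moreover have "l \<subseteq> regulus_of a b c \<longleftrightarrow> (\<forall>z. creg (q a) (q b) (q c) (px (q l) z) (py (q l) z) z = 0)"
    if "a \<in> M" "b \<in> M" "c \<in> M" "l \<in> M" for a b c l
    unfolding q_def using regulus_subset_chart[OF n3 nd[OF that(1)] nd[OF that(2)] nd[OF that(3)] nd[OF that(4)]] pd(2) that by metis
  moreover have "\<exists>s. ccol (q a) (q b) (q c) s \<noteq> 0" if "(a, b, c) \<in> Tr" for a b c
  proof -
    have abc: "a \<in> M" "b \<in> M" "c \<in> M" using Tr(2)[OF that] by auto
    have "\<nu> \<bullet> ev (a, b, c) \<noteq> 0" using nu that by blast
    then show ?thesis unfolding q_def ev_def prod.case using ccol_chart[OF n3 nd[OF abc(2)] nd[OF abc(3)]] by blast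
  qed
  ultimately show ?thesis by (intro exI[of _ q]) auto
qed

section \<open>Quadrics through skew lines\<close>

definition quadric :: "(real \<Rightarrow> real \<Rightarrow> real \<Rightarrow> real) \<Rightarrow> bool" where
  "quadric Q \<longleftrightarrow> (\<exists>c0 c1 c2 c3 c4 c5 c6 c7 c8 c9. \<forall>x y z.
     Q x y z = c0 + c1*x + c2*y + c3*z + c4*x^2 + c5*x*y + c6*y^2 + c7*x*z + c8*y*z + c9*z^2)"

definition vanishes :: "(real \<Rightarrow> real \<Rightarrow> real \<Rightarrow> real) \<Rightarrow> chart_line \<Rightarrow> bool" where
  "vanishes Q q \<longleftrightarrow> (\<forall>z. Q (px q z) (py q z) z = 0)"

lemma quadric_add: "quadric P \<Longrightarrow> quadric Q \<Longrightarrow> quadric (\<lambda>x y z. P x y z + Q x y z)"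
  unfolding quadric_def
proof (elim exE)
  fix a0 a1 a2 a3 a4 a5 a6 a7 a8 a9 b0 b1 b2 b3 b4 b5 b6 b7 b8 b9 :: real
  assume a: "\<forall>x y z. P x y z = a0 + a1*x + a2*y + a3*z + a4*x^2 + a5*x*y + a6*y^2 + a7*x*z + a8*y*z + a9*z^2"
     and b: "\<forall>x y z. Q x y z = b0 + b1*x + b2*y + b3*z + b4*x^2 + b5*x*y + b6*y^2 + b7*x*z + b8*y*z + b9*z^2"
  show "\<exists>c0 c1 c2 c3 c4 c5 c6 c7 c8 c9. \<forall>x y z. P x y z + Q x y z =
     c0 + c1*x + c2*y + c3*z + c4*x^2 + c5*x*y + c6*y^2 + c7*x*z + c8*y*z + c9*z^2"
    by (rule exI[of _ "a0 + b0"], rule exI[of _ "a1 + b1"], rule exI[of _ "a2 + b2"], rule exI[of _ "a3 + b3"],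
        rule exI[of _ "a4 + b4"], rule exI[of _ "a5 + b5"], rule exI[of _ "a6 + b6"], rule exI[of _ "a7 + b7"],
        rule exI[of _ "a8 + b8"], rule exI[of _ "a9 + b9"]) (simp add: a b algebra_simps)
qed

lemma quadric_mult_affine:
  "quadric (\<lambda>x y z. (a0 + a1*x + a2*y + a3*z) * (b0 + b1*x + b2*y + b3*z))"
  unfolding quadric_def
  by (rule exI[of _ "a0*b0"], rule exI[of _ "a0*b1 + a1*b0"], rule exI[of _ "a0*b2 + a2*b0"], rule exI[of _ "a0*b3 + a3*b0"],
      rule exI[of _ "a1*b1"], rule exI[of _ "a1*b2 + a2*b1"], rule exI[of _ "a2*b2"], rule exI[of _ "a1*b3 + a3*b1"],
      rule exI[of _ "a2*b3 + a3*b2"], rule exI[of _ "a3*b3"]) (simp add: power2_eq_square algebra_simps)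

lemma quadric_scale: "quadric Q \<Longrightarrow> quadric (\<lambda>x y z. k * Q x y z)"
  unfolding quadric_def
proof (elim exE)
  fix b0 b1 b2 b3 b4 b5 b6 b7 b8 b9 :: real
  assume b: "\<forall>x y z. Q x y z = b0 + b1*x + b2*y + b3*z + b4*x^2 + b5*x*y + b6*y^2 + b7*x*z + b8*y*z + b9*z^2"
  show "\<exists>c0 c1 c2 c3 c4 c5 c6 c7 c8 c9. \<forall>x y z. k * Q x y z =
     c0 + c1*x + c2*y + c3*z + c4*x^2 + c5*x*y + c6*y^2 + c7*x*z + c8*y*z + c9*z^2"
    by (rule exI[of _ "k*b0"], rule exI[of _ "k*b1"], rule exI[of _ "k*b2"], rule exI[of _ "k*b3"],
        rule exI[of _ "k*b4"], rule exI[of _ "k*b5"], rule exI[of _ "k*b6"], rule exI[of _ "k*b7"],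
        rule exI[of _ "k*b8"], rule exI[of _ "k*b9"]) (simp add: b algebra_simps)
qed

lemma quadric_affine_subst:
  assumes "quadric Q"
  shows "quadric (\<lambda>x y z. Q (a0 + a1*x + a2*y + a3*z) (b0 + b1*x + b2*y + b3*z) (d0 + d1*x + d2*y + d3*z))"
proof -
  obtain c0 c1 c2 c3 c4 c5 c6 c7 c8 c9 where c: "\<And>x y z.
     Q x y z = c0 + c1*x + c2*y + c3*z + c4*x^2 + c5*x*y + c6*y^2 + c7*x*z + c8*y*z + c9*z^2"
    using assms unfolding quadric_def by blast
  define A B D where "A x y z = a0 + a1*x + a2*y + a3*z" and "B x y z = b0 + b1*x + b2*y + b3*z"
    and "D x y z = d0 + d1*x + d2*y + d3*z" for x y z
  have one: "(\<lambda>x y z. 1 + 0*x + 0*y + 0*z) = (\<lambda>x y z. 1::real)" by simp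
  have q: "quadric (\<lambda>x y z. A x y z * A x y z)" "quadric (\<lambda>x y z. A x y z * B x y z)" "quadric (\<lambda>x y z. B x y z * B x y z)"
     "quadric (\<lambda>x y z. A x y z * D x y z)" "quadric (\<lambda>x y z. B x y z * D x y z)" "quadric (\<lambda>x y z. D x y z * D x y z)"
    unfolding A_def B_def D_def by (rule quadric_mult_affine)+
  have l: "quadric (\<lambda>x y z. (k0 + k1*x + k2*y + k3*z) * 1)" for k0 k1 k2 k3
    using quadric_mult_affine[of k0 k1 k2 k3 1 0 0 0] by simp
  have "quadric (\<lambda>x y z. (c0 + 0*x + 0*y + 0*z) * 1 + (c1 * (A x y z * 1) + (c2 * (B x y z * 1) + (c3 * (D x y z * 1) +
     (c4 * (A x y z * A x y z) + (c5 * (A x y z * B x y z) + (c6 * (B x y z * B x y z) + (c7 * (A x y z * D x y z) +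
     (c8 * (B x y z * D x y z) + c9 * (D x y z * D x y z))))))))))"
    by (intro quadric_add quadric_scale q l) (unfold A_def B_def D_def, (intro quadric_add quadric_scale q l)+)
  then show ?thesis unfolding c A_def[symmetric] B_def[symmetric] D_def[symmetric]
    by (simp add: power2_eq_square algebra_simps)
qed

text \<open>On its first two lines the regulus is cut out by the affine forms $x - x_i(z)$ and $y - y_i(z)$, so its
  equation is a bilinear form in them; in particular the cubic terms of \<^const>\<open>creg\<close> cancel.\<close>

lemma creg_bilinear:
  fixes q1 q2 q3
  defines "cx q \<equiv> px q3 0 - px q 0" and "cy q \<equiv> py q3 0 - py q 0" and "wx q \<equiv> vx q3 - vx q" and "wy q \<equiv> vy q3 - vy q"
  shows "creg q1 q2 q3 x y z =
     (wy q1 * cy q2 - cy q1 * wy q2) * ((x - px q1 z) * (x - px q2 z)) + (cy q1 * wx q2 - wy q1 * cx q2) * ((x - px q1 z) * (y - py q2 z)) +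
     ((cx q1 * wy q2 - wx q1 * cy q2) * ((y - py q1 z) * (x - px q2 z)) + (wx q1 * cx q2 - cx q1 * wx q2) * ((y - py q1 z) * (y - py q2 z)))"
proof -
  define X1 Y1 X2 Y2 X3 Y3 where "X1 = x - px q1 z" and "Y1 = y - py q1 z" and "X2 = x - px q2 z" and "Y2 = y - py q2 z"
    and "X3 = x - px q3 z" and "Y3 = y - py q3 z"
  have cx: "cx q = px q3 z - px q z - wx q * z" and cy: "cy q = py q3 z - py q z - wy q * z" for q
    unfolding cx_def cy_def wx_def wy_def px_eq[of q3 z 0] px_eq[of q z 0] py_eq[of q3 z 0] py_eq[of q z 0]
    by (simp_all add: algebra_simps)
  have c: "cx q1 = X1 - X3 - wx q1 * z" "cy q1 = Y1 - Y3 - wy q1 * z" "cx q2 = X2 - X3 - wx q2 * z" "cy q2 = Y2 - Y3 - wy q2 * z"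
    unfolding cx cy by (simp_all add: X1_def Y1_def X2_def Y2_def X3_def Y3_def)
  show ?thesis
    unfolding c creg_def X1_def[symmetric] Y1_def[symmetric] X2_def[symmetric] Y2_def[symmetric] X3_def[symmetric] Y3_def[symmetric]
      wx_def wy_def by algebra
qed

lemma quadric_creg: "quadric (creg q1 q2 q3)"
proof -
  have p: "quadric (\<lambda>x y z. (x - px q z) * (x - px q' z))" "quadric (\<lambda>x y z. (x - px q z) * (y - py q' z))"
    "quadric (\<lambda>x y z. (y - py q z) * (x - px q' z))" "quadric (\<lambda>x y z. (y - py q z) * (y - py q' z))" for q q'
  proof -
    have x: "- px q 0 + 1 * x + 0 * y + - vx q * z = x - px q z" and y: "- py q 0 + 0 * x + 1 * y + - vy q * z = y - py q z" for q x y z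
      using px_eq[of q z 0] py_eq[of q z 0] by simp_all
    show "quadric (\<lambda>x y z. (x - px q z) * (x - px q' z))"
      using quadric_mult_affine[of "- px q 0" 1 0 "- vx q" "- px q' 0" 1 0 "- vx q'"] by (simp only: x y)
    show "quadric (\<lambda>x y z. (x - px q z) * (y - py q' z))"
      using quadric_mult_affine[of "- px q 0" 1 0 "- vx q" "- py q' 0" 0 1 "- vy q'"] by (simp only: x y)
    show "quadric (\<lambda>x y z. (y - py q z) * (x - px q' z))"
      using quadric_mult_affine[of "- py q 0" 0 1 "- vy q" "- px q' 0" 1 0 "- vx q'"] by (simp only: x y)
    show "quadric (\<lambda>x y z. (y - py q z) * (y - py q' z))"
      using quadric_mult_affine[of "- py q 0" 0 1 "- vy q" "- py q' 0" 0 1 "- vy q'"] by (simp only: x y)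
  qed
  have "quadric (\<lambda>x y z. creg q1 q2 q3 x y z)"
    unfolding creg_bilinear by (intro quadric_add quadric_scale p)
  then show ?thesis .
qed

lemma vanishes_creg: "vanishes (creg q1 q2 q3) q1" "vanishes (creg q1 q2 q3) q2" "vanishes (creg q1 q2 q3) q3"
  by (simp_all add: vanishes_def creg_def)

text \<open>Here the two generic conditions enter: for skew lines and non-collinear points the
  equation is not identically zero, and the midpoint of two generating points is off the slice. This
  later excludes conics that split into lines.\<close>

lemma creg_midpoint:
  "creg q1 q2 q3 ((px q1 s + px q2 s) / 2) ((py q1 s + py q2 s) / 2) s = - cskew q1 q2 * ccol q1 q2 q3 s / 4"
proof -
  define x1 y1 x2 y2 x3 y3 where "x1 = px q1 s" and "y1 = py q1 s" and "x2 = px q2 s" and "y2 = py q2 s" and "x3 = px q3 s" and "y3 = py q3 s"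
  define m n where "m = (x1 + x2) / 2" and "n = (y1 + y2) / 2"
  have *: "x2 = 2 * m - x1" "y2 = 2 * n - y1" by (simp_all add: m_def n_def field_simps)
  have "creg q1 q2 q3 m n s * 4 = - cskew q1 q2 * ccol q1 q2 q3 s"
    unfolding creg_def cskew_at[of _ _ s] ccol_def x1_def[symmetric] y1_def[symmetric] x2_def[symmetric] y2_def[symmetric] x3_def[symmetric] y3_def[symmetric] *
    by algebra
  then show ?thesis unfolding m_def n_def x1_def y1_def x2_def y2_def by simp
qed

lemma creg_perm: "creg q1 q2 q3 x y z = - creg q1 q3 q2 x y z" "creg q1 q2 q3 x y z = creg q2 q3 q1 x y z"
  unfolding creg_def by algebra+

lemma ccol_perm: "ccol q1 q2 q3 s = - ccol q1 q3 q2 s" "ccol q1 q2 q3 s = ccol q2 q3 q1 s"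
  unfolding ccol_def by algebra+

lemma creg_midpoints_nonzero:
  assumes "cskew q1 q2 \<noteq> 0" "cskew q1 q3 \<noteq> 0" "cskew q2 q3 \<noteq> 0" "ccol q1 q2 q3 s \<noteq> 0"
  shows "creg q1 q2 q3 ((px q1 s + px q2 s) / 2) ((py q1 s + py q2 s) / 2) s \<noteq> 0"
    "creg q1 q2 q3 ((px q1 s + px q3 s) / 2) ((py q1 s + py q3 s) / 2) s \<noteq> 0"
    "creg q1 q2 q3 ((px q2 s + px q3 s) / 2) ((py q2 s + py q3 s) / 2) s \<noteq> 0"
proof -
  show "creg q1 q2 q3 ((px q1 s + px q2 s) / 2) ((py q1 s + py q2 s) / 2) s \<noteq> 0"
    unfolding creg_midpoint using assms by simp
  show "creg q1 q2 q3 ((px q1 s + px q3 s) / 2) ((py q1 s + py q3 s) / 2) s \<noteq> 0"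
    unfolding creg_perm(1)[of q1 q2 q3] creg_midpoint using assms by (simp add: ccol_perm(1)[of q1 q3 q2])
  show "creg q1 q2 q3 ((px q2 s + px q3 s) / 2) ((py q2 s + py q3 s) / 2) s \<noteq> 0"
    unfolding creg_perm(2)[of q1 q2 q3] creg_midpoint using assms by (simp add: ccol_perm(2)[of q1 q2 q3])
qed

text \<open>Ten coefficients face nine conditions from three lines and a tenth from the midpoint. In
  these coordinates the first line is the height axis, the others pass through
  \<open>(1, 0, 0)\<close> and \<open>(0, 1, 0)\<close>, and \<open>nz\<close> is their pairwise
  skewness, which makes the system regular.\<close>

lemma quadric_zero_normalised:
  assumes "quadric Q"
    and l1: "\<And>t. Q 0 0 t = 0" and l2: "\<And>t. Q (1 + b2*t) (d2*t) t = 0" and l3: "\<And>t. Q (b3*t) (1 + d3*t) t = 0"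
    and mid: "Q (1/2) 0 0 = 0" and nz: "d2 \<noteq> 0" "b3 \<noteq> 0" "d2 - d3 + b2 - b3 \<noteq> 0"
  shows "Q x y z = 0"
proof -
  obtain c0 c1 c2 c3 c4 c5 c6 c7 c8 c9 where c: "\<And>x y z.
     Q x y z = c0 + c1*x + c2*y + c3*z + c4*x^2 + c5*x*y + c6*y^2 + c7*x*z + c8*y*z + c9*z^2"
    using assms(1) unfolding quadric_def by blast
  have 0: "c0 = 0" "c3 = 0" "c9 = 0" using l1[of 0] l1[of 1] l1[of "-1"] unfolding c by simp_all
  have "c1 + c4 = 0" using l2[of 0] 0 unfolding c by simp
  moreover have "c1 / 2 + c4 / 4 = 0" using mid 0 unfolding c by (simp add: power2_eq_square)
  ultimately have 1: "c1 = 0" "c4 = 0" by simp_all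
  have 2: "c6 = - c2" using l3[of 0] 0 1 unfolding c by simp
  have q: "c2*y + c5*x*y - c2*y^2 + c7*x*z + c8*y*z = Q x y z" for x y z unfolding c by (simp add: 0 1 2)
  \<comment> \<open>Along a line \<open>Q\<close> is a polynomial of degree at most 2 in
    \<open>t\<close>; the values at 1 and -1 complete the one at 0.\<close>
  have p2: "c2*d2 + c5*(1+b2)*d2 - c2*d2^2 + c7*(1+b2) + c8*d2 = 0"
    and m2: "- (c2*d2) - c5*(1-b2)*d2 - c2*d2^2 - c7*(1-b2) + c8*d2 = 0"
    using l2[of 1] l2[of "-1"] q[of d2 "1+b2" 1] q[of "-d2" "1-b2" "-1"] by (simp_all add: algebra_simps power2_eq_square)
  have p3: "c2*(1+d3) + c5*b3*(1+d3) - c2*(1+d3)^2 + c7*b3 + c8*(1+d3) = 0"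
    and m3: "c2*(1-d3) - c5*b3*(1-d3) - c2*(1-d3)^2 + c7*b3 - c8*(1-d3) = 0"
    using l3[of 1] l3[of "-1"] q[of "1+d3" "b3" 1] q[of "1-d3" "-b3" "-1"] by (simp_all add: algebra_simps power2_eq_square)
  have e1: "c2*d2 + c5*d2 + c7 = 0" using p2 m2 by (simp add: algebra_simps power2_eq_square)
  have e2: "- c2*d2^2 + c5*b2*d2 + c7*b2 + c8*d2 = 0" using p2 m2 by (simp add: algebra_simps power2_eq_square)
  have e3: "- c2*d3 + c5*b3 + c8 = 0" using p3 m3 by (simp add: algebra_simps power2_eq_square)
  have e4: "- c2*d3^2 + c5*b3*d3 + c7*b3 + c8*d3 = 0" using p3 m3 by (simp add: algebra_simps power2_eq_square)
  have "c7 * b3 = 0" using e3 e4 by algebra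
  then have c7: "c7 = 0" using nz by simp
  have "(c2 + c5) * d2 = 0" using e1 c7 by algebra
  then have c5: "c5 = - c2" using nz by simp
  have "c2 * d2 * (d2 - d3 + b2 - b3) = 0" using e2 e3 c5 c7 by algebra
  then have c2: "c2 = 0" using nz by simp
  then have "c8 = 0" using e3 c5 by simp
  then show ?thesis using c2 c5 c7 by (simp add: q[symmetric])
qed

text \<open>Reduction to the normal form: the origin is the point of \<open>q1\<close> at height
  \<open>s\<close>, the horizontal basis points to those of \<open>q2\<close> and \<open>q3\<close>,
  which is possible as they are not collinear, and the vertical axis follows
  \<open>q1\<close>.\<close>

lemma quadric_zero:
  assumes Q: "quadric Q" and v: "vanishes Q q1" "vanishes Q q2" "vanishes Q q3"
    and sk: "cskew q2 q1 \<noteq> 0" "cskew q3 q1 \<noteq> 0" "cskew q2 q3 \<noteq> 0" and col: "ccol q1 q2 q3 s \<noteq> 0"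
    and mid: "Q ((px q1 s + px q2 s) / 2) ((py q1 s + py q2 s) / 2) s = 0"
  shows "Q x y z = 0"
proof -
  define x1 y1 where "x1 = px q1 s" and "y1 = py q1 s"
  define wx wy ux uy where "wx = px q2 s - x1" and "wy = py q2 s - y1" and "ux = px q3 s - x1" and "uy = py q3 s - y1"
  define c where "c = wx * uy - ux * wy"
  have c0: "c \<noteq> 0" using col by (simp add: c_def ccol_def wx_def wy_def ux_def uy_def x1_def y1_def)
  define f2 g2 f3 g3 where "f2 = vx q2 - vx q1" and "g2 = vy q2 - vy q1" and "f3 = vx q3 - vx q1" and "g3 = vy q3 - vy q1"
  \<comment> \<open>The velocities of \<open>q2\<close> and \<open>q3\<close> relative to
    \<open>q1\<close> in the new basis, by Cramer's rule.\<close>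
  define b2 d2 b3 d3 where "b2 = (f2 * uy - g2 * ux) / c" and "d2 = (wx * g2 - wy * f2) / c"
    and "b3 = (f3 * uy - g3 * ux) / c" and "d3 = (wx * g3 - wy * f3) / c"
  have bd: "c * b2 = f2 * uy - g2 * ux" "c * d2 = wx * g2 - wy * f2" "c * b3 = f3 * uy - g3 * ux" "c * d3 = wx * g3 - wy * f3"
    using c0 by (simp_all add: b2_def d2_def b3_def d3_def)
  have "c * (b2 * wx + d2 * ux) = c * f2" "c * (b2 * wy + d2 * uy) = c * g2"
     "c * (b3 * wx + d3 * ux) = c * f3" "c * (b3 * wy + d3 * uy) = c * g3"
    using bd unfolding c_def by algebra+
  then have comb: "b2 * wx + d2 * ux = f2" "b2 * wy + d2 * uy = g2" "b3 * wx + d3 * ux = f3" "b3 * wy + d3 * uy = g3"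
    using c0 by simp_all
  define T where "T X Y Z = Q (x1 + wx * X + ux * Y + vx q1 * Z) (y1 + wy * X + uy * Y + vy q1 * Z) (s + 0 * X + 0 * Y + 1 * Z)" for X Y Z
  have zero: "T X Y Z = 0" for X Y Z
  proof (rule quadric_zero_normalised[of T b2 d2 b3 d3])
    show "quadric T" unfolding T_def by (rule quadric_affine_subst[OF Q])
    show "T 0 0 t = 0" for t
    proof -
      have "x1 + vx q1 * t = px q1 (s + t)" "y1 + vy q1 * t = py q1 (s + t)"
        unfolding px_eq[of q1 "s + t" s] py_eq[of q1 "s + t" s] by (simp_all add: x1_def y1_def)
      then show ?thesis using v(1) unfolding T_def vanishes_def by simp
    qed
    show "T (1 + b2 * t) (d2 * t) t = 0" for t
    proof -
      have "x1 + wx * (1 + b2 * t) + ux * (d2 * t) + vx q1 * t = px q2 (s + t)"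
        unfolding px_eq[of q2 "s + t" s] using comb(1) by (simp add: wx_def f2_def) algebra
      moreover have "y1 + wy * (1 + b2 * t) + uy * (d2 * t) + vy q1 * t = py q2 (s + t)"
        unfolding py_eq[of q2 "s + t" s] using comb(2) by (simp add: wy_def g2_def) algebra
      ultimately show ?thesis using v(2) unfolding T_def vanishes_def by simp
    qed
    show "T (b3 * t) (1 + d3 * t) t = 0" for t
    proof -
      have "x1 + wx * (b3 * t) + ux * (1 + d3 * t) + vx q1 * t = px q3 (s + t)"
        unfolding px_eq[of q3 "s + t" s] using comb(3) by (simp add: ux_def f3_def) algebra
      moreover have "y1 + wy * (b3 * t) + uy * (1 + d3 * t) + vy q1 * t = py q3 (s + t)"
        unfolding py_eq[of q3 "s + t" s] using comb(4) by (simp add: uy_def g3_def) algebra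
      ultimately show ?thesis using v(3) unfolding T_def vanishes_def by simp
    qed
    show "T (1/2) 0 0 = 0"
      using mid unfolding T_def wx_def wy_def x1_def y1_def by (simp add: field_simps)
    have "c * d2 = cskew q2 q1" "c * b3 = - cskew q3 q1" "c * (d2 - d3 + b2 - b3) = cskew q2 q3"
      unfolding cskew_at[of _ _ s] distrib_left right_diff_distrib bd
      unfolding wx_def wy_def ux_def uy_def f2_def g2_def f3_def g3_def x1_def y1_def by algebra+
    then show "d2 \<noteq> 0" "b3 \<noteq> 0" "d2 - d3 + b2 - b3 \<noteq> 0" using sk by auto
  qed
  define Z where "Z = z - s"
  define xx yy where "xx = x - x1 - vx q1 * Z" and "yy = y - y1 - vy q1 * Z"
  define X Y where "X = (xx * uy - yy * ux) / c" and "Y = (wx * yy - wy * xx) / c"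
  have XY: "c * X = xx * uy - yy * ux" "c * Y = wx * yy - wy * xx" using c0 by (simp_all add: X_def Y_def)
  have "c * (wx * X + ux * Y) = c * xx" "c * (wy * X + uy * Y) = c * yy" using XY unfolding c_def by algebra+
  then have "wx * X + ux * Y = xx" "wy * X + uy * Y = yy" using c0 by simp_all
  then have "x1 + wx * X + ux * Y + vx q1 * Z = x" "y1 + wy * X + uy * Y + vy q1 * Z = y"
    unfolding xx_def yy_def by linarith+
  then have "T X Y Z = Q x y z" unfolding T_def Z_def by simp
  then show ?thesis using zero by metis
qed

text \<open>The multiple of \<open>creg\<close> is chosen so that the difference vanishes at the
  midpoint, the tenth condition that \<open>quadric_zero\<close> needs.\<close>

lemma quadric_unique:
  assumes Q: "quadric Q" and v: "vanishes Q q1" "vanishes Q q2" "vanishes Q q3"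
    and sk: "cskew q1 q2 \<noteq> 0" "cskew q1 q3 \<noteq> 0" "cskew q2 q3 \<noteq> 0" and col: "ccol q1 q2 q3 s \<noteq> 0"
  shows "\<exists>\<kappa>. \<forall>x y z. Q x y z = \<kappa> * creg q1 q2 q3 x y z"
proof -
  define mx my where "mx = (px q1 s + px q2 s) / 2" and "my = (py q1 s + py q2 s) / 2"
  define \<kappa> where "\<kappa> = Q mx my s / creg q1 q2 q3 mx my s"
  have nz: "creg q1 q2 q3 mx my s \<noteq> 0" unfolding mx_def my_def by (rule creg_midpoints_nonzero(1)[OF sk col])
  have sym: "cskew q q' = cskew q' q" for q q' by (simp add: cskew_def algebra_simps)
  have "Q x y z + (- \<kappa>) * creg q1 q2 q3 x y z = 0" for x y z
  proof (rule quadric_zero[where Q = "\<lambda>x y z. Q x y z + (- \<kappa>) * creg q1 q2 q3 x y z"])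
    show "quadric (\<lambda>x y z. Q x y z + (- \<kappa>) * creg q1 q2 q3 x y z)"
      by (rule quadric_add[OF Q quadric_scale[OF quadric_creg]])
    show "vanishes (\<lambda>x y z. Q x y z + (- \<kappa>) * creg q1 q2 q3 x y z) q1" "vanishes (\<lambda>x y z. Q x y z + (- \<kappa>) * creg q1 q2 q3 x y z) q2"
      "vanishes (\<lambda>x y z. Q x y z + (- \<kappa>) * creg q1 q2 q3 x y z) q3"
      using v vanishes_creg[of q1 q2 q3] by (simp_all add: vanishes_def)
    show "cskew q2 q1 \<noteq> 0" "cskew q3 q1 \<noteq> 0" "cskew q2 q3 \<noteq> 0" using sk sym by auto
    show "ccol q1 q2 q3 s \<noteq> 0" by (rule col)
    show "Q ((px q1 s + px q2 s) / 2) ((py q1 s + py q2 s) / 2) s + (- \<kappa>) * creg q1 q2 q3 ((px q1 s + px q2 s) / 2) ((py q1 s + py q2 s) / 2) s = 0"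
      using nz unfolding mx_def[symmetric] my_def[symmetric] by (simp add: \<kappa>_def)
  qed
  then show ?thesis by (intro exI[of _ \<kappa>]) (simp add: algebra_simps)
qed

section \<open>Blocks of lines on a common regulus\<close>

text \<open>Closure rules for this predicate show that each genericity condition excludes only
  finitely many parameter values, without computing coefficients.\<close>

definition polyfun :: "(real \<Rightarrow> real) \<Rightarrow> bool" where
  "polyfun f \<longleftrightarrow> (\<exists>p. \<forall>s. f s = poly p s)"

lemma polyfun_const: "polyfun (\<lambda>s. c)" unfolding polyfun_def by (rule exI[of _ "[:c:]"]) simp
lemma polyfun_id: "polyfun (\<lambda>s. s)" unfolding polyfun_def by (rule exI[of _ "[:0, 1:]"]) simp
lemma polyfun_add: "polyfun f \<Longrightarrow> polyfun g \<Longrightarrow> polyfun (\<lambda>s. f s + g s)"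
  unfolding polyfun_def
proof (elim exE)
  fix p r assume "\<forall>s. f s = poly p s" "\<forall>s. g s = poly r s"
  then show "\<exists>p. \<forall>s. f s + g s = poly p s" by (intro exI[of _ "p + r"]) simp
qed
lemma polyfun_diff: "polyfun f \<Longrightarrow> polyfun g \<Longrightarrow> polyfun (\<lambda>s. f s - g s)"
  unfolding polyfun_def
proof (elim exE)
  fix p r assume "\<forall>s. f s = poly p s" "\<forall>s. g s = poly r s"
  then show "\<exists>p. \<forall>s. f s - g s = poly p s" by (intro exI[of _ "p - r"]) simp
qed
lemma polyfun_mult: "polyfun f \<Longrightarrow> polyfun g \<Longrightarrow> polyfun (\<lambda>s. f s * g s)"
  unfolding polyfun_def
proof (elim exE)
  fix p r assume "\<forall>s. f s = poly p s" "\<forall>s. g s = poly r s"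
  then show "\<exists>p. \<forall>s. f s * g s = poly p s" by (intro exI[of _ "p * r"]) simp
qed
lemma polyfun_px: "polyfun (px q)" and polyfun_py: "polyfun (py q)"
proof -
  have "px q s = px q 0 + vx q * s" "py q s = py q 0 + vy q * s" for s
    using px_eq[of q s 0] py_eq[of q s 0] by simp_all
  then have *: "px q = (\<lambda>s. px q 0 + vx q * s)" "py q = (\<lambda>s. py q 0 + vy q * s)" by blast+
  show "polyfun (px q)" by (subst *(1)) (intro polyfun_add polyfun_mult polyfun_const polyfun_id)
  show "polyfun (py q)" by (subst *(2)) (intro polyfun_add polyfun_mult polyfun_const polyfun_id)
qed

lemmas polyfun_intros = polyfun_const polyfun_id polyfun_add polyfun_diff polyfun_mult polyfun_px polyfun_py

lemma polyfuns_avoid_roots: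
  assumes "finite I" "\<And>i. i \<in> I \<Longrightarrow> polyfun (f i)" "\<And>i. i \<in> I \<Longrightarrow> \<exists>s. f i s \<noteq> 0"
  shows "\<exists>s. \<forall>i\<in>I. f i s \<noteq> 0"
proof -
  have "\<forall>i\<in>I. \<exists>p. \<forall>s. f i s = poly p s" using assms(2) unfolding polyfun_def by blast
  then obtain p where p: "\<And>i s. i \<in> I \<Longrightarrow> f i s = poly (p i) s" by metis
  have "p i \<noteq> 0" if "i \<in> I" for i using assms(3)[OF that] p[OF that] by auto
  then have "0 \<notin> p ` I" by auto
  then obtain t where "\<forall>r\<in>p ` I. poly r t \<noteq> 0" using polys_avoid_roots[of "p ` I"] assms(1) by auto
  then show ?thesis using p by auto
qed

text \<open>The shear $u = x + \mu y$ makes the slice of the quadric at height \<^term>\<open>s\<close> monic in the ordinate up to the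
  factor \<^term>\<open>A \<mu>\<close>.\<close>

lemma quadric_slice_conic:
  assumes "quadric Q"
  obtains A where "polyfun A"
    "(\<forall>\<mu>. A \<mu> = 0) \<Longrightarrow> (\<forall>x1 y1 x2 y2. Q x1 y1 s = 0 \<longrightarrow> Q x2 y2 s = 0 \<longrightarrow> Q ((x1 + x2)/2) ((y1 + y2)/2) s = 0)"
    "\<And>\<mu>. A \<mu> \<noteq> 0 \<Longrightarrow> \<exists>B C. degree B \<le> 1 \<and> degree C \<le> 2 \<and> (\<forall>u v. monic_conic B C u v = Q (u - \<mu> * v) v s / A \<mu>)"
proof -
  obtain c0 c1 c2 c3 c4 c5 c6 c7 c8 c9 where c: "\<And>x y z.
     Q x y z = c0 + c1*x + c2*y + c3*z + c4*x^2 + c5*x*y + c6*y^2 + c7*x*z + c8*y*z + c9*z^2"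
    using assms unfolding quadric_def by blast
  \<comment> \<open>The coefficient of \<open>v^2\<close> after the substitution
    \<open>x = u - \<mu> * v\<close>.\<close>
  define A where "A \<mu> = c4 * (\<mu> * \<mu>) - c5 * \<mu> + c6" for \<mu>
  have "polyfun A" unfolding A_def by (intro polyfun_intros)
  moreover have "\<forall>x1 y1 x2 y2. Q x1 y1 s = 0 \<longrightarrow> Q x2 y2 s = 0 \<longrightarrow> Q ((x1 + x2)/2) ((y1 + y2)/2) s = 0" if "\<forall>\<mu>. A \<mu> = 0"
  proof -
    \<comment> \<open>Without quadratic terms the slice equation is affine, so its zero set is
      closed under midpoints.\<close>
    have "c6 = 0" "c4 - c5 = 0" "c4 + c5 = 0"
      using that[rule_format, of 0] that[rule_format, of 1] that[rule_format, of "-1"] by (simp_all add: A_def)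
    then have z: "c6 = 0" "c4 = 0" "c5 = 0" by simp_all
    show ?thesis
    proof (intro allI impI)
      fix x1 y1 x2 y2 assume "Q x1 y1 s = 0" "Q x2 y2 s = 0"
      moreover have "Q ((x1 + x2)/2) ((y1 + y2)/2) s = (Q x1 y1 s + Q x2 y2 s) / 2"
        unfolding c z by (simp add: field_simps)
      ultimately show "Q ((x1 + x2)/2) ((y1 + y2)/2) s = 0" by simp
    qed
  qed
  moreover have "\<exists>B C. degree B \<le> 1 \<and> degree C \<le> 2 \<and> (\<forall>u v. monic_conic B C u v = Q (u - \<mu> * v) v s / A \<mu>)" if "A \<mu> \<noteq> 0" for \<mu>
  proof (intro exI conjI allI)
    show "degree [:(c2 - c1 * \<mu> - c7 * s * \<mu> + c8 * s) / (2 * A \<mu>), (c5 - 2 * c4 * \<mu>) / (2 * A \<mu>):] \<le> 1"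
      by (simp add: degree_pCons_le)
    show "degree [:(c0 + c3 * s + c9 * s^2) / A \<mu>, (c1 + c7 * s) / A \<mu>, c4 / A \<mu>:] \<le> 2"
      by (simp add: degree_pCons_le)
    show "monic_conic [:(c2 - c1 * \<mu> - c7 * s * \<mu> + c8 * s) / (2 * A \<mu>), (c5 - 2 * c4 * \<mu>) / (2 * A \<mu>):]
       [:(c0 + c3 * s + c9 * s^2) / A \<mu>, (c1 + c7 * s) / A \<mu>, c4 / A \<mu>:] u v = Q (u - \<mu> * v) v s / A \<mu>" (is "?l = _") for u v
    proof -
      have "?l * A \<mu> = v^2 * A \<mu> + (c2 - c1 * \<mu> - c7 * s * \<mu> + c8 * s + (c5 - 2 * c4 * \<mu>) * u) * v
         + (c0 + c3 * s + c9 * s^2 + (c1 + c7 * s) * u + c4 * u^2)"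
        unfolding monic_conic_def using that by (simp add: field_simps power2_eq_square)
      also have "\<dots> = Q (u - \<mu> * v) v s" unfolding c A_def by algebra
      finally show ?thesis using that by (simp add: field_simps)
    qed
  qed
  ultimately show ?thesis by (rule that)
qed

section \<open>Reguli spanned by triples of the given lines\<close>

locale skew_lines =
  fixes L :: "'l set" and q :: "'l \<Rightarrow> chart_line"
  assumes finL: "finite L"
    and skew: "l \<in> L \<Longrightarrow> m \<in> L \<Longrightarrow> l \<noteq> m \<Longrightarrow> cskew (q l) (q m) \<noteq> 0"
    and col: "a \<in> L \<Longrightarrow> b \<in> L \<Longrightarrow> c \<in> L \<Longrightarrow> a \<noteq> b \<Longrightarrow> a \<noteq> c \<Longrightarrow> b \<noteq> c \<Longrightarrow> \<exists>s. ccol (q a) (q b) (q c) s \<noteq> 0"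
begin

definition triples :: "('l \<times> 'l \<times> 'l) set" where
  "triples = {(a, b, c). a \<in> L \<and> b \<in> L \<and> c \<in> L \<and> a \<noteq> b \<and> a \<noteq> c \<and> b \<noteq> c}"

definition reg :: "'l \<times> 'l \<times> 'l \<Rightarrow> real \<Rightarrow> real \<Rightarrow> real \<Rightarrow> real" where
  "reg = (\<lambda>(a, b, c). creg (q a) (q b) (q c))"

definition block :: "'l \<times> 'l \<times> 'l \<Rightarrow> 'l set" where
  "block t = {l \<in> L. vanishes (reg t) (q l)}"

lemma finite_triples: "finite triples"
  by (rule finite_subset[of _ "L \<times> L \<times> L"]) (use finL in \<open>auto simp: triples_def\<close>)

lemma block_subset: "block t \<subseteq> L"
  by (auto simp: block_def)

lemma mem_block: "(a, b, c) \<in> triples \<Longrightarrow> a \<in> block (a, b, c) \<and> b \<in> block (a, b, c) \<and> c \<in> block (a, b, c)"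
  by (auto simp: block_def reg_def triples_def vanishes_creg)

lemma reg_nonzero:
  assumes "t \<in> triples"
  shows "\<exists>x y z. reg t x y z \<noteq> 0"
proof -
  obtain a b c where t: "t = (a, b, c)" "a \<in> L" "b \<in> L" "c \<in> L" "a \<noteq> b" "a \<noteq> c" "b \<noteq> c"
    using assms by (auto simp: triples_def)
  obtain s where "ccol (q a) (q b) (q c) s \<noteq> 0" using col[OF t(2-7)] by blast
  then show ?thesis unfolding t(1) reg_def prod.case
    using creg_midpoints_nonzero(1)[OF skew[OF t(2,3,5)] skew[OF t(2,4,6)] skew[OF t(3,4,7)]] by blast
qed

lemma quadric_multiple:
  assumes Q: "quadric Q" and t: "(a, b, c) \<in> triples" and v: "vanishes Q (q a)" "vanishes Q (q b)" "vanishes Q (q c)"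
  shows "\<exists>\<kappa>. \<forall>x y z. Q x y z = \<kappa> * reg (a, b, c) x y z"
proof -
  have abc: "a \<in> L" "b \<in> L" "c \<in> L" "a \<noteq> b" "a \<noteq> c" "b \<noteq> c" using t by (auto simp: triples_def)
  obtain s where s: "ccol (q a) (q b) (q c) s \<noteq> 0" using col[OF abc] by blast
  show ?thesis unfolding reg_def prod.case
    using quadric_unique[OF Q v skew[OF abc(1,2,4)] skew[OF abc(1,3,5)] skew[OF abc(2,3,6)] s] .
qed

lemma vanishes_multiple:
  assumes "\<forall>x y z. Q x y z = \<kappa> * P x y z" "\<exists>x y z. Q x y z \<noteq> 0"
  shows "vanishes Q r \<longleftrightarrow> vanishes P r"
proof -
  have "\<kappa> \<noteq> 0" using assms by auto
  then show ?thesis unfolding vanishes_def using assms(1) by simp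
qed

text \<open>The equation of \<open>t\<close> is a quadric through \<open>a\<close>,
  \<open>b\<close>, \<open>c\<close>, hence a multiple of their own equation, and a nonzero one by
  \<open>reg_nonzero\<close>.\<close>

lemma block_eq:
  assumes t: "t \<in> triples" and t': "(a, b, c) \<in> triples" and abc: "a \<in> block t" "b \<in> block t" "c \<in> block t"
  shows "block (a, b, c) = block t"
proof -
  have "quadric (reg t)" unfolding reg_def by (cases t) (simp add: quadric_creg)
  then obtain \<kappa> where k: "\<forall>x y z. reg t x y z = \<kappa> * reg (a, b, c) x y z"
    using quadric_multiple[OF _ t'] abc unfolding block_def by blast
  show ?thesis unfolding block_def using vanishes_multiple[OF k reg_nonzero[OF t]] by simp
qed

definition blocks :: "'l set set" where "blocks = block ` triples"

lemma finite_blocks: "finite blocks" unfolding blocks_def using finite_triples by simp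

lemma card_blocks: "card blocks \<le> card L ^ 3"
proof -
  have "card blocks \<le> card triples" unfolding blocks_def by (rule card_image_le[OF finite_triples])
  also have "\<dots> \<le> card (L \<times> L \<times> L)" by (rule card_mono) (use finL in \<open>auto simp: triples_def\<close>)
  finally show ?thesis by (simp add: card_cartesian_product power3_eq_cube)
qed

lemma blocks_inter:
  assumes "\<beta> \<in> blocks" "\<beta>' \<in> blocks" "\<beta> \<noteq> \<beta>'"
  shows "card (\<beta> \<inter> \<beta>') \<le> 2"
proof (rule ccontr)
  assume "\<not> card (\<beta> \<inter> \<beta>') \<le> 2"
  then have "3 \<le> card (\<beta> \<inter> \<beta>')" by simp
  then obtain T where "T \<subseteq> \<beta> \<inter> \<beta>'" "card T = 3" by (rule obtain_subset_with_card_n)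
  then obtain a b c where T: "a \<in> \<beta> \<inter> \<beta>'" "b \<in> \<beta> \<inter> \<beta>'" "c \<in> \<beta> \<inter> \<beta>'" "a \<noteq> b" "a \<noteq> c" "b \<noteq> c"
    by (auto simp: card_3_iff)
  obtain t t' where t: "t \<in> triples" "\<beta> = block t" "t' \<in> triples" "\<beta>' = block t'"
    using assms(1,2) unfolding blocks_def by blast
  have "a \<in> L" "b \<in> L" "c \<in> L" using T(1-3) block_subset[of t] unfolding t(2) by blast+
  then have abc: "(a, b, c) \<in> triples" using T(4-6) by (simp add: triples_def)
  have "block (a, b, c) = block t" by (rule block_eq[OF t(1) abc]) (use T(1-3) in \<open>simp_all add: t(2)\<close>)
  moreover have "block (a, b, c) = block t'" by (rule block_eq[OF t(3) abc]) (use T(1-3) in \<open>simp_all add: t(4)\<close>)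
  ultimately show False using assms(3) t by simp
qed

text \<open>A slice at a generic height turns lines into points and blocks into conics with exactly
  the incidences of the blocks; a generic shear brings these conics into the monic form.\<close>

theorem card_rich_blocks:
  assumes k: "104482 \<le> k"
  shows "card {\<beta> \<in> blocks. k \<le> card \<beta>} \<le> 22674816 * 26120^2 * real (card L) ^ 3 / real k ^ 5 + 6 * real (card L) / k"
proof -
  \<comment> \<open>A height without accidents: a line outside a block misses its conic, and the
    three points of a triple are not collinear.\<close>
  obtain s where s: "\<And>a b c. (a, b, c) \<in> triples \<Longrightarrow> ccol (q a) (q b) (q c) s \<noteq> 0"
    "\<And>t l. t \<in> triples \<Longrightarrow> l \<in> L \<Longrightarrow> l \<notin> block t \<Longrightarrow> reg t (px (q l) s) (py (q l) s) s \<noteq> 0"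
  proof -
    define I where "I = (\<lambda>t. Inl t) ` triples \<union> (\<lambda>x. Inr x) ` {(t, l). t \<in> triples \<and> l \<in> L \<and> l \<notin> block t}"
    define f where "f i s = (case i of Inl t \<Rightarrow> (case t of (a, b, c) \<Rightarrow> ccol (q a) (q b) (q c) s)
        | Inr x \<Rightarrow> (case x of (t, l) \<Rightarrow> reg t (px (q l) s) (py (q l) s) s))" for i s
    have "finite {(t, l). t \<in> triples \<and> l \<in> L \<and> l \<notin> block t}"
      by (rule finite_subset[of _ "triples \<times> L"]) (use finite_triples finL in auto)
    then have "finite I" unfolding I_def using finite_triples by simp
    moreover have "polyfun (f i)" for i
    proof (cases i)
      case (Inl t)
      obtain a b c where "t = (a, b, c)" by (cases t)
      then have "f i = ccol (q a) (q b) (q c)" using Inl by (auto simp: f_def)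
      moreover have "polyfun (\<lambda>s. ccol (q a) (q b) (q c) s)" unfolding ccol_def by (intro polyfun_intros)
      ultimately show ?thesis by simp
    next
      case (Inr x)
      obtain a b c l where "x = ((a, b, c), l)" by (cases x) auto
      then have "f i = (\<lambda>s. creg (q a) (q b) (q c) (px (q l) s) (py (q l) s) s)" using Inr by (auto simp: f_def reg_def)
      moreover have "polyfun (\<lambda>s. creg (q a) (q b) (q c) (px (q l) s) (py (q l) s) s)"
        unfolding creg_def by (intro polyfun_intros)
      ultimately show ?thesis by simp
    qed
    moreover have "\<exists>s. f i s \<noteq> 0" if "i \<in> I" for i
      using that col by (auto simp: I_def f_def triples_def block_def vanishes_def)
    ultimately obtain s where "\<forall>i\<in>I. f i s \<noteq> 0" using polyfuns_avoid_roots by blast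
    then have "ccol (q a) (q b) (q c) s \<noteq> 0" if "(a, b, c) \<in> triples" for a b c
      using that by (auto simp: I_def f_def dest!: bspec[of _ _ "Inl (a, b, c)"])
    moreover have "reg t (px (q l) s) (py (q l) s) s \<noteq> 0" if "t \<in> triples" "l \<in> L" "l \<notin> block t" for t l
      using that bspec[OF \<open>\<forall>i\<in>I. f i s \<noteq> 0\<close>, of "Inr (t, l)"] by (auto simp: I_def f_def)
    ultimately show ?thesis by (rule that)
  qed
  have mid: "reg t ((px (q l) s + px (q m) s) / 2) ((py (q l) s + py (q m) s) / 2) s \<noteq> 0"
    if "t \<in> triples" "(l, m) \<in> {(fst t, fst (snd t)), (fst t, snd (snd t)), (fst (snd t), snd (snd t))}" for t l m
  proof -
    obtain a b c where t: "t = (a, b, c)" by (cases t)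
    have abc: "a \<in> L" "b \<in> L" "c \<in> L" "a \<noteq> b" "a \<noteq> c" "b \<noteq> c" using that(1) unfolding t by (auto simp: triples_def)
    show ?thesis using that(2) creg_midpoints_nonzero[OF skew[OF abc(1,2,4)] skew[OF abc(1,3,5)] skew[OF abc(2,3,6)] s(1)]
        that(1) unfolding t reg_def by auto
  qed
  have "\<forall>t. \<exists>A. polyfun A \<and>
    ((\<forall>\<mu>. A \<mu> = 0) \<longrightarrow> (\<forall>x1 y1 x2 y2. reg t x1 y1 s = 0 \<longrightarrow> reg t x2 y2 s = 0 \<longrightarrow> reg t ((x1 + x2)/2) ((y1 + y2)/2) s = 0)) \<and>
    (\<forall>\<mu>. A \<mu> \<noteq> 0 \<longrightarrow> (\<exists>B C. degree B \<le> 1 \<and> degree C \<le> 2 \<and> (\<forall>u v. monic_conic B C u v = reg t (u - \<mu> * v) v s / A \<mu>)))"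
  proof
    fix t
    have "quadric (reg t)" unfolding reg_def by (cases t) (simp add: quadric_creg)
    from quadric_slice_conic[OF this, of s] show "\<exists>A. polyfun A \<and>
    ((\<forall>\<mu>. A \<mu> = 0) \<longrightarrow> (\<forall>x1 y1 x2 y2. reg t x1 y1 s = 0 \<longrightarrow> reg t x2 y2 s = 0 \<longrightarrow> reg t ((x1 + x2)/2) ((y1 + y2)/2) s = 0)) \<and>
    (\<forall>\<mu>. A \<mu> \<noteq> 0 \<longrightarrow> (\<exists>B C. degree B \<le> 1 \<and> degree C \<le> 2 \<and> (\<forall>u v. monic_conic B C u v = reg t (u - \<mu> * v) v s / A \<mu>)))"
      by metis
  qed
  then obtain A where A: "\<And>t. polyfun (A t)"
     "\<And>t. \<forall>\<mu>. A t \<mu> = 0 \<Longrightarrow> (\<forall>x1 y1 x2 y2. reg t x1 y1 s = 0 \<longrightarrow> reg t x2 y2 s = 0 \<longrightarrow> reg t ((x1 + x2)/2) ((y1 + y2)/2) s = 0)"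
     "\<And>t \<mu>. A t \<mu> \<noteq> 0 \<Longrightarrow> \<exists>B C. degree B \<le> 1 \<and> degree C \<le> 2 \<and> (\<forall>u v. monic_conic B C u v = reg t (u - \<mu> * v) v s / A t \<mu>)"
    by metis
  have on0: "reg t (px (q l) s) (py (q l) s) s = 0" if "l \<in> block t" for t l
    using that by (auto simp: block_def vanishes_def)
  \<comment> \<open>If no shear worked, the zero set would be closed under midpoints, against
    \<open>mid\<close>.\<close>
  have A0: "\<exists>\<mu>. A t \<mu> \<noteq> 0" if t: "t \<in> triples" for t
  proof (rule ccontr)
    assume "\<nexists>\<mu>. A t \<mu> \<noteq> 0"
    then have z: "\<forall>\<mu>. A t \<mu> = 0" by blast
    obtain a b c where abc: "t = (a, b, c)" by (cases t)
    have "reg t (px (q a) s) (py (q a) s) s = 0" "reg t (px (q b) s) (py (q b) s) s = 0"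
      using on0 mem_block t unfolding abc by blast+
    then have "reg t ((px (q a) s + px (q b) s)/2) ((py (q a) s + py (q b) s)/2) s = 0" using A(2)[OF z] by blast
    then show False using mid[OF t, of a b] by (simp add: abc)
  qed
  \<comment> \<open>One shear for all conics, which also separates the abscissas: skew lines have
    different points at height \<open>s\<close>.\<close>
  obtain \<mu> where mu: "\<And>t. t \<in> triples \<Longrightarrow> A t \<mu> \<noteq> 0"
    "\<And>l m. l \<in> L \<Longrightarrow> m \<in> L \<Longrightarrow> l \<noteq> m \<Longrightarrow> px (q l) s + \<mu> * py (q l) s \<noteq> px (q m) s + \<mu> * py (q m) s"
  proof -
    define I where "I = (\<lambda>t. Inl t) ` triples \<union> (\<lambda>x. Inr x) ` {(l, m). l \<in> L \<and> m \<in> L \<and> l \<noteq> m}"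
    define f where "f i \<mu> = (case i of Inl t \<Rightarrow> A t \<mu>
        | Inr x \<Rightarrow> (case x of (l, m) \<Rightarrow> (px (q l) s - px (q m) s) + \<mu> * (py (q l) s - py (q m) s)))" for i \<mu>
    have "finite {(l, m). l \<in> L \<and> m \<in> L \<and> l \<noteq> m}" by (rule finite_subset[of _ "L \<times> L"]) (use finL in auto)
    then have "finite I" unfolding I_def using finite_triples by simp
    moreover have "polyfun (f i)" for i
    proof (cases i)
      case (Inl t)
      then have "f i = A t" by (auto simp: f_def)
      then show ?thesis using A(1) by simp
    next
      case (Inr x)
      obtain l m where "x = (l, m)" by (cases x)
      then have "f i = (\<lambda>\<mu>. (px (q l) s - px (q m) s) + \<mu> * (py (q l) s - py (q m) s))" using Inr by (auto simp: f_def)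
      moreover have "polyfun (\<lambda>\<mu>. (px (q l) s - px (q m) s) + \<mu> * (py (q l) s - py (q m) s))" by (intro polyfun_intros)
      ultimately show ?thesis by simp
    qed
    moreover have "\<exists>\<mu>. f i \<mu> \<noteq> 0" if iI: "i \<in> I" for i
    proof (cases i)
      case (Inl t)
      then show ?thesis using iI A0 by (auto simp: I_def f_def)
    next
      case (Inr x)
      then obtain l m where x: "i = Inr (l, m)" "l \<in> L" "m \<in> L" "l \<noteq> m" using iI by (auto simp: I_def)
      show ?thesis
      proof (rule ccontr)
        assume "\<nexists>\<mu>. f i \<mu> \<noteq> 0"
        then have "f i 0 = 0" "f i 1 = 0" by blast+
        then have "px (q l) s - px (q m) s = 0" "py (q l) s - py (q m) s = 0" unfolding x(1) f_def by simp_all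
        then have "cskew (q l) (q m) = 0" unfolding cskew_at[of _ _ s] by simp
        then show False using skew x by blast
      qed
    qed
    ultimately obtain \<mu> where m: "\<forall>i\<in>I. f i \<mu> \<noteq> 0" using polyfuns_avoid_roots by blast
    have "A t \<mu> \<noteq> 0" if "t \<in> triples" for t
      using that bspec[OF m, of "Inl t"] by (simp add: I_def f_def)
    moreover have "px (q l) s + \<mu> * py (q l) s \<noteq> px (q m) s + \<mu> * py (q m) s" if "l \<in> L" "m \<in> L" "l \<noteq> m" for l m
      using that bspec[OF m, of "Inr (l, m)"] by (auto simp: I_def f_def algebra_simps)
    ultimately show ?thesis by (rule that)
  qed
  have "\<forall>t\<in>triples. \<exists>B C. degree B \<le> 1 \<and> degree C \<le> 2 \<and> (\<forall>u v. monic_conic B C u v = reg t (u - \<mu> * v) v s / A t \<mu>)"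
    using A(3) mu(1) by blast
  then obtain B C where BC: "\<And>t. t \<in> triples \<Longrightarrow> degree (B t) \<le> 1" "\<And>t. t \<in> triples \<Longrightarrow> degree (C t) \<le> 2"
     "\<And>t u v. t \<in> triples \<Longrightarrow> monic_conic (B t) (C t) u v = reg t (u - \<mu> * v) v s / A t \<mu>" by metis
  \<comment> \<open>Equations belong to triples, but many triples span the same block. Fixing one
    triple per block keeps different curves at two common points at most.\<close>
  have "\<forall>\<beta>\<in>blocks. \<exists>t\<in>triples. \<beta> = block t" by (auto simp: blocks_def)
  then obtain tr where tr: "\<And>\<beta>. \<beta> \<in> blocks \<Longrightarrow> tr \<beta> \<in> triples" "\<And>\<beta>. \<beta> \<in> blocks \<Longrightarrow> block (tr \<beta>) = \<beta>" by metis
  define x where "x l = px (q l) s + \<mu> * py (q l) s" for l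
  define y where "y l = py (q l) s" for l
  have x_mid: "(x l + x m) / 2 - \<mu> * ((y l + y m) / 2) = (px (q l) s + px (q m) s) / 2" for l m
    by (simp add: x_def y_def field_simps)
  have on: "monic_conic (B (tr \<beta>)) (C (tr \<beta>)) (x l) (y l) = 0 \<longleftrightarrow> l \<in> \<beta>" if "\<beta> \<in> blocks" "l \<in> L" for \<beta> l
  proof -
    have "monic_conic (B (tr \<beta>)) (C (tr \<beta>)) (x l) (y l) = reg (tr \<beta>) (px (q l) s) (py (q l) s) s / A (tr \<beta>) \<mu>"
      unfolding BC(3)[OF tr(1)[OF that(1)]] by (simp add: x_def y_def)
    then show ?thesis using mu(1)[OF tr(1)[OF that(1)]] on0[of l "tr \<beta>"] s(2)[OF tr(1)[OF that(1)] that(2)] tr(2)[OF that(1)]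
      by auto
  qed
  have sub: "\<beta> \<subseteq> L" if "\<beta> \<in> blocks" for \<beta> using that block_subset by (auto simp: blocks_def)
  define G where "G = {\<beta> \<in> blocks. k \<le> card \<beta>}"
  have onset: "{l \<in> L. monic_conic (B (tr \<beta>)) (C (tr \<beta>)) (x l) (y l) = 0} = \<beta>" if "\<beta> \<in> G" for \<beta>
    using on[of \<beta>] sub[of \<beta>] that by (auto simp: G_def)
  have "card G \<le> 22674816 * 26120^2 * real (card L) ^ 3 / real k ^ 5 + 6 * real (card L) / k"
  proof (rule card_rich_conics[where x = x and y = y and Bp = "\<lambda>\<beta>. B (tr \<beta>)" and Cp = "\<lambda>\<beta>. C (tr \<beta>)"])
    show "finite L" by (rule finL)
    show "inj_on x L" using mu(2) by (auto simp: inj_on_def x_def)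
    show "finite G" unfolding G_def using finite_blocks by simp
    show "degree (B (tr \<beta>)) \<le> 1" "degree (C (tr \<beta>)) \<le> 2" if "\<beta> \<in> G" for \<beta> using BC tr that by (auto simp: G_def)
    show "104482 \<le> k" by (rule k)
    show "k \<le> card {l \<in> L. monic_conic (B (tr \<beta>)) (C (tr \<beta>)) (x l) (y l) = 0}" if "\<beta> \<in> G" for \<beta>
      unfolding onset[OF that] using that by (simp add: G_def)
    show "card {l \<in> L. monic_conic (B (tr \<beta>)) (C (tr \<beta>)) (x l) (y l) = 0 \<and> monic_conic (B (tr \<beta>')) (C (tr \<beta>')) (x l) (y l) = 0} \<le> 2"
      if "\<beta> \<in> G" "\<beta>' \<in> G" "\<beta> \<noteq> \<beta>'" for \<beta> \<beta>'
    proof -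
      have "{l \<in> L. monic_conic (B (tr \<beta>)) (C (tr \<beta>)) (x l) (y l) = 0 \<and> monic_conic (B (tr \<beta>')) (C (tr \<beta>')) (x l) (y l) = 0} = \<beta> \<inter> \<beta>'"
        using onset[OF that(1)] onset[OF that(2)] by blast
      then show ?thesis using blocks_inter that by (simp add: G_def)
    qed
    show "\<exists>v1 v2 v3. monic_conic (B (tr \<beta>)) (C (tr \<beta>)) (x v1) (y v1) = 0 \<and> monic_conic (B (tr \<beta>)) (C (tr \<beta>)) (x v2) (y v2) = 0 \<and>
       monic_conic (B (tr \<beta>)) (C (tr \<beta>)) (x v3) (y v3) = 0 \<and>
       monic_conic (B (tr \<beta>)) (C (tr \<beta>)) ((x v1 + x v2)/2) ((y v1 + y v2)/2) \<noteq> 0 \<and>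
       monic_conic (B (tr \<beta>)) (C (tr \<beta>)) ((x v1 + x v3)/2) ((y v1 + y v3)/2) \<noteq> 0 \<and>
       monic_conic (B (tr \<beta>)) (C (tr \<beta>)) ((x v2 + x v3)/2) ((y v2 + y v3)/2) \<noteq> 0" if "\<beta> \<in> G" for \<beta>
    proof -
      have b: "\<beta> \<in> blocks" using that by (simp add: G_def)
      obtain v1 v2 v3 where t: "tr \<beta> = (v1, v2, v3)" by (cases "tr \<beta>")
      have "v1 \<in> \<beta>" "v2 \<in> \<beta>" "v3 \<in> \<beta>" using mem_block[of v1 v2 v3] tr[OF b] unfolding t by auto
      then have "monic_conic (B (tr \<beta>)) (C (tr \<beta>)) (x v1) (y v1) = 0" "monic_conic (B (tr \<beta>)) (C (tr \<beta>)) (x v2) (y v2) = 0"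
        "monic_conic (B (tr \<beta>)) (C (tr \<beta>)) (x v3) (y v3) = 0" using on[OF b] sub[OF b] by auto
      moreover have "monic_conic (B (tr \<beta>)) (C (tr \<beta>)) ((x l + x m)/2) ((y l + y m)/2) \<noteq> 0"
        if "(l, m) \<in> {(v1, v2), (v1, v3), (v2, v3)}" for l m
        unfolding BC(3)[OF tr(1)[OF b]] x_mid using mid[OF tr(1)[OF b], of l m] mu(1)[OF tr(1)[OF b]] that
        by (simp add: t y_def)
      ultimately show ?thesis by (intro exI[of _ v1] exI[of _ v2] exI[of _ v3]) simp
    qed
  qed
  then show ?thesis by (simp add: G_def)
qed

end

section \<open>Counting and random sampling\<close>

text \<open>The regulus of a bad 4-subset may be generated by lines outside \<open>L\<close>. Its
  equation vanishes on three lines of the subset, so it is a nonzero multiple of the equation of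
  these three, and the subset lies in their block.\<close>

lemma lines_blocks:
  fixes L :: "space set set"
  assumes fin: "finite L" and lines: "\<And>l. l \<in> L \<Longrightarrow> is_line l" and sk: "pairwise skew L"
  shows "\<exists>Bl. finite Bl \<and> card Bl \<le> card L ^ 3 \<and> (\<forall>\<beta>\<in>Bl. \<beta> \<subseteq> L \<and> on_common_regulus \<beta>) \<and>
    (\<forall>T. T \<subseteq> L \<and> card T = 4 \<and> on_common_regulus T \<longrightarrow> (\<exists>\<beta>\<in>Bl. T \<subseteq> \<beta>)) \<and>
    (\<forall>k. 104482 \<le> k \<longrightarrow> card {\<beta> \<in> Bl. k \<le> card \<beta>} \<le> 22674816 * 26120^2 * real (card L) ^ 3 / real k ^ 5 + 6 * real (card L) / k)"
proof -
  define S4 where "S4 = {T. T \<subseteq> L \<and> card T = 4 \<and> on_common_regulus T}"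
  have fS4: "finite S4" unfolding S4_def using fin by simp
  have "\<forall>T\<in>S4. \<exists>a b c. is_line a \<and> is_line b \<and> is_line c \<and> skew a b \<and> skew a c \<and> skew b c \<and> (\<forall>l\<in>T. l \<subseteq> regulus_of a b c)"
    unfolding S4_def on_common_regulus_def is_regulus_def by blast
  then obtain a b c where ext: "\<And>T. T \<in> S4 \<Longrightarrow> is_line (a T) \<and> is_line (b T) \<and> is_line (c T) \<and>
     skew (a T) (b T) \<and> skew (a T) (c T) \<and> skew (b T) (c T) \<and> (\<forall>l\<in>T. l \<subseteq> regulus_of (a T) (b T) (c T))"
    by metis
  \<comment> \<open>The generators chosen for each bad 4-subset join the lines of \<open>L\<close>,
    so that one chart is generic for all of them.\<close>
  define M where "M = L \<union> a ` S4 \<union> b ` S4 \<union> c ` S4"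
  define D where "D = {(x, y, z). x \<in> L \<and> y \<in> L \<and> z \<in> L \<and> x \<noteq> y \<and> x \<noteq> z \<and> y \<noteq> z}"
  define Tr where "Tr = D \<union> (\<lambda>T. (a T, b T, c T)) ` S4"
  have fM: "finite M" unfolding M_def using fin fS4 by simp
  have lM: "is_line l" if "l \<in> M" for l using that lines ext by (auto simp: M_def)
  have "finite D" by (rule finite_subset[of _ "L \<times> L \<times> L"]) (use fin in \<open>auto simp: D_def\<close>)
  then have fTr: "finite Tr" unfolding Tr_def using fS4 by simp
  have skL: "skew x y" if "x \<in> L" "y \<in> L" "x \<noteq> y" for x y using sk that by (auto simp: pairwise_def)
  have Tr: "x \<in> M \<and> y \<in> M \<and> z \<in> M \<and> skew x y \<and> skew x z \<and> skew y z" if "(x, y, z) \<in> Tr" for x y z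
    using that unfolding Tr_def
  proof
    assume "(x, y, z) \<in> D"
    then show ?thesis using skL by (auto simp: D_def M_def)
  next
    assume "(x, y, z) \<in> (\<lambda>T. (a T, b T, c T)) ` S4"
    then show ?thesis using ext by (auto simp: M_def)
  qed
  obtain q where Q: "(\<forall>l\<in>M. \<forall>m\<in>M. skew l m \<longrightarrow> cskew (q l) (q m) \<noteq> 0) \<and>
    (\<forall>a\<in>M. \<forall>b\<in>M. \<forall>c\<in>M. \<forall>l\<in>M.
       l \<subseteq> regulus_of a b c \<longleftrightarrow> (\<forall>z. creg (q a) (q b) (q c) (px (q l) z) (py (q l) z) z = 0)) \<and>
    (\<forall>(a, b, c)\<in>Tr. \<exists>s. ccol (q a) (q b) (q c) s \<noteq> 0)"
    using chart_exists[OF fM lM fTr Tr] by (rule exE)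
  have q1: "cskew (q l) (q m) \<noteq> 0" if "l \<in> M" "m \<in> M" "skew l m" for l m
    using conjunct1[OF Q] that by simp
  have q2: "l \<subseteq> regulus_of x y z \<longleftrightarrow> (\<forall>h. creg (q x) (q y) (q z) (px (q l) h) (py (q l) h) h = 0)"
    if "x \<in> M" "y \<in> M" "z \<in> M" "l \<in> M" for x y z l
    using conjunct1[OF conjunct2[OF Q]] that by simp
  have q3: "\<exists>s. ccol (q x) (q y) (q z) s \<noteq> 0" if "(x, y, z) \<in> Tr" for x y z
    using bspec[OF conjunct2[OF conjunct2[OF Q]] that] by simp
  have LM: "l \<in> M" if "l \<in> L" for l using that by (simp add: M_def)
  interpret skew_lines L q
  proof
    show "finite L" by (rule fin)
    show "cskew (q l) (q m) \<noteq> 0" if "l \<in> L" "m \<in> L" "l \<noteq> m" for l m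
      by (rule q1[OF LM[OF that(1)] LM[OF that(2)] skL[OF that]])
    show "\<exists>s. ccol (q x) (q y) (q z) s \<noteq> 0" if "x \<in> L" "y \<in> L" "z \<in> L" "x \<noteq> y" "x \<noteq> z" "y \<noteq> z" for x y z
      by (rule q3) (use that in \<open>auto simp: Tr_def D_def\<close>)
  qed
  have block_reg: "block (x, y, z) = {l \<in> L. l \<subseteq> regulus_of x y z}" if "x \<in> L" "y \<in> L" "z \<in> L" for x y z
    unfolding block_def reg_def prod.case vanishes_def using q2[OF LM[OF that(1)] LM[OF that(2)] LM[OF that(3)] LM] by blast
  have "\<beta> \<subseteq> L \<and> on_common_regulus \<beta>" if \<beta>: "\<beta> \<in> blocks" for \<beta>
  proof -
    obtain x y z where t: "(x, y, z) \<in> triples" "\<beta> = block (x, y, z)" using \<beta> by (auto simp: blocks_def)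
    then have xyz: "x \<in> L" "y \<in> L" "z \<in> L" "x \<noteq> y" "x \<noteq> z" "y \<noteq> z" by (auto simp: triples_def)
    then have "is_regulus (regulus_of x y z)" unfolding is_regulus_def using lines skL by blast
    moreover have "\<forall>l\<in>\<beta>. l \<subseteq> regulus_of x y z" unfolding t(2) block_reg[OF xyz(1-3)] by blast
    ultimately show ?thesis using block_subset t(2) unfolding on_common_regulus_def by blast
  qed
  moreover have "\<exists>\<beta>\<in>blocks. T \<subseteq> \<beta>" if T: "T \<subseteq> L" "card T = 4" "on_common_regulus T" for T
  proof -
    have TS: "T \<in> S4" using T by (simp add: S4_def)
    have "card T \<ge> 3" using T(2) by simp
    then obtain U where U: "U \<subseteq> T" "card U = 3" by (rule obtain_subset_with_card_n)
    then obtain x y z where xyz: "U = {x, y, z}" "x \<noteq> y" "x \<noteq> z" "y \<noteq> z" by (auto simp: card_3_iff)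
    have in_T: "x \<in> T" "y \<in> T" "z \<in> T" using U(1) xyz(1) by auto
    have t: "(x, y, z) \<in> triples" using in_T xyz T(1) by (auto simp: triples_def)
    have eM: "a T \<in> M" "b T \<in> M" "c T \<in> M" using TS by (auto simp: M_def)
    define Q where "Q = creg (q (a T)) (q (b T)) (q (c T))"
    have van: "vanishes Q (q l)" if "l \<in> T" for l
      unfolding vanishes_def Q_def using q2[OF eM LM[of l]] ext[OF TS] that T(1) by blast
    have "\<exists>s. ccol (q (a T)) (q (b T)) (q (c T)) s \<noteq> 0" by (rule q3) (use TS in \<open>auto simp: Tr_def\<close>)
    then obtain s where s: "ccol (q (a T)) (q (b T)) (q (c T)) s \<noteq> 0" ..
    have "cskew (q (a T)) (q (b T)) \<noteq> 0" "cskew (q (a T)) (q (c T)) \<noteq> 0" "cskew (q (b T)) (q (c T)) \<noteq> 0"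
      using q1 eM ext[OF TS] by blast+
    then have nz: "\<exists>x y z. Q x y z \<noteq> 0" using creg_midpoints_nonzero(1)[OF _ _ _ s] unfolding Q_def by blast
    obtain \<kappa> where k: "\<forall>u v w. Q u v w = \<kappa> * reg (x, y, z) u v w"
      using quadric_multiple[OF _ t van[OF in_T(1)] van[OF in_T(2)] van[OF in_T(3)]] quadric_creg unfolding Q_def by blast
    have "T \<subseteq> block (x, y, z)"
      unfolding block_def using van vanishes_multiple[OF k nz] T(1) by blast
    then show ?thesis using t by (auto simp: blocks_def)
  qed
  ultimately show ?thesis
    using finite_blocks card_blocks card_rich_blocks by (intro exI[of _ blocks]) blast
qed

section \<open>From rich blocks to bad 4-subsets\<close>

lemma sum_inverse_squares_le: "(\<Sum>k=1..m. 1 / real k ^ 2) \<le> 2"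
proof -
  have *: "(\<Sum>k=1..m. 1 / real k ^ 2) \<le> 2 - 1 / real m" if "0 < m" for m using that
  proof (induction m rule: nat_induct_non_zero)
    case (Suc m)
    have "1 / real (Suc m) ^ 2 \<le> 1 / (real m * real (Suc m))"
      using Suc by (intro divide_left_mono) (auto simp: power2_eq_square)
    also have "\<dots> = 1 / real m - 1 / real (Suc m)" using Suc by (simp add: field_simps)
    finally have "1 / real (Suc m) ^ 2 \<le> 1 / real m - 1 / real (Suc m)" .
    then show ?case using Suc by simp
  qed simp
  show ?thesis
  proof (cases "m = 0")
    case False
    then have "(\<Sum>k=1..m. 1 / real k ^ 2) \<le> 2 - 1 / real m" by (intro *) simp
    also have "\<dots> \<le> 2" by simp
    finally show ?thesis .
  qed simp
qed

text \<open>Discrete integration for summing by layers: the fourth power grows by at most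
  \<open>4 * k ^ 3\<close> in step \<open>k\<close>.\<close>

lemma power4_le_sum: "j ^ 4 \<le> (\<Sum>k=1..j. 4 * k ^ 3)" for j :: nat
proof (induction j)
  case (Suc j)
  have "Suc j ^ 4 = j ^ 4 + (4 * j^3 + 6 * j^2 + 4 * j + 1)" by (simp add: power_numeral_reduce algebra_simps)
  also have "\<dots> \<le> j ^ 4 + 4 * Suc j ^ 3" by (simp add: power_numeral_reduce algebra_simps)
  finally show ?case using Suc by simp
qed simp

text \<open>Summation over the layers \<open>k \<le> card \<beta>\<close>. The \<open>K\<close>
  lowest layers are bounded by \<open>card Bl\<close>, the main term is \<open>4 * C\<close> times
  the series of inverse squares, and the linear term sums to \<open>24 * n * m ^ 3\<close>, where
  \<open>m ^ 3 \<le> n ^ 2\<close> is used.\<close>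

lemma sum_block_powers:
  fixes Bl :: "'l set set" and C n :: real
  assumes fin: "finite Bl" and n: "0 \<le> n" "card Bl \<le> n ^ 3" and C: "0 \<le> C"
    and rich: "\<And>k. K \<le> k \<Longrightarrow> card {\<beta> \<in> Bl. k \<le> card \<beta>} \<le> C * n ^ 3 / real k ^ 5 + 6 * n / k"
    and m: "\<And>\<beta>. \<beta> \<in> Bl \<Longrightarrow> card \<beta> \<le> m" "real m ^ 3 \<le> n ^ 2" and K: "0 < K"
  shows "(\<Sum>\<beta>\<in>Bl. real (card \<beta> ^ 4)) \<le> (4 * real K ^ 4 + 8 * C + 24) * n ^ 3"
proof -
  define N where "N k = card {\<beta> \<in> Bl. k \<le> card \<beta>}" for k
  have "(\<Sum>\<beta>\<in>Bl. card \<beta> ^ 4) \<le> (\<Sum>\<beta>\<in>Bl. \<Sum>k=1..m. if k \<le> card \<beta> then 4 * k ^ 3 else 0)"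
  proof (rule sum_mono)
    fix \<beta> assume "\<beta> \<in> Bl"
    then have "card \<beta> \<le> m" by (rule m(1))
    then have "{k \<in> {1..m}. k \<le> card \<beta>} = {1..card \<beta>}" by auto
    then have "(\<Sum>k=1..card \<beta>. 4 * k ^ 3) = (\<Sum>k=1..m. if k \<le> card \<beta> then 4 * k ^ 3 else 0)"
      using sum.inter_filter[of "{1..m}" "\<lambda>k. 4 * k ^ 3" "\<lambda>k. k \<le> card \<beta>"] by simp
    then show "card \<beta> ^ 4 \<le> (\<Sum>k=1..m. if k \<le> card \<beta> then 4 * k ^ 3 else 0)" using power4_le_sum[of "card \<beta>"] by simp
  qed
  also have "\<dots> = (\<Sum>k=1..m. \<Sum>\<beta>\<in>Bl. if k \<le> card \<beta> then 4 * k ^ 3 else 0)" by (rule sum.swap)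
  also have "\<dots> = (\<Sum>k=1..m. 4 * k ^ 3 * N k)"
  proof (rule sum.cong[OF refl])
    fix k
    have "(\<Sum>\<beta>\<in>Bl. if k \<le> card \<beta> then 4 * k ^ 3 else 0) = (\<Sum>\<beta> | \<beta> \<in> Bl \<and> k \<le> card \<beta>. 4 * k ^ 3)"
      by (rule sum.inter_filter[OF fin, symmetric])
    then show "(\<Sum>\<beta>\<in>Bl. if k \<le> card \<beta> then 4 * k ^ 3 else 0) = 4 * k ^ 3 * N k" by (simp add: N_def)
  qed
  finally have "real (\<Sum>\<beta>\<in>Bl. card \<beta> ^ 4) \<le> real (\<Sum>k=1..m. 4 * k ^ 3 * N k)" by (rule of_nat_mono)
  also have "\<dots> = (\<Sum>k=1..m. 4 * real k ^ 3 * real (N k))" by simp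
  also have "\<dots> \<le> (\<Sum>k=1..m. (if k < K then 4 * real K ^ 3 * n ^ 3 else 0) + (4 * C * n ^ 3 * (1 / real k ^ 2) + 24 * n * real m ^ 2))"
  proof (rule sum_mono)
    fix k assume k: "k \<in> {1..m}"
    show "4 * real k ^ 3 * real (N k) \<le> (if k < K then 4 * real K ^ 3 * n ^ 3 else 0) + (4 * C * n ^ 3 * (1 / real k ^ 2) + 24 * n * real m ^ 2)"
    proof (cases "k < K")
      case True
      have "N k \<le> card Bl" unfolding N_def by (rule card_mono[OF fin]) auto
      then have "real (N k) \<le> n ^ 3" using n(2) by linarith
      moreover have "real k ^ 3 \<le> real K ^ 3" using True by (intro power_mono) auto
      ultimately have "4 * real k ^ 3 * real (N k) \<le> 4 * real K ^ 3 * n ^ 3" by (intro mult_mono) auto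
      moreover have "0 \<le> 4 * C * n ^ 3 * (1 / real k ^ 2)" "0 \<le> 24 * n * real m ^ 2" using C n by simp_all
      ultimately show ?thesis using True by simp
    next
      case False
      then have "4 * real k ^ 3 * real (N k) \<le> 4 * real k ^ 3 * (C * n ^ 3 / real k ^ 5 + 6 * n / k)"
        unfolding N_def by (intro mult_left_mono rich) auto
      also have "\<dots> = 4 * C * n ^ 3 * (1 / real k ^ 2) + 24 * n * real k ^ 2"
        using k by (simp add: field_simps power_numeral_reduce)
      also have "24 * n * real k ^ 2 \<le> 24 * n * real m ^ 2"
        using k n by (intro mult_left_mono power_mono) auto
      finally show ?thesis using False by simp
    qed
  qed
  also have "\<dots> = (\<Sum>k=1..m. if k < K then 4 * real K ^ 3 * n ^ 3 else 0) + (4 * C * n ^ 3 * (\<Sum>k=1..m. 1 / real k ^ 2) + 24 * n * real m ^ 3)"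
    by (simp add: sum.distrib sum_distrib_left power3_eq_cube power2_eq_square)
  also have "\<dots> \<le> 4 * real K ^ 4 * n ^ 3 + (4 * C * n ^ 3 * 2 + 24 * n * n ^ 2)"
  proof (intro add_mono mult_left_mono)
    have "(\<Sum>k=1..m. if k < K then 4 * real K ^ 3 * n ^ 3 else 0) = (\<Sum>k\<in>{k\<in>{1..m}. k < K}. 4 * real K ^ 3 * n ^ 3)"
      by (rule sum.inter_filter[symmetric]) simp
    also have "\<dots> \<le> (\<Sum>k\<in>{..<K}. 4 * real K ^ 3 * n ^ 3)" by (rule sum_mono2) (use n in auto)
    also have "\<dots> = 4 * real K ^ 4 * n ^ 3" by (simp add: power_numeral_reduce)
    finally show "(\<Sum>k=1..m. if k < K then 4 * real K ^ 3 * n ^ 3 else 0) \<le> 4 * real K ^ 4 * n ^ 3" .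
    show "(\<Sum>k=1..m. 1 / real k ^ 2) \<le> 2" by (rule sum_inverse_squares_le)
    show "real m ^ 3 \<le> n ^ 2" by (rule m(2))
  qed (use C n in auto)
  also have "\<dots> = (4 * real K ^ 4 + 8 * C + 24) * n ^ 3" by (simp add: algebra_simps power3_eq_cube power2_eq_square)
  finally show ?thesis by simp
qed

text \<open>The first colour class of a random colouring with $q$ colours, minus one point of each edge inside it.\<close>

lemma independent_set_4_uniform:
  fixes C :: real
  assumes V: "finite V" and E: "\<And>T. T \<in> E \<Longrightarrow> T \<subseteq> V \<and> card T = 4"
    and cE: "card E \<le> C * real (card V) ^ 3" and q: "0 < q" "2 * C * real (card V) ^ 2 \<le> real q ^ 3"
  shows "\<exists>S\<subseteq>V. real (card V) / (2 * real q) \<le> card S \<and> (\<forall>T\<in>E. \<not> T \<subseteq> S)"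
proof -
  define n where "n = card V"
  define F where "F = PiE V (\<lambda>_. {..<q})"
  define A where "A f = {v \<in> V. f v = (0::nat)}" for f
  define bad where "bad f = {T \<in> E. T \<subseteq> A f}" for f
  have fE: "finite E" by (rule finite_subset[of _ "Pow V"]) (use E V in auto)
  have fF: "finite F" unfolding F_def using V by (intro finite_PiE) auto
  have cF: "card F = q ^ n" unfolding F_def n_def using V by (simp add: card_PiE)
  \<comment> \<open>A set \<open>U\<close> falls into the first class with probability
    \<open>1 / q ^ card U\<close>.\<close>
  have cU: "card {f \<in> F. U \<subseteq> A f} * q ^ card U = q ^ n" if U: "U \<subseteq> V" for U
  proof -
    have "{f \<in> F. U \<subseteq> A f} = PiE V (\<lambda>v. if v \<in> U then {0} else {..<q})"
    proof (intro set_eqI iffI)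
      fix f assume f: "f \<in> {f \<in> F. U \<subseteq> A f}"
      then show "f \<in> PiE V (\<lambda>v. if v \<in> U then {0} else {..<q})"
        by (intro PiE_I) (auto simp: F_def A_def PiE_iff extensional_def)
    next
      fix f assume f: "f \<in> PiE V (\<lambda>v. if v \<in> U then {0} else {..<q})"
      have "f v < q" if "v \<in> V" for v using f that q(1) by (cases "v \<in> U") (auto simp: PiE_iff)
      moreover have "f v = 0" if "v \<in> U" for v using f that U by (force simp: PiE_iff)
      ultimately show "f \<in> {f \<in> F. U \<subseteq> A f}" using f U by (auto simp: F_def A_def PiE_iff)
    qed
    then have "card {f \<in> F. U \<subseteq> A f} = (\<Prod>v\<in>V. card (if v \<in> U then {0} else {..<q}))" using V by (simp add: card_PiE)
    also have "\<dots> = (\<Prod>v\<in>V - U. q)"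
    proof -
      have "(\<Prod>v\<in>V - U. q) = (\<Prod>v\<in>V. card (if v \<in> U then {0} else {..<q}))"
        by (rule prod.mono_neutral_cong_left) (use V in auto)
      then show ?thesis by simp
    qed
    also have "\<dots> = q ^ (n - card U)" using V U by (simp add: card_Diff_subset finite_subset n_def)
    finally show ?thesis using card_mono[OF V U] by (simp add: n_def flip: power_add)
  qed
  have sA: "(\<Sum>f\<in>F. card (A f)) * q = n * q ^ n"
  proof -
    have "(\<Sum>f\<in>F. card (A f)) = (\<Sum>f\<in>F. \<Sum>v\<in>V. if f v = 0 then 1 else 0)"
      unfolding A_def using V by (simp only: sum_indicator_nat)
    also have "\<dots> = (\<Sum>v\<in>V. \<Sum>f\<in>F. if f v = 0 then 1 else 0)" by (rule sum.swap)
    also have "\<dots> = (\<Sum>v\<in>V. card {f\<in>F. f v = 0})" using fF by (simp only: sum_indicator_nat)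
    also have "\<dots> * q = (\<Sum>v\<in>V. q ^ n)" unfolding sum_distrib_right
    proof (rule sum.cong[OF refl])
      fix v assume "v \<in> V"
      then show "card {f\<in>F. f v = 0} * q = q ^ n" using cU[of "{v}"] by (simp add: A_def)
    qed
    finally show ?thesis by (simp add: n_def)
  qed
  have sB: "(\<Sum>f\<in>F. card (bad f)) * q ^ 4 = card E * q ^ n"
  proof -
    have "(\<Sum>f\<in>F. card (bad f)) = (\<Sum>f\<in>F. \<Sum>T\<in>E. if T \<subseteq> A f then 1 else 0)"
      unfolding bad_def using fE by (simp only: sum_indicator_nat)
    also have "\<dots> = (\<Sum>T\<in>E. \<Sum>f\<in>F. if T \<subseteq> A f then 1 else 0)" by (rule sum.swap)
    also have "\<dots> = (\<Sum>T\<in>E. card {f\<in>F. T \<subseteq> A f})" using fF by (simp only: sum_indicator_nat)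
    also have "\<dots> * q ^ 4 = (\<Sum>T\<in>E. q ^ n)" unfolding sum_distrib_right
    proof (rule sum.cong[OF refl])
      fix T assume "T \<in> E"
      then show "card {f\<in>F. T \<subseteq> A f} * q ^ 4 = q ^ n" using cU[of T] E[of T] by simp
    qed
    finally show ?thesis by simp
  qed
  \<comment> \<open>The expected difference is \<open>n / q - card E / q ^ 4\<close>. The hypothesis
    on \<open>q\<close> makes the second term at most half of the first.\<close>
  have "\<exists>f\<in>F. real n / (2 * q) \<le> real (card (A f)) - real (card (bad f))"
  proof (rule ccontr)
    assume "\<not> ?thesis"
    then have lt: "\<And>f. f \<in> F \<Longrightarrow> real (card (A f)) - real (card (bad f)) < real n / (2 * q)" by force
    have "F \<noteq> {}" using cF q(1) by auto
    then have "(\<Sum>f\<in>F. real (card (A f)) - real (card (bad f))) < (\<Sum>f\<in>F. real n / (2 * q))"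
      using fF lt by (intro sum_strict_mono) auto
    then have "real (\<Sum>f\<in>F. card (A f)) - real (\<Sum>f\<in>F. card (bad f)) < real q ^ n * (real n / (2 * q))"
      by (simp add: sum_subtractf cF)
    then have "(real (\<Sum>f\<in>F. card (A f)) - real (\<Sum>f\<in>F. card (bad f))) * real q ^ 4 < real q ^ n * (real n / (2 * q)) * real q ^ 4"
      using q(1) by (intro mult_strict_right_mono) auto
    also have "\<dots> = real q ^ n * (real n * real q ^ 3 / 2)" using q(1) by (simp add: field_simps power_numeral_reduce)
    also have "(real (\<Sum>f\<in>F. card (A f)) - real (\<Sum>f\<in>F. card (bad f))) * real q ^ 4
        = real ((\<Sum>f\<in>F. card (A f)) * q) * real q ^ 3 - real ((\<Sum>f\<in>F. card (bad f)) * q ^ 4)"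
      by (simp add: algebra_simps power_numeral_reduce)
    also have "\<dots> = real q ^ n * (real n * real q ^ 3 - real (card E))" unfolding sA sB by (simp add: algebra_simps)
    finally have "real n * real q ^ 3 - real (card E) < real n * real q ^ 3 / 2" using q(1) by (simp add: mult_less_cancel_left_pos)
    then have "real n * real q ^ 3 < 2 * real (card E)" by simp
    also have "\<dots> \<le> 2 * (C * real n ^ 3)" using cE by (simp add: n_def)
    also have "\<dots> = real n * (2 * C * real n ^ 2)" by (simp add: power3_eq_cube power2_eq_square)
    also have "\<dots> \<le> real n * real q ^ 3" using q(2) by (intro mult_left_mono) (auto simp: n_def)
    finally show False by simp
  qed
  then obtain f where f: "real n / (2 * q) \<le> real (card (A f)) - real (card (bad f))" by blast
  have "\<forall>T\<in>bad f. \<exists>v. v \<in> T" using E by (auto simp: bad_def) (metis card.empty ex_in_conv zero_neq_numeral)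
  then obtain pick where pick: "\<And>T. T \<in> bad f \<Longrightarrow> pick T \<in> T" by metis
  define S where "S = A f - pick ` bad f"
  have fb: "finite (bad f)" unfolding bad_def using fE by simp
  have "card (A f) - card (pick ` bad f) \<le> card S" unfolding S_def by (rule diff_card_le_card_Diff) (use fb in simp)
  moreover have "card (pick ` bad f) \<le> card (bad f)" by (rule card_image_le[OF fb])
  ultimately have "real (card (A f)) - real (card (bad f)) \<le> card S" by linarith
  then have "real n / (2 * q) \<le> card S" using f by linarith
  moreover have "\<not> T \<subseteq> S" if "T \<in> E" for T
  proof
    assume "T \<subseteq> S"
    then have "T \<in> bad f" using that by (auto simp: bad_def S_def)
    then have "pick T \<in> T" "pick T \<notin> S" using pick by (auto simp: S_def)
    then show False using \<open>T \<subseteq> S\<close> by blast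
  qed
  moreover have "S \<subseteq> V" by (auto simp: S_def A_def)
  ultimately show ?thesis unfolding n_def by (intro exI[of _ S]) simp
qed

theorem theorem26:
  "\<exists>c\<^sub>1 c\<^sub>2 :: real. c\<^sub>1 > 0 \<and> c\<^sub>2 > 0 \<and>
    (\<forall>(n :: nat) (L :: space set set).
      finite L \<and> card L = n \<and> (\<forall>l\<in>L. is_line l) \<and> pairwise skew L \<longrightarrow>
        (\<exists>S\<subseteq>L. real (card S) \<ge> c\<^sub>1 * real n powr (2/3) \<and> on_common_regulus S) \<or>
        (\<exists>S\<subseteq>L. real (card S) \<ge> c\<^sub>2 * real n powr (1/3) \<and>
          (\<forall>T\<subseteq>S. card T = 4 \<longrightarrow> \<not> on_common_regulus T)))"
proof -
  define C :: real where "C = 4 * real 104482 ^ 4 + 8 * (22674816 * 26120^2) + 24"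
  \<comment> \<open>Chosen with \<open>D ^ 3 = 2 * C\<close>: as \<open>N ^ 3 = n ^ 2\<close>, about
    \<open>D * N\<close> colours satisfy the hypothesis of
    \<open>independent_set_4_uniform\<close>.\<close>
  define D where "D = (2 * C) powr (1/3)"
  have C1: "1 \<le> 2 * C" by (simp add: C_def)
  have D1: "1 \<le> D" unfolding D_def using C1 by (intro ge_one_powr_ge_zero) auto
  have D3: "D ^ 3 = 2 * C" unfolding D_def using C1 by (simp add: powr_realpow[symmetric] powr_powr)
  have main: "(\<exists>S\<subseteq>L. real (card S) \<ge> 1 * real n powr (2/3) \<and> on_common_regulus S) \<or>
        (\<exists>S\<subseteq>L. real (card S) \<ge> 1 / (4 * D) * real n powr (1/3) \<and> (\<forall>T\<subseteq>S. card T = 4 \<longrightarrow> \<not> on_common_regulus T))"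
    if L: "finite L" "card L = n" "\<forall>l\<in>L. is_line l" "pairwise skew L" for n and L :: "space set set"
  proof (cases "n = 0")
    case True
    then show ?thesis by (intro disjI2 exI[of _ "{}"]) auto
  next
    case False
    define N where "N = real n powr (2/3)"
    have n1: "1 \<le> real n" using False by simp
    have N1: "1 \<le> N" unfolding N_def using n1 by (intro ge_one_powr_ge_zero) auto
    have N3: "N ^ 3 = real n ^ 2"
    proof -
      have "N ^ 3 = N powr 3" using N1 by (subst powr_numeral) auto
      also have "\<dots> = real n powr 2" unfolding N_def powr_powr by simp
      also have "\<dots> = real n ^ 2" using n1 by (subst powr_numeral) auto
      finally show ?thesis .
    qed
    have "is_line l" if "l \<in> L" for l using L(3) that by blast
    from lines_blocks[OF L(1) this L(4)]
    obtain Bl where B: "finite Bl \<and> card Bl \<le> card L ^ 3 \<and> (\<forall>\<beta>\<in>Bl. \<beta> \<subseteq> L \<and> on_common_regulus \<beta>) \<and>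
      (\<forall>T. T \<subseteq> L \<and> card T = 4 \<and> on_common_regulus T \<longrightarrow> (\<exists>\<beta>\<in>Bl. T \<subseteq> \<beta>)) \<and>
      (\<forall>k. 104482 \<le> k \<longrightarrow> card {\<beta> \<in> Bl. k \<le> card \<beta>} \<le> 22674816 * 26120^2 * real (card L) ^ 3 / real k ^ 5 + 6 * real (card L) / k)"
      by (rule exE)
    have Bl: "finite Bl" "card Bl \<le> card L ^ 3"
      "\<And>\<beta>. \<beta> \<in> Bl \<Longrightarrow> \<beta> \<subseteq> L \<and> on_common_regulus \<beta>"
      "\<And>T. T \<subseteq> L \<Longrightarrow> card T = 4 \<Longrightarrow> on_common_regulus T \<Longrightarrow> \<exists>\<beta>\<in>Bl. T \<subseteq> \<beta>"
      "\<And>k. 104482 \<le> k \<Longrightarrow> card {\<beta> \<in> Bl. k \<le> card \<beta>} \<le> 22674816 * 26120^2 * real (card L) ^ 3 / real k ^ 5 + 6 * real (card L) / k"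
      using B by (elim conjE; simp)+
    show ?thesis
    proof (cases "\<exists>\<beta>\<in>Bl. N \<le> card \<beta>")
      case True
      then show ?thesis using Bl(3) unfolding N_def by (intro disjI1) auto
    next
      case False
      \<comment> \<open>Without a block of \<open>N\<close> lines all blocks have at most
        \<open>m\<close> lines, and \<open>m ^ 3 \<le> n ^ 2\<close> is what
        \<open>sum_block_powers\<close> asks for.\<close>
      define m where "m = nat \<lfloor>N\<rfloor>"
      have "real m \<le> N" using N1 by (simp add: m_def)
      then have m3: "real m ^ 3 \<le> real n ^ 2" unfolding N3[symmetric] by (intro power_mono) auto
      have mb: "card \<beta> \<le> m" if "\<beta> \<in> Bl" for \<beta>
        using False that N1 unfolding m_def by (simp add: le_nat_floor not_le less_imp_le)
      have s4: "(\<Sum>\<beta>\<in>Bl. real (card \<beta> ^ 4)) \<le> C * real n ^ 3"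
        unfolding C_def
        by (rule sum_block_powers[OF Bl(1) _ _ _ _ mb m3]) (use Bl(2,5) L(2) in \<open>auto simp flip: of_nat_power\<close>)
      define E where "E = {T. T \<subseteq> L \<and> card T = 4 \<and> on_common_regulus T}"
      have fb: "finite \<beta>" if "\<beta> \<in> Bl" for \<beta> using Bl(3)[OF that] L(1) finite_subset by blast
      have "E \<subseteq> (\<Union>\<beta>\<in>Bl. {T. T \<subseteq> \<beta> \<and> card T = 4})" using Bl(4) by (auto simp: E_def)
      then have "card E \<le> card (\<Union>\<beta>\<in>Bl. {T. T \<subseteq> \<beta> \<and> card T = 4})"
        by (rule card_mono[rotated]) (use Bl(1) fb in auto)
      also have "\<dots> \<le> (\<Sum>\<beta>\<in>Bl. card {T. T \<subseteq> \<beta> \<and> card T = 4})" by (rule card_UN_le[OF Bl(1)])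
      also have "\<dots> \<le> (\<Sum>\<beta>\<in>Bl. card \<beta> ^ 4)"
      proof (rule sum_mono)
        fix \<beta> assume "\<beta> \<in> Bl"
        then have "card {T. T \<subseteq> \<beta> \<and> card T = 4} = card \<beta> choose 4" using fb by (simp add: n_subsets)
        also have "\<dots> \<le> card \<beta> ^ 4" using binomial_le_pow[of 4 "card \<beta>"] by (cases "4 \<le> card \<beta>") (auto simp: binomial_eq_0)
        finally show "card {T. T \<subseteq> \<beta> \<and> card T = 4} \<le> card \<beta> ^ 4" .
      qed
      finally have "real (card E) \<le> real (\<Sum>\<beta>\<in>Bl. card \<beta> ^ 4)" by (rule of_nat_mono)
      then have cE: "real (card E) \<le> C * real (card L) ^ 3" using s4 L(2) by simp
      \<comment> \<open>Rounding up at most doubles \<open>D * N\<close>, since it is at least 1.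
        Hence \<open>n / (2 * q)\<close> is at least \<open>n / (4 * D * N)\<close>, which gives the
        constant \<open>1 / (4 * D)\<close>.\<close>
      define q where "q = nat \<lceil>D * N\<rceil>"
      have DN: "1 \<le> D * N" using D1 N1 by (metis mult_mono mult_1 order_trans zero_le_one)
      have q_ge: "D * N \<le> real q" unfolding q_def by (simp add: real_nat_ceiling_ge)
      have "real q \<le> D * N + 1" unfolding q_def using DN by linarith
      then have q_le: "real q \<le> 2 * D * N" using DN by simp
      have q0: "0 < q" using q_ge DN by (cases "q = 0") auto
      have "2 * C * real (card L) ^ 2 = (D * N) ^ 3" unfolding power_mult_distrib D3 N3 using L(2) by simp
      also have "\<dots> \<le> real q ^ 3" using q_ge DN by (intro power_mono) auto
      finally have q3: "2 * C * real (card L) ^ 2 \<le> real q ^ 3" .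
      obtain S where S: "S \<subseteq> L" "real (card L) / (2 * real q) \<le> card S" "\<forall>T\<in>E. \<not> T \<subseteq> S"
        using independent_set_4_uniform[OF L(1) _ cE q0 q3] unfolding E_def by auto
      have "1 / (4 * D) * real n powr (1/3) \<le> real n / (2 * real q)"
      proof -
        have "real n powr (1/3) * N = real n" unfolding N_def using n1 by (simp flip: powr_add)
        then have "1 / (4 * D) * real n powr (1/3) = real n / (2 * (2 * D * N))" using D1 N1 by (simp add: field_simps)
        also have "\<dots> \<le> real n / (2 * real q)" using q_le q0 D1 N1 by (intro divide_left_mono mult_pos_pos) auto
        finally show ?thesis .
      qed
      then have "1 / (4 * D) * real n powr (1/3) \<le> card S" using S(2) L(2) by simp
      moreover have "\<forall>T\<subseteq>S. card T = 4 \<longrightarrow> \<not> on_common_regulus T" using S(1,3) unfolding E_def by blast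
      ultimately show ?thesis using S(1) by blast
    qed
  qed
  show ?thesis
  proof (intro exI conjI allI impI)
    show "(0::real) < 1" by simp
    show "0 < 1 / (4 * D)" using D1 by simp
    fix n and L :: "space set set"
    assume "finite L \<and> card L = n \<and> (\<forall>l\<in>L. is_line l) \<and> pairwise skew L"
    then show "(\<exists>S\<subseteq>L. real (card S) \<ge> 1 * real n powr (2/3) \<and> on_common_regulus S) \<or>
        (\<exists>S\<subseteq>L. real (card S) \<ge> 1 / (4 * D) * real n powr (1/3) \<and> (\<forall>T\<subseteq>S. card T = 4 \<longrightarrow> \<not> on_common_regulus T))"
      using main by blast
  qed
qed

end
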